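(* For every integer $n>2$ and every $d\in\mathbb{N}$, $$\boldsymbol{\lambda}\big(\mathcal{P}_d(\mathbb{S}^{n-1})\big)=\frac{1}{2\sqrt\pi}\,\frac{\Gamma\big(\frac n2\big)\,\Gamma(d+n)}{\Gamma(n-1)\,\Gamma\big(d+\frac{n+1}{2}\big)}\int_{-1}^{1}\Big|P_d^{(\frac{n-1}{2},\frac{n-1}{2})}(t)\Big|\,(1-t^2)^{\frac{n-3}{2}}\,dt.$$
   Context: $\mathbb{N}=\{1,2,\dots\}$. $\mathbb{S}^{n-1}$ is the Euclidean unit sphere of $\mathbb{R}^n$. $\mathcal{P}_d(\mathbb{S}^{n-1})$ is the space of restrictions to $\mathbb{S}^{n-1}$ of $d$-homogeneous polynomials on $\mathbb{R}^n$ with complex coefficients, a complex Banach space under the supremum norm on $\mathbb{S}^{n-1}$. For $\alpha,\beta>-1$, the Jacobi polynomial $P_d^{(\alpha,\beta)}$ is $$P_d^{(\alpha,\beta)}(t)=\frac{(-1)^d}{2^d d!}(1-t)^{-\alpha}(1+t)^{-\beta}\Big(\frac{d}{dt}\Big)^d\big[(1-t)^{\alpha+d}(1+t)^{\beta+d}\big],$$ i.e. the degree-$d$ polynomial orthogonal on $[-1,1]$ for the weight $(1-t)^\alpha(1+t)^\beta$ to all polynomials of lower degree, normalized by $P_d^{(\alpha,\beta)}(1)=\binom{d+\alpha}{d}$. For a subspace $X$ of a Banach space $Y$, $\boldsymbol{\lambda}(X,Y)=\inf\{\|P\|: P\in\mathcal{L}(Y,X),\ P|_X=\mathrm{id}_X\}$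 (with $\inf\varnothing=\infty$). The (absolute) projection constant of $X$ is $\boldsymbol{\lambda}(X)=\sup\boldsymbol{\lambda}(I(X),Y)$, the supremum over all complex Banach spaces $Y$ and all linear isometric embeddings $I\colon X\to Y$. *)

theory Defs
  imports "HOL-Analysis.Analysis" "HOL-Algebra.Module"
begin

section \<open>Complex Banach spaces on explicit carriers\<close>

text \<open>The projection constant is a supremum over Banach spaces, so these have to be values one
  can quantify over rather than types. They are modules over the field of complex numbers
  together with a norm. The multiplication and unit that the record inherits from rings play no
  role in the module axioms.\<close>

definition complex_field :: "complex ring" where
  "complex_field = \<lparr>carrier = UNIV, monoid.mult = (*), one = 1, zero = 0, add = (+)\<rparr>"

record 'a cnormed = "(complex, 'a) module" +
  nrm :: "'a \<Rightarrow> real"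

locale complex_normed_space = Module.module complex_field Y for Y :: "'a cnormed" (structure) +
  assumes nrm_eq_0_iff: "x \<in> carrier Y \<Longrightarrow> nrm Y x = 0 \<longleftrightarrow> x = \<zero>"
    and nrm_triangle: "\<lbrakk>x \<in> carrier Y; y \<in> carrier Y\<rbrakk> \<Longrightarrow> nrm Y (x \<oplus> y) \<le> nrm Y x + nrm Y y"
    and nrm_smult: "x \<in> carrier Y \<Longrightarrow> nrm Y (c \<odot> x) = cmod c * nrm Y x"

text \<open>Non-negativity of the norm follows from the axioms above on the carrier only. Off the
  carrier the norm is arbitrary, while the library's metric spaces are required to have a
  symmetric, non-negative distance everywhere; hence the truncation of the distance.\<close>

definition nrm_dist :: "'a cnormed \<Rightarrow> 'a \<Rightarrow> 'a \<Rightarrow> real" where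
  "nrm_dist Y x y = (if x \<in> carrier Y \<and> y \<in> carrier Y then nrm Y (x \<ominus>\<^bsub>Y\<^esub> y) else 0)"

locale complex_banach_space = complex_normed_space +
  assumes complete: "Metric_space.mcomplete (carrier Y) (nrm_dist Y)"


section \<open>Projection constants\<close>

definition linear_between :: "'a cnormed \<Rightarrow> 'b cnormed \<Rightarrow> ('a \<Rightarrow> 'b) \<Rightarrow> bool" where
  "linear_between X Y T \<longleftrightarrow> T \<in> carrier X \<rightarrow> carrier Y \<and>
     (\<forall>x\<in>carrier X. \<forall>y\<in>carrier X. T (x \<oplus>\<^bsub>X\<^esub> y) = T x \<oplus>\<^bsub>Y\<^esub> T y) \<and>
     (\<forall>c. \<forall>x\<in>carrier X. T (c \<odot>\<^bsub>X\<^esub> x) = c \<odot>\<^bsub>Y\<^esub> T x)"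

definition bounded_linear_between :: "'a cnormed \<Rightarrow> 'b cnormed \<Rightarrow> ('a \<Rightarrow> 'b) \<Rightarrow> bool" where
  "bounded_linear_between X Y T \<longleftrightarrow> linear_between X Y T \<and>
     (\<exists>C. \<forall>x\<in>carrier X. nrm Y (T x) \<le> C * nrm X x)"

definition op_norm :: "'a cnormed \<Rightarrow> 'b cnormed \<Rightarrow> ('a \<Rightarrow> 'b) \<Rightarrow> real" where
  "op_norm X Y T = (SUP x\<in>{x \<in> carrier X. nrm X x \<le> 1}. nrm Y (T x))"

definition isometric_embedding :: "'a cnormed \<Rightarrow> 'b cnormed \<Rightarrow> ('a \<Rightarrow> 'b) \<Rightarrow> bool" where
  "isometric_embedding X Y J \<longleftrightarrow> linear_between X Y J \<and> (\<forall>x\<in>carrier X. nrm Y (J x) = nrm X x)"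

text \<open>A subspace of \<open>Y\<close> is given by its carrier \<open>S\<close>; the infimum of the empty set is
  \<open>\<infinity>\<close> in the extended reals.\<close>

definition relative_projection_constant :: "'a cnormed \<Rightarrow> 'a set \<Rightarrow> ereal" where
  "relative_projection_constant Y S =
     (INF P\<in>{P. bounded_linear_between Y (Y\<lparr>carrier := S\<rparr>) P \<and> (\<forall>x\<in>S. P x = x)}.
        ereal (op_norm Y (Y\<lparr>carrier := S\<rparr>) P))"

text \<open>No definition in HOL can range over the Banach spaces of all types at once. The supremum
  is therefore taken over all Banach spaces whose elements lie in the type \<open>'u\<close>, and statements
  are to be made for arbitrarily large \<open>'u\<close>.\<close>

definition projection_constant :: "'u itself \<Rightarrow> 'a cnormed \<Rightarrow> ereal" where
  "projection_constant _ X =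
     (SUP (Y, J)\<in>{(Y :: 'u cnormed, J). complex_banach_space Y \<and> isometric_embedding X Y J}.
        relative_projection_constant Y (J ` carrier X))"


section \<open>Homogeneous polynomials on the sphere\<close>

text \<open>Polynomials are given by their coefficients, indexed by the multi-indices \<open>a\<close> of
  order \<open>d\<close>.\<close>

definition homogeneous_polynomials :: "nat \<Rightarrow> (real ^ 'n \<Rightarrow> complex) set" where
  "homogeneous_polynomials d =
     {f. \<exists>c :: ('n \<Rightarrow> nat) \<Rightarrow> complex.
        f = (\<lambda>x. \<Sum>a | (\<Sum>i\<in>UNIV. a i) = d. c a * of_real (\<Prod>i\<in>UNIV. (x $ i) ^ a i))}"

definition sphere_polynomials :: "nat \<Rightarrow> (real ^ 'n \<Rightarrow> complex) cnormed" where
  "sphere_polynomials d =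
     \<lparr>carrier = (\<lambda>f. restrict f (sphere 0 1)) ` homogeneous_polynomials d,
      monoid.mult = undefined, one = undefined,
      zero = (\<lambda>x\<in>sphere 0 1. 0),
      add = (\<lambda>f g. \<lambda>x\<in>sphere 0 1. f x + g x),
      module.smult = (\<lambda>c f. \<lambda>x\<in>sphere 0 1. c * f x),
      nrm = (\<lambda>f. SUP x\<in>sphere 0 1. cmod (f x))\<rparr>"


section \<open>Jacobi polynomials\<close>

definition rodrigues :: "real \<Rightarrow> real \<Rightarrow> nat \<Rightarrow> real \<Rightarrow> real" where
  "rodrigues \<alpha> \<beta> d t = (- 1) ^ d / (2 ^ d * fact d) * (1 - t) powr (- \<alpha>) * (1 + t) powr (- \<beta>) *
     (deriv ^^ d) (\<lambda>s. (1 - s) powr (\<alpha> + real d) * (1 + s) powr (\<beta> + real d)) t"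

text \<open>Rodrigues' formula is meaningful as it stands only for \<open>-1 < t < 1\<close>, where it
  agrees with a polynomial.\<close>

lemma rodrigues_deriv:
  fixes a b :: real
  shows "\<exists>q. \<forall>t\<in>{-1<..<1}. (deriv ^^ k) (\<lambda>s. (1 - s) powr a * (1 + s) powr b) t =
           (1 - t) powr (a - real k) * (1 + t) powr (b - real k) * poly q t"
proof (induction k)
  case 0
  show ?case by (intro exI[of _ 1]) simp
next
  case (Suc k)
  let ?g = "\<lambda>s. (1 - s) powr a * (1 + s) powr b"
  obtain q where q: "\<And>t. t \<in> {-1<..<1} \<Longrightarrow> (deriv ^^ k) ?g t =
      (1 - t) powr (a - real k) * (1 + t) powr (b - real k) * poly q t"
    using Suc by blast
  define r where "r = [:- (a - real k), - (a - real k):] * q + [:b - real k, - (b - real k):] * q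
      + [:1, 0, -1:] * pderiv q"
  show ?case
  proof (intro exI[of _ r] ballI)
    fix t :: real assume t: "t \<in> {-1<..<1}"
    let ?u = "a - real k" and ?v = "b - real k"
    have e: "(1 - t) powr ?u = (1 - t) powr (?u - 1) * (1 - t)"
            "(1 + t) powr ?v = (1 + t) powr (?v - 1) * (1 + t)"
      using t by (simp_all add: powr_diff)
    have "((\<lambda>s. (1 - s) powr ?u * (1 + s) powr ?v * poly q s) has_field_derivative
        (- ?u * (1 - t) powr (?u - 1)) * (1 + t) powr ?v * poly q t
        + (1 - t) powr ?u * (?v * (1 + t) powr (?v - 1)) * poly q t
        + (1 - t) powr ?u * (1 + t) powr ?v * poly (pderiv q) t) (at t)"
      using t by (auto intro!: derivative_eq_intros poly_DERIV simp: algebra_simps)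
    also have "(- ?u * (1 - t) powr (?u - 1)) * (1 + t) powr ?v * poly q t
        + (1 - t) powr ?u * (?v * (1 + t) powr (?v - 1)) * poly q t
        + (1 - t) powr ?u * (1 + t) powr ?v * poly (pderiv q) t
        = (1 - t) powr (?u - 1) * (1 + t) powr (?v - 1) * poly r t"
      unfolding e r_def by (simp add: algebra_simps)
    finally have "((deriv ^^ k) ?g has_field_derivative
        (1 - t) powr (?u - 1) * (1 + t) powr (?v - 1) * poly r t) (at t)"
      by (rule has_field_derivative_transform_within_open[where S = "{-1<..<1}"])
         (use t q in auto)
    then show "(deriv ^^ Suc k) ?g t =
        (1 - t) powr (a - real (Suc k)) * (1 + t) powr (b - real (Suc k)) * poly r t"
      by (auto dest!: DERIV_imp_deriv simp: diff_diff_eq add.commute)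
  qed
qed

definition jacobi_poly :: "real \<Rightarrow> real \<Rightarrow> nat \<Rightarrow> real poly" where
  "jacobi_poly \<alpha> \<beta> d = (THE p. \<forall>t\<in>{-1<..<1}. poly p t = rodrigues \<alpha> \<beta> d t)"

lemma poly_jacobi_poly:
  assumes "t \<in> {-1<..<1}"
  shows "poly (jacobi_poly \<alpha> \<beta> d) t = rodrigues \<alpha> \<beta> d t"
proof -
  obtain q where q: "\<And>t. t \<in> {-1<..<1} \<Longrightarrow>
      (deriv ^^ d) (\<lambda>s. (1 - s) powr (\<alpha> + real d) * (1 + s) powr (\<beta> + real d)) t =
        (1 - t) powr \<alpha> * (1 + t) powr \<beta> * poly q t"
    using rodrigues_deriv[of d "\<alpha> + real d" "\<beta> + real d"] by auto
  define p where "p = Polynomial.smult ((- 1) ^ d / (2 ^ d * fact d)) q"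
  have p: "\<forall>t\<in>{-1<..<1}. poly p t = rodrigues \<alpha> \<beta> d t"
  proof
    fix t :: real assume t: "t \<in> {-1<..<1}"
    have "(1 - t) powr (- \<alpha>) * (1 - t) powr \<alpha> = 1" "(1 + t) powr (- \<beta>) * (1 + t) powr \<beta> = 1"
      using t by (simp_all flip: powr_add)
    moreover have "rodrigues \<alpha> \<beta> d t = poly p t *
        ((1 - t) powr (- \<alpha>) * (1 - t) powr \<alpha>) * ((1 + t) powr (- \<beta>) * (1 + t) powr \<beta>)"
      unfolding rodrigues_def q[OF t] p_def poly_smult by (simp only: mult_ac)
    ultimately show "poly p t = rodrigues \<alpha> \<beta> d t" by simp
  qed
  have "p' = p" if "\<forall>t\<in>{-1<..<1}. poly p' t = rodrigues \<alpha> \<beta> d t" for p'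
  proof (rule ccontr)
    assume "p' \<noteq> p"
    then have "finite {t. poly (p' - p) t = 0}"
      by (intro poly_roots_finite) simp
    moreover have "{-1<..<1} \<subseteq> {t. poly (p' - p) t = 0}"
      using p that by auto
    ultimately have "finite {-1<..<1::real}"
      by (rule rev_finite_subset)
    then show False by (simp add: infinite_Ioo)
  qed
  then have "\<forall>t\<in>{-1<..<1}. poly (jacobi_poly \<alpha> \<beta> d) t = rodrigues \<alpha> \<beta> d t"
    unfolding jacobi_poly_def using p
    by (intro theI[where P = "\<lambda>p. \<forall>t\<in>{-1<..<1}. poly p t = rodrigues \<alpha> \<beta> d t" and a = p])
  then show ?thesis using assms by blast
qed

end

theory Submission
  imports Defs
begin

text \<open>The kernel \<open>\<kappa>(x \<cdot> y)\<close>, with \<open>\<kappa>\<close> the suitably scaled Jacobi polynomial, reproduces the spherical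
  polynomials of degree \<open>d\<close>: by rotation invariance, integrals of \<open>\<psi>(x \<cdot> y) (x \<cdot> u)\<^sup>2\<^sup>k\<close> for orthonormal
  \<open>y\<close>, \<open>u\<close> reduce to integrals of \<open>\<psi>(t) (1 - t\<^sup>2)\<^sup>k\<close> against the weight \<open>(1 - t\<^sup>2)\<^sup>p\<close>, \<open>p = (n - 3) / 2\<close>, so
  that the reproducing property becomes the orthogonality of the Jacobi polynomial together with
  one Beta integral. Both bounds identify the projection constant with \<open>\<integral> \<bar>\<kappa>(x \<cdot> y)\<bar> dx\<close>.

  Upper bound: for an isometric embedding \<open>J\<close> into \<open>Y\<close>, the functional \<open>J \<circ> G \<mapsto> \<integral> G(z)(z) dz\<close> is
  dominated by the upper integral of \<open>\<parallel>F(z)\<parallel>\<close> on bounded functions \<open>F\<close> from the sphere to \<open>Y\<close>. With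
  a Hahn-Banach extension \<open>\<Phi>\<close> of it, \<open>y \<mapsto> J (x \<mapsto> \<Phi>(z \<mapsto> \<kappa>(x \<cdot> z) y))\<close> is a projection of the required norm.

  Lower bound: for any projection \<open>P\<close> and any polynomial \<open>\<phi>\<close> with \<open>\<bar>\<phi>\<bar> \<le> 1\<close> on \<open>[-1, 1]\<close>, the average
  over \<open>x\<close> of \<open>P(\<phi>(x \<cdot> _))(x)\<close> is at most \<open>\<parallel>P\<parallel>\<close>, and it is the trace of the convolution with \<open>\<phi>\<close>,
  that is \<open>\<integral> \<phi>(x \<cdot> y) \<kappa>(x \<cdot> y) dx\<close>, whatever \<open>P\<close> is. Let \<open>\<phi>\<close> approach the sign of \<open>\<kappa>\<close>.\<close>

section \<open>Symmetric Jacobi polynomials\<close>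

text \<open>The measure on [-1, 1] has exponent p = (n - 3) / 2, yet the Jacobi parameter is p + 1.
  The reason: a polynomial f of degree at most d with the parity of d is f(1) t^d plus some (1 -
  t^2) g with g of degree at most d - 2. Reproducing the value at 1 therefore means orthogonality to
  all such g for the exponent p + 1, together with one normalization on t^d. In the upper bound,
  extending each evaluation J f -> f(z) to Y separately would give functionals that depend on z in
  no measurable way and cannot be integrated against the kernel. A single extension on functions
  with values in Y replaces the family and its integral at once. In the lower bound, convolution
  with \<phi> sends the polynomials into themselves, where P is the identity, so the trace does not
  see P. Using one test function per point x replaces the averaging of P over the rotation group and
  needs integrals over the sphere only. All kernels are finite sums of products g(x) h(z), so that
  exchanging integrals, or moving \<Phi> or P past them, is a matter of finite linearity.\<close>

lemma weight_Suc: "(1 - t\<^sup>2) powr (p + 1) = (1 - t\<^sup>2) * (1 - t\<^sup>2) powr p" if "t \<in> {-1..1}" for t p :: real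
proof -
  have "\<bar>t\<bar> \<le> 1" using that by auto
  then have "t\<^sup>2 \<le> 1" by (simp add: abs_square_le_1)
  then show ?thesis by (cases "t\<^sup>2 = 1") (simp_all add: powr_add)
qed

lemma weight_pos: "0 < 1 - t\<^sup>2" if "t \<in> {-1<..<1}" for t :: real
proof -
  have "\<bar>t\<bar> < 1" using that by auto
  then show ?thesis by (simp add: abs_square_less_1)
qed

lemma continuous_on_weight: "0 < p \<Longrightarrow> continuous_on {-1..1} (\<lambda>t::real. (1 - t\<^sup>2) powr p)"
  by (intro continuous_on_powr' continuous_intros) (auto simp: abs_square_le_1)

text \<open>The case p = 0 (that is, n = 3) is separate because \<open>0 powr 0\<close> is 0: the
  weight then drops from 1 to 0 at the endpoints and is not continuous on the closed interval.
  Changing it at two points does not affect integrability.\<close>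

lemma integrable_weight:
  fixes g :: "real \<Rightarrow> real"
  assumes "0 \<le> p" and g: "continuous_on {-1..1} g"
  shows "(\<lambda>t. g t * (1 - t\<^sup>2) powr p) integrable_on {-1..1}"
proof (cases "p = 0")
  case True
  have "g integrable_on {-1..1}"
    using g by (rule integrable_continuous_real)
  moreover have "g t * (1 - t\<^sup>2) powr p = g t" if "t \<in> {-1..1} - {-1, 1}" for t
  proof -
    have "t \<in> {-1<..<1}" using that by auto
    from weight_pos[OF this] show ?thesis using True by simp
  qed
  ultimately show ?thesis
    using integrable_spike[of g "{-1..1}" "{-1, 1}" "\<lambda>t. g t * (1 - t\<^sup>2) powr p"] by blast
next
  case False
  then show ?thesis
    using assms by (intro integrable_continuous_real continuous_intros continuous_on_weight) auto
qed

text \<open>The function t^(k+1) (1 - t^2)^(p+1) vanishes at both endpoints, so its derivative has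
  integral 0; the two terms of that derivative are the two sides.\<close>

lemma weight_moment_rec:
  assumes "0 \<le> p"
  shows "real (k + 1) * integral {-1..1} (\<lambda>t. t ^ k * (1 - t\<^sup>2) powr (p + 1)) =
    2 * (p + 1) * integral {-1..1} (\<lambda>t. t ^ (k + 2) * (1 - t\<^sup>2) powr p)"
proof -
  let ?f = "\<lambda>t::real. real (k + 1) * (t ^ k * (1 - t\<^sup>2) powr (p + 1))
     - 2 * (p + 1) * (t ^ (k + 2) * (1 - t\<^sup>2) powr p)"
  have "(?f has_integral (1 ^ (k + 1) * (1 - 1\<^sup>2) powr (p + 1)
      - (- 1) ^ (k + 1) * (1 - (- 1)\<^sup>2) powr (p + 1))) {-1..1}"
  proof (rule fundamental_theorem_of_calculus_interior)
    show "continuous_on {-1..1} (\<lambda>t::real. t ^ (k + 1) * (1 - t\<^sup>2) powr (p + 1))"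
      using assms by (intro continuous_intros continuous_on_weight) auto
    fix t :: real assume t: "t \<in> {-1<..<1}"
    show "((\<lambda>t::real. t ^ (k + 1) * (1 - t\<^sup>2) powr (p + 1)) has_vector_derivative ?f t) (at t)"
    proof -
      have "((\<lambda>t::real. t ^ (k + 1)) has_field_derivative real (k + 1) * t ^ k) (at t)"
        using DERIV_pow[of "k + 1" t] by simp
      moreover have "((\<lambda>t::real. (1 - t\<^sup>2) powr (p + 1)) has_field_derivative
          (p + 1) * (1 - t\<^sup>2) powr p * (- 2 * t)) (at t)"
        using weight_pos[OF t] by (auto intro!: derivative_eq_intros)
      ultimately show ?thesis
        unfolding has_real_derivative_iff_has_vector_derivative [symmetric]
        by (rule DERIV_cong[OF DERIV_mult]) (simp add: algebra_simps power2_eq_square)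
    qed
  qed simp
  then have "integral {-1..1} ?f = 0"
    by (simp add: integral_unique)
  moreover have "(\<lambda>t::real. t ^ k * (1 - t\<^sup>2) powr (p + 1)) integrable_on {-1..1}"
    "(\<lambda>t::real. t ^ (k + 2) * (1 - t\<^sup>2) powr p) integrable_on {-1..1}"
    using assms by (intro integrable_weight continuous_intros; simp)+
  ultimately have "0 = integral {-1..1} (\<lambda>t. real (k + 1) * (t ^ k * (1 - t\<^sup>2) powr (p + 1)))
      - integral {-1..1} (\<lambda>t. 2 * (p + 1) * (t ^ (k + 2) * (1 - t\<^sup>2) powr p))"
    by (subst integral_diff[symmetric]) (simp_all add: integrable_on_mult_right del: of_nat_add power_Suc)
  then show ?thesis
    by (simp only: integral_mult_right)
qed

text \<open>The polynomials \<open>q\<^sub>k\<close> with \<open>(d/dt)\<^sup>k (1 - t\<^sup>2)\<^sup>b = (1 - t\<^sup>2)\<^sup>b\<^sup>-\<^sup>k q\<^sub>k(t)\<close>.\<close>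

primrec rodrigues_poly :: "real \<Rightarrow> nat \<Rightarrow> real poly" where
  "rodrigues_poly b 0 = 1"
| "rodrigues_poly b (Suc k) =
    Polynomial.smult (- 2 * (b - real k)) (pCons 0 (rodrigues_poly b k))
    + (pderiv (rodrigues_poly b k) - pCons 0 (pCons 0 (pderiv (rodrigues_poly b k))))"

lemma coeff_rodrigues_poly:
  "coeff (rodrigues_poly b k) i \<noteq> 0 \<Longrightarrow> i \<le> k \<and> even (k + i)"
proof (induction k arbitrary: i)
  case 0
  then show ?case by (auto simp: coeff_1 split: if_splits)
next
  case (Suc k)
  consider "i > 0" "coeff (rodrigues_poly b k) (i - 1) \<noteq> 0"
    | "coeff (rodrigues_poly b k) (Suc i) \<noteq> 0"
    | "i > 1" "coeff (rodrigues_poly b k) (i - 1) \<noteq> 0"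
    using Suc.prems by (force simp: coeff_pCons coeff_pderiv split: nat.splits)
  then show ?case
    by cases (use Suc.IH in \<open>force\<close>)+
qed

lemma poly_rodrigues_poly_uminus:
  "poly (rodrigues_poly b k) (- t) = (- 1) ^ k * poly (rodrigues_poly b k) t"
proof -
  have "coeff (rodrigues_poly b k) i * (- t) ^ i
      = (- 1) ^ k * (coeff (rodrigues_poly b k) i * t ^ i)" for i
    using coeff_rodrigues_poly[of b k i]
    by (cases "coeff (rodrigues_poly b k) i = 0") (auto simp: power_minus' power_minus_odd)
  then have "(\<Sum>i\<le>degree (rodrigues_poly b k). coeff (rodrigues_poly b k) i * (- t) ^ i)
    = (\<Sum>i\<le>degree (rodrigues_poly b k). (- 1) ^ k * (coeff (rodrigues_poly b k) i * t ^ i))"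
    by (intro sum.cong refl)
  then show ?thesis
    by (simp only: poly_altdef sum_distrib_left)
qed

lemma has_derivative_rodrigues_poly:
  assumes "t \<in> {-1<..<1}"
  shows "((\<lambda>s. (1 - s\<^sup>2) powr (b - real k) * poly (rodrigues_poly b k) s) has_field_derivative
    (1 - t\<^sup>2) powr (b - real (Suc k)) * poly (rodrigues_poly b (Suc k)) t) (at t)"
proof -
  have e: "(1 - t\<^sup>2) powr (b - real k) = (1 - t\<^sup>2) powr (b - real (Suc k)) * (1 - t\<^sup>2)"
    using weight_pos[OF assms] powr_add[of "1 - t\<^sup>2" "b - real (Suc k)" 1] by simp
  have f: "b - real k - 1 = b - real (Suc k)" by simp
  have "((\<lambda>s. (1 - s\<^sup>2) powr (b - real k) * poly (rodrigues_poly b k) s) has_field_derivative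
     ((b - real k) * (1 - t\<^sup>2) powr (b - real k - 1) * (- 2 * t)) * poly (rodrigues_poly b k) t
     + (1 - t\<^sup>2) powr (b - real k) * poly (pderiv (rodrigues_poly b k)) t) (at t)"
    using weight_pos[OF assms]
    by (auto intro!: derivative_eq_intros poly_DERIV simp: algebra_simps)
  also have "((b - real k) * (1 - t\<^sup>2) powr (b - real k - 1) * (- 2 * t)) * poly (rodrigues_poly b k) t
     + (1 - t\<^sup>2) powr (b - real k) * poly (pderiv (rodrigues_poly b k)) t
     = (1 - t\<^sup>2) powr (b - real (Suc k)) * poly (rodrigues_poly b (Suc k)) t"
    unfolding e f by (simp add: algebra_simps power2_eq_square)
  finally show ?thesis .
qed

lemma higher_deriv_weight:
  assumes "t \<in> {-1<..<1}"
  shows "(deriv ^^ k) (\<lambda>s::real. (1 - s) powr b * (1 + s) powr b) t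
    = (1 - t\<^sup>2) powr (b - real k) * poly (rodrigues_poly b k) t"
  using assms
proof (induction k arbitrary: t)
  case 0
  then have "(1 - t) powr b * (1 + t) powr b = ((1 - t) * (1 + t)) powr b"
    by (simp add: powr_mult)
  also have "(1 - t) * (1 + t) = 1 - t\<^sup>2"
    by (simp add: algebra_simps power2_eq_square)
  finally show ?case by simp
next
  case (Suc k)
  have "((deriv ^^ k) (\<lambda>s. (1 - s) powr b * (1 + s) powr b) has_field_derivative
    (1 - t\<^sup>2) powr (b - real (Suc k)) * poly (rodrigues_poly b (Suc k)) t) (at t)"
    by (rule has_field_derivative_transform_within_open[where S = "{-1<..<1}",
          OF has_derivative_rodrigues_poly])
       (use Suc in auto)
  then show ?case by (auto dest: DERIV_imp_deriv)
qed

text \<open>Starting from the exponent \<alpha> + d, the derivative of order d leaves the factor (1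
  - t^2)^\<alpha>, which the prefactor of Rodrigues' formula cancels. Agreement on the infinite set
  ]-1, 1[ then gives equality of polynomials.\<close>

lemma jacobi_poly_symmetric:
  "jacobi_poly \<alpha> \<alpha> d =
    Polynomial.smult ((- 1) ^ d / (2 ^ d * fact d)) (rodrigues_poly (\<alpha> + real d) d)"
    (is "_ = ?p")
proof (rule ccontr)
  assume "jacobi_poly \<alpha> \<alpha> d \<noteq> ?p"
  then have "finite {t. poly (jacobi_poly \<alpha> \<alpha> d - ?p) t = 0}"
    by (intro poly_roots_finite) simp
  moreover have "{-1<..<1} \<subseteq> {t. poly (jacobi_poly \<alpha> \<alpha> d - ?p) t = 0}"
  proof safe
    fix t :: real assume t: "t \<in> {-1<..<1}"
    have u: "(1 - t) powr (- \<alpha>) * (1 + t) powr (- \<alpha>) = (1 - t\<^sup>2) powr (- \<alpha>)"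
      using t by (simp flip: powr_mult add: algebra_simps power2_eq_square)
    have "(1 - t\<^sup>2) powr (- \<alpha>) * (1 - t\<^sup>2) powr \<alpha> = 1"
      using weight_pos[OF t] by (simp flip: powr_add)
    then have v: "(1 - t\<^sup>2) powr (- \<alpha>) * ((1 - t\<^sup>2) powr \<alpha> * x) = x" for x
      by (simp flip: mult.assoc)
    have "rodrigues \<alpha> \<alpha> d t = (- 1) ^ d / (2 ^ d * fact d) * (((1 - t) powr (- \<alpha>) * (1 + t) powr (- \<alpha>)) *
        (deriv ^^ d) (\<lambda>s. (1 - s) powr (\<alpha> + real d) * (1 + s) powr (\<alpha> + real d)) t)"
      unfolding rodrigues_def by (simp only: mult.assoc)
    also have "\<dots> = poly ?p t"
      unfolding u higher_deriv_weight[OF t] by (simp add: v)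
    finally show "poly (jacobi_poly \<alpha> \<alpha> d - ?p) t = 0"
      using poly_jacobi_poly[OF t] by simp
  qed
  ultimately have "finite {-1<..<1::real}"
    by (rule rev_finite_subset)
  then show False by (simp add: infinite_Ioo)
qed

text \<open>\<open>?D (Suc k)\<close> is the derivative of \<open>?D k\<close>, so each integration
  by parts moves one derivative onto R, and the boundary terms vanish because the exponent of 1 -
  t^2 stays positive. The alternative R = 0 covers the derivative of a constant and is all that
  remains for k = 0.\<close>

lemma rodrigues_poly_orthogonal:
  assumes "R = 0 \<or> degree R < k" and "real k < b"
  shows "integral {-1..1} (\<lambda>t. poly (rodrigues_poly b k) t * poly R t * (1 - t\<^sup>2) powr (b - real k)) = 0"
  using assms
proof (induction k arbitrary: R)
  case 0
  then show ?case by simp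
next
  case (Suc k)
  let ?D = "\<lambda>k t. poly (rodrigues_poly b k) t * (1 - t\<^sup>2) powr (b - real k)"
  have "((\<lambda>t. ?D (Suc k) t * poly R t + ?D k t * poly (pderiv R) t) has_integral
     (?D k 1 * poly R 1 - ?D k (- 1) * poly R (- 1))) {-1..1}"
  proof (rule fundamental_theorem_of_calculus_interior)
    show "continuous_on {-1..1} (\<lambda>t. ?D k t * poly R t)"
      using Suc.prems by (intro continuous_intros continuous_on_weight) auto
    fix t :: real assume t: "t \<in> {-1<..<1}"
    show "((\<lambda>t. ?D k t * poly R t) has_vector_derivative
        (?D (Suc k) t * poly R t + ?D k t * poly (pderiv R) t)) (at t)"
      unfolding has_real_derivative_iff_has_vector_derivative [symmetric]
      using DERIV_mult[OF has_derivative_rodrigues_poly[OF t, of b k] poly_DERIV[of R t]]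
      by (simp add: mult_ac add.commute)
  qed simp
  then have "integral {-1..1} (\<lambda>t. ?D (Suc k) t * poly R t + ?D k t * poly (pderiv R) t) = 0"
    by (simp add: integral_unique)
  moreover have "(\<lambda>t. ?D (Suc k) t * poly R t) integrable_on {-1..1}"
    using integrable_weight[of "b - real (Suc k)" "\<lambda>t. poly (rodrigues_poly b (Suc k)) t * poly R t"]
      Suc.prems by (simp add: continuous_intros mult_ac)
  moreover have "(\<lambda>t. ?D k t * poly (pderiv R) t) integrable_on {-1..1}"
    using integrable_weight[of "b - real k" "\<lambda>t. poly (rodrigues_poly b k) t * poly (pderiv R) t"]
      Suc.prems by (simp add: continuous_intros mult_ac)
  moreover have "integral {-1..1} (\<lambda>t. ?D k t * poly (pderiv R) t) = 0"
  proof -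
    have "pderiv R = 0 \<or> degree (pderiv R) < k"
      using Suc.prems degree_pderiv[of R] by (cases "degree R = 0") (auto simp: pderiv_eq_0_iff)
    then show ?thesis
      using Suc.IH[of "pderiv R"] Suc.prems by (simp add: mult_ac)
  qed
  ultimately show ?case
    by (simp add: integral_add mult_ac)
qed

text \<open>Integrating \<open>d\<close> times by parts against \<open>1 / (1 - t)\<close>, whose \<open>d\<close>-th derivative
  turns the integral into a Beta integral.\<close>

lemma integral_rodrigues_poly_Beta:
  assumes "1 \<le> a"
  shows "integral {-1..1} (\<lambda>t. poly (rodrigues_poly (a + real d) d) t * (1 + t) * (1 - t\<^sup>2) powr (a - 1))
    = (- 1) ^ d * fact d * 2 powr (2 * a + real d) * Beta (a + real d + 1) a"
proof -
  let ?B = "2 powr (2 * a + real d) * Beta (a + real d + 1) a"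
  define b where "b = a + real d"
  \<comment> \<open>\<open>H k\<close> is the k-th derivative of (1 - t^2)^b times (1 -
    t)^(-(d-k+1)); the second factor is, up to a factorial, the derivative of order d - k of 1 / (1
    - t). Merging the powers of 1 - t leaves the exponent a - 1, which is not negative.
    \<open>H 0\<close> is a Beta integrand and \<open>H d\<close> the integrand of the
    lemma.\<close>
  define H where "H k t = (1 - t) powr (a - 1) * (1 + t) powr (b - real k) * poly (rodrigues_poly b k) t"
    for k t
  have Beta: "(H 0 has_integral ?B) {-1..1}"
  proof -
    have "((\<lambda>t. t powr ((b + 1) - 1) * (1 - t) powr (a - 1)) has_integral Beta (b + 1) a) {0..1}"
      using assms by (intro has_integral_Beta_real) (auto simp: b_def)
    moreover have "(\<lambda>x::real. (1 / 2) *\<^sub>R x + - ((1 / 2) *\<^sub>R - 1)) ` {-1..1} = {0..1}"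
      using image_affinity_atLeastAtMost[of "1/2" "1/2" "-1::real" 1] by simp
    moreover have "(\<lambda>x::real. (1 / (1/2)) *\<^sub>R x + - ((1 / (1/2)) *\<^sub>R (1/2))) ` {0..1} = {-1..1}"
      using image_affinity_atLeastAtMost[of 2 "-1" "0::real" 1] by simp
    ultimately have "((\<lambda>t. (1/2 * t + 1/2) powr b * (1 - (1/2 * t + 1/2)) powr (a - 1))
        has_integral 2 * Beta (b + 1) a) {-1..1}"
      using has_integral_affinity[of "\<lambda>t. t powr b * (1 - t) powr (a - 1)" "Beta (b + 1) a" 0 1 "1/2" "1/2"]
      by simp
    moreover have "1/2 * t + 1/2 = (1 + t) / 2" "1 - (1/2 * t + 1/2) = (1 - t) / 2" for t :: real
      by (simp_all add: field_simps)
    ultimately have "((\<lambda>t. ((1 + t) / 2) powr b * ((1 - t) / 2) powr (a - 1)) has_integral 2 * Beta (b + 1) a) {-1..1}"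
      by (simp only:)
    then have "((\<lambda>t. 2 powr (a - 1 + b) * (((1 + t) / 2) powr b * ((1 - t) / 2) powr (a - 1)))
        has_integral 2 powr (a - 1 + b) * (2 * Beta (b + 1) a)) {-1..1}"
      by (rule has_integral_mult_right)
    then have "(H 0 has_integral 2 powr (a - 1 + b) * (2 * Beta (b + 1) a)) {-1..1}"
      by (rule has_integral_eq[rotated]) (simp add: H_def powr_divide powr_add)
    also have "2 powr (a - 1 + b) * (2 * Beta (b + 1) a) = 2 powr (a - 1 + b + 1) * Beta (b + 1) a"
      by (simp only: powr_add) simp
    finally show ?thesis
      by (simp add: b_def algebra_simps)
  qed
  have step: "k \<le> d \<Longrightarrow> (H k has_integral (- 1) ^ k * (fact d / fact (d - k)) *
      ?B) {-1..1}" for k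
  proof (induction k)
    case 0
    then show ?case using Beta by simp
  next
    case (Suc k)
    \<comment> \<open>The product to be differentiated in one integration by parts: the k-th
      derivative of (1 - t^2)^b times (1 - t)^(-(d-k)). Both remaining exponents are positive, so it
      vanishes at the endpoints.\<close>
    define G where "G t = (1 - t) powr a * (1 + t) powr (b - real k) * poly (rodrigues_poly b k) t" for t
    have bk: "b - real k > 0" "a > 0" using Suc.prems assms by (auto simp: b_def)
    have "((\<lambda>t. H (Suc k) t + real (d - k) * H k t) has_integral (G 1 - G (- 1))) {-1..1}"
    proof (rule fundamental_theorem_of_calculus_interior)
      show "continuous_on {-1..1} G"
        unfolding G_def using bk
        by (intro continuous_intros continuous_on_powr') auto
      fix t :: real assume t: "t \<in> {-1<..<1}"
      have e: "(1 - t) powr a = (1 - t) powr (a - 1) * (1 - t)"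
        "(1 + t) powr (b - real k) = (1 + t) powr (b - real (Suc k)) * (1 + t)"
        using t powr_add[of "1 - t" "a - 1" 1] powr_add[of "1 + t" "b - real (Suc k)" 1] by auto
      have f: "b - real k - 1 = b - real (Suc k)" by simp
      have g: "real (d - k) = b - a - real k"
        using Suc.prems by (simp add: b_def)
      have "(G has_field_derivative (- a * (1 - t) powr (a - 1)) * (1 + t) powr (b - real k) * poly (rodrigues_poly b k) t
        + (1 - t) powr a * ((b - real k) * (1 + t) powr (b - real k - 1)) * poly (rodrigues_poly b k) t
        + (1 - t) powr a * (1 + t) powr (b - real k) * poly (pderiv (rodrigues_poly b k)) t) (at t)"
        unfolding G_def using t
        by (auto intro!: derivative_eq_intros poly_DERIV simp: algebra_simps)
      also have "(- a * (1 - t) powr (a - 1)) * (1 + t) powr (b - real k) * poly (rodrigues_poly b k) t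
        + (1 - t) powr a * ((b - real k) * (1 + t) powr (b - real k - 1)) * poly (rodrigues_poly b k) t
        + (1 - t) powr a * (1 + t) powr (b - real k) * poly (pderiv (rodrigues_poly b k)) t
        = H (Suc k) t + real (d - k) * H k t"
        unfolding H_def e f g by (simp add: algebra_simps)
      finally show "(G has_vector_derivative (H (Suc k) t + real (d - k) * H k t)) (at t)"
        unfolding has_real_derivative_iff_has_vector_derivative [symmetric] .
    qed simp
    also have "G 1 - G (- 1) = 0"
      using bk by (simp add: G_def)
    finally have "((\<lambda>t. H (Suc k) t + real (d - k) * H k t) has_integral 0) {-1..1}" .
    from has_integral_diff[OF this has_integral_mult_right[OF Suc.IH, of "real (d - k)"]]
    have "(H (Suc k) has_integral - (real (d - k) * ((- 1) ^ k * (fact d / fact (d - k)) *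
      ?B))) {-1..1}"
      using Suc.prems by simp
    moreover
    have dk: "d - k = Suc (d - Suc k)" using Suc.prems by simp
    have "real (d - k) * (fact d / fact (d - k)) = fact d / (fact (d - Suc k) :: real)"
      unfolding dk by (simp del: of_nat_Suc)
    moreover have "- (r * (s * x * y)) = (- 1 * s) * (r * x) * y" for r s x y :: real
      by simp
    ultimately have "(H (Suc k) has_integral (- 1 * (- 1) ^ k) * (fact d / fact (d - Suc k)) *
      ?B) {-1..1}"
      by (simp only:)
    then show ?case by (simp only: power_Suc)
  qed
  have "integral {-1..1} (\<lambda>t. poly (rodrigues_poly b d) t * (1 + t) * (1 - t\<^sup>2) powr (a - 1))
     = integral {-1..1} (H d)"
  proof (rule integral_cong)
    fix t :: real assume t: "t \<in> {-1..1}"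
    have "1 - t\<^sup>2 = (1 - t) * (1 + t)" by (simp add: algebra_simps power2_eq_square)
    moreover have "(1 + t) powr a = (1 + t) * (1 + t) powr (a - 1)"
      using t powr_add[of "1 + t" 1 "a - 1"] by (cases "t = -1") auto
    ultimately show "poly (rodrigues_poly b d) t * (1 + t) * (1 - t\<^sup>2) powr (a - 1) = H d t"
      using t by (simp add: H_def b_def powr_mult)
  qed
  then show ?thesis
    using integral_unique[OF step[of d]] by (simp add: b_def mult_ac)
qed

section \<open>The normalizing moment and the constant of the theorem\<close>

lemma integral_odd_eq_0:
  fixes f :: "real \<Rightarrow> real"
  assumes "\<And>t. f (- t) = - f t"
  shows "integral {-1..1} f = 0"
proof -
  have "integral {-1..1} f = integral {-1..1} (\<lambda>t. f (- t))"
    by (metis Henstock_Kurzweil_Integration.integral_reflect_real minus_minus)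
  then show ?thesis by (simp add: assms)
qed

text \<open>The difference t^j - t^(j+2) = t^j (1 - t^2) raises the exponent of the weight to a, for
  which the polynomial is orthogonal to t^j as long as j < d. Hence the moment of order d equals the
  one of order 0 or 1, according to the parity of d. The other of these two vanishes by parity, so
  their sum, the integral against 1 + t, has the same value.\<close>

lemma integral_rodrigues_poly_power:
  assumes "1 \<le> a"
  shows "integral {-1..1} (\<lambda>t. poly (rodrigues_poly (a + real d) d) t * t ^ d * (1 - t\<^sup>2) powr (a - 1))
    = (- 1) ^ d * fact d * 2 powr (2 * a + real d) * Beta (a + real d + 1) a"
proof -
  let ?q = "rodrigues_poly (a + real d) d"
  define M where "M j = integral {-1..1} (\<lambda>t. poly ?q t * t ^ j * (1 - t\<^sup>2) powr (a - 1))" for j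
  have int: "(\<lambda>t. poly ?q t * t ^ j * (1 - t\<^sup>2) powr (a - 1)) integrable_on {-1..1}" for j
    using assms by (intro integrable_weight[of "a - 1" "\<lambda>t. poly ?q t * t ^ j"] continuous_intros) auto
  have step: "M (j + 2) = M j" if "j < d" for j
  proof -
    have "M j - M (j + 2) = integral {-1..1} (\<lambda>t. poly ?q t * t ^ j * (1 - t\<^sup>2) powr (a - 1)
        - poly ?q t * t ^ (j + 2) * (1 - t\<^sup>2) powr (a - 1))"
      unfolding M_def by (rule integral_diff[OF int int, symmetric])
    also have "\<dots> = integral {-1..1} (\<lambda>t. poly ?q t * poly (monom 1 j) t * (1 - t\<^sup>2) powr (a + real d - real d))"
    proof (rule integral_cong)
      fix t :: real assume "t \<in> {-1..1}"
      then have e: "(1 - t\<^sup>2) powr a = (1 - t\<^sup>2) * (1 - t\<^sup>2) powr (a - 1)"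
        using weight_Suc[of t "a - 1"] by simp
      show "poly ?q t * t ^ j * (1 - t\<^sup>2) powr (a - 1) - poly ?q t * t ^ (j + 2) * (1 - t\<^sup>2) powr (a - 1)
          = poly ?q t * poly (monom 1 j) t * (1 - t\<^sup>2) powr (a + real d - real d)"
        unfolding add_diff_cancel_right' e by (simp add: poly_monom algebra_simps power2_eq_square)
    qed
    also have "\<dots> = 0"
      by (rule rodrigues_poly_orthogonal) (use that assms in \<open>auto simp: degree_monom_eq\<close>)
    finally show ?thesis by simp
  qed
  have "M (d mod 2 + 2 * j) = M (d mod 2)" if "2 * j \<le> d" for j
    using that
  proof (induction j)
    case (Suc j)
    then have "M (d mod 2 + 2 * j + 2) = M (d mod 2 + 2 * j)"
      by (intro step) presburger
    then show ?case using Suc by simp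
  qed simp
  from this[of "d div 2"] have "M d = M (d mod 2)" by simp
  also have "\<dots> = M 0 + M 1"
  proof -
    have "M (1 - d mod 2) = 0"
      unfolding M_def
      by (rule integral_odd_eq_0)
         (cases "even d"; simp add: poly_rodrigues_poly_uminus)
    then show ?thesis by (cases "even d") (simp_all add: odd_iff_mod_2_eq_one)
  qed
  also have "\<dots> = integral {-1..1} (\<lambda>t. poly ?q t * t ^ 0 * (1 - t\<^sup>2) powr (a - 1)
      + poly ?q t * t ^ 1 * (1 - t\<^sup>2) powr (a - 1))"
    unfolding M_def using int by (intro integral_add[symmetric])
  also have "\<dots> = integral {-1..1} (\<lambda>t. poly ?q t * (1 + t) * (1 - t\<^sup>2) powr (a - 1))"
    by (simp add: algebra_simps)
  finally show ?thesis
    using integral_rodrigues_poly_Beta[OF assms] by (simp add: M_def)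
qed

lemma Gamma_duplication_real:
  assumes "(0::real) < x"
  shows "Gamma x * Gamma (x + 1/2) = 2 powr (1 - 2 * x) * sqrt pi * Gamma (2 * x)"
proof -
  have "of_real x \<notin> (\<int>\<^sub>\<le>\<^sub>0 :: complex set)" "of_real x + 1/2 \<notin> (\<int>\<^sub>\<le>\<^sub>0 :: complex set)"
    using assms by (auto elim!: nonpos_Ints_cases simp: complex_eq_iff)
  from Gamma_legendre_duplication[OF this]
  have "Gamma (complex_of_real x) * Gamma (complex_of_real (x + 1/2))
     = of_real (exp ((1 - 2 * x) * ln 2)) * of_real (sqrt pi) * Gamma (complex_of_real (2 * x))"
    by (simp flip: exp_of_real)
  then have "complex_of_real (Gamma x * Gamma (x + 1/2))
     = of_real (exp ((1 - 2 * x) * ln 2) * sqrt pi * Gamma (2 * x))"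
    unfolding Gamma_complex_of_real by simp
  then show ?thesis
    unfolding of_real_eq_iff by (simp add: powr_def mult.commute)
qed

definition jacobi_integral :: "nat \<Rightarrow> nat \<Rightarrow> real" where
  "jacobi_integral n d = 1 / (2 * sqrt pi) * (Gamma (real n / 2) * Gamma (real d + real n)) /
     (Gamma (real n - 1) * Gamma (real d + (real n + 1) / 2)) * integral {-1..1} (\<lambda>t.
       \<bar>poly (jacobi_poly ((real n - 1) / 2) ((real n - 1) / 2) d) t\<bar> * (1 - t\<^sup>2) powr ((real n - 3) / 2))"

text \<open>The weighted reproducing kernel at \<open>1\<close> of the polynomials of degree at most \<open>d\<close>
  having the parity of \<open>d\<close>.\<close>

lemma zonal_kernel_exists:
  fixes n d :: nat
  assumes "n > 2"
  obtains q :: "real poly" where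
    "\<And>i. coeff q i \<noteq> 0 \<Longrightarrow> i \<le> d \<and> even (d + i)"
    "integral {-1..1} (\<lambda>t. poly q t * t ^ d * (1 - t\<^sup>2) powr ((real n - 3) / 2)) = 1"
    "\<And>k. 0 < k \<Longrightarrow> 2 * k \<le> d \<Longrightarrow>
       integral {-1..1} (\<lambda>t. poly q t * t ^ (d - 2 * k) * (1 - t\<^sup>2) powr (real k + (real n - 3) / 2)) = 0"
    "integral {-1..1} (\<lambda>t. \<bar>poly q t\<bar> * (1 - t\<^sup>2) powr ((real n - 3) / 2)) = jacobi_integral n d"
proof -
  define a where "a = (real n - 1) / 2"
  have a: "1 \<le> a" "a - 1 = (real n - 3) / 2" using assms by (auto simp: a_def field_simps)
  let ?r = "rodrigues_poly (a + real d) d"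
  \<comment> \<open>The value of the integral of \<open>?r\<close> against t^d, so that division by
    it gives the required normalization.\<close>
  define C where "C = (- 1) ^ d * fact d * 2 powr (2 * a + real d) * Beta (a + real d + 1) a"
  have Gpos: "Gamma x > 0" if "x > 0" for x :: real using that by (rule Gamma_real_pos)
  have Bpos: "Beta (a + real d + 1) a > 0"
    using a by (simp add: Beta_def Gpos)
  then have C0: "C \<noteq> 0" by (simp add: C_def)
  define q where "q = Polynomial.smult (1 / C) ?r"
  show thesis
  proof (rule that[of q])
    show "i \<le> d \<and> even (d + i)" if "coeff q i \<noteq> 0" for i
      using coeff_rodrigues_poly[of "a + real d" d i] that by (simp add: q_def)
    have "integral {-1..1} (\<lambda>t. poly q t * t ^ d * (1 - t\<^sup>2) powr (a - 1)) =
       integral {-1..1} (\<lambda>t. 1 / C * (poly ?r t * t ^ d * (1 - t\<^sup>2) powr (a - 1)))"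
      by (simp add: q_def mult_ac)
    also have "\<dots> = 1 / C * C"
      by (subst integral_mult_right) (simp add: integral_rodrigues_poly_power[OF a(1)] C_def)
    finally show "integral {-1..1} (\<lambda>t. poly q t * t ^ d * (1 - t\<^sup>2) powr ((real n - 3) / 2)) = 1"
      using C0 a by simp
    show "integral {-1..1} (\<lambda>t. poly q t * t ^ (d - 2 * k) * (1 - t\<^sup>2) powr (real k + (real n - 3) / 2)) = 0"
      if k: "0 < k" "2 * k \<le> d" for k
    proof -
      \<comment> \<open>The surplus factor (1 - t^2)^(k-1) of the weight is moved into the
        polynomial, which leaves the exponent a. The degree becomes (d - 2k) + 2(k - 1) = d - 2,
        within reach of orthogonality.\<close>
      let ?R = "Polynomial.smult (1 / C) (monom 1 (d - 2 * k) * [:1, 0, -1:] ^ (k - 1))"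
      have w: "(1 - t\<^sup>2) powr (real j + p) = (1 - t\<^sup>2) ^ j * (1 - t\<^sup>2) powr p" if "t \<in> {-1..1}" for t p :: real and j
      proof (induction j)
        case (Suc j)
        then show ?case using weight_Suc[OF that, of "real j + p"] by (simp add: algebra_simps)
      qed simp
      have "integral {-1..1} (\<lambda>t. poly q t * t ^ (d - 2 * k) * (1 - t\<^sup>2) powr (real k + (a - 1)))
        = integral {-1..1} (\<lambda>t. poly ?r t * poly ?R t * (1 - t\<^sup>2) powr (a + real d - real d))"
      proof (rule integral_cong)
        fix t :: real assume t: "t \<in> {-1..1}"
        have k': "real k + (a - 1) = real (k - 1) + a" using k by simp
        have e: "poly [:1, 0, - 1:] t = 1 - t\<^sup>2" by (simp add: power2_eq_square)
        show "poly q t * t ^ (d - 2 * k) * (1 - t\<^sup>2) powr (real k + (a - 1))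
            = poly ?r t * poly ?R t * (1 - t\<^sup>2) powr (a + real d - real d)"
          unfolding k' w[OF t] q_def poly_smult poly_mult poly_power e poly_monom by simp
      qed
      also have "\<dots> = 0"
      proof (rule rodrigues_poly_orthogonal)
        have "degree ([:1, 0, -1:] ^ (k - 1) :: real poly) \<le> 2 * (k - 1)"
          using degree_power_le[of "[:1, 0, -1:] :: real poly" "k - 1"] by simp
        then have "degree ?R \<le> (d - 2 * k) + 2 * (k - 1)"
          by (intro order_trans[OF degree_smult_le] order_trans[OF degree_mult_le])
             (simp add: degree_monom_eq)
        then show "?R = 0 \<or> degree ?R < d" using k by auto
      qed (use a in simp)
      finally show ?thesis using a by simp
    qed
    let ?P = "jacobi_poly a a d"
    let ?I = "integral {-1..1} (\<lambda>t. \<bar>poly ?P t\<bar> * (1 - t\<^sup>2) powr (a - 1))"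
    define D where "D = \<bar>1 / C\<bar> * (2 ^ d * fact d)"
    have "\<bar>poly q t\<bar> = D * \<bar>poly ?P t\<bar>" for t
      by (simp add: q_def D_def jacobi_poly_symmetric abs_mult abs_divide)
    then have "integral {-1..1} (\<lambda>t. \<bar>poly q t\<bar> * (1 - t\<^sup>2) powr (a - 1)) = D * ?I"
      by (simp add: mult.assoc)
    \<comment> \<open>\<open>D\<close> is the ratio between the normalized kernel and the Jacobi
      polynomial. Writing the Beta function through Gamma leaves 2^(2a) Gamma(a) in the denominator;
      the duplication formula trades it for Gamma(n/2), Gamma(n - 1) and the square root of
      pi.\<close>
    moreover have "D = 1 / (2 * sqrt pi) * (Gamma (a + 1/2) * Gamma (real d + real n)) /
           (Gamma (2 * a) * Gamma (real d + (a + 1)))"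
    proof -
      have "D = 2 ^ d / (2 powr (2 * a + real d) * Beta (a + real d + 1) a)"
        using Bpos by (simp add: D_def C_def abs_mult)
      also have "\<dots> = 1 / (2 powr (2 * a) * Beta (a + real d + 1) a)"
        by (simp add: powr_add powr_realpow)
      also have "\<dots> = Gamma (real d + real n) / (2 powr (2 * a) * Gamma a * Gamma (real d + (a + 1)))"
      proof -
        have e: "a + real d + 1 + a = real d + real n" "a + real d + 1 = real d + (a + 1)"
          by (simp_all add: a_def field_simps)
        show ?thesis unfolding Beta_def e(1) unfolding e(2) by (simp add: mult_ac)
      qed
      also have "\<dots> = 1 / (2 powr (2 * a) * Gamma a) * (Gamma (real d + real n) / Gamma (real d + (a + 1)))"
        by simp
      also have "1 / (2 powr (2 * a) * Gamma a) = Gamma (a + 1/2) / (2 * sqrt pi * Gamma (2 * a))"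
      proof -
        have "Gamma a * Gamma (a + 1/2) * 2 powr (2 * a) = 2 powr (1 - 2 * a + 2 * a) * sqrt pi * Gamma (2 * a)"
          unfolding powr_add[of 2 "1 - 2 * a"] using Gamma_duplication_real[of a] a by simp
        then have e: "2 * sqrt pi * Gamma (2 * a) = Gamma a * Gamma (a + 1/2) * 2 powr (2 * a)"
          by simp
        have "Gamma (a + 1/2) \<noteq> 0" using Gpos[of "a + 1/2"] a by linarith
        then show ?thesis unfolding e by simp
      qed
      finally show ?thesis by simp
    qed
    moreover have "a + 1/2 = real n / 2" "2 * a = real n - 1" "a + 1 = (real n + 1) / 2"
      by (simp_all add: a_def field_simps)
    ultimately show "integral {-1..1} (\<lambda>t. \<bar>poly q t\<bar> * (1 - t\<^sup>2) powr ((real n - 3) / 2)) = jacobi_integral n d"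
      using a(2) unfolding jacobi_integral_def a_def[symmetric] by simp
  qed
qed

section \<open>The rotation-invariant measure on the sphere\<close>

lemma emeasure_ball_nontrivial:
  "emeasure lborel (ball (0::'a::euclidean_space) 1) \<noteq> 0" "emeasure lborel (ball (0::'a) 1) \<noteq> \<infinity>"
  using emeasure_lborel_ball_finite[of "0::'a" 1]
  by (auto simp: content_ball_pos emeasure_eq_ennreal_measure dest: less_imp_neq)

text \<open>Orthogonal maps preserve Lebesgue measure: by Fubini the translation-invariant measures
  \<open>\<lambda>\<close> and \<open>\<lambda> \<circ> f\<inverse>\<close> satisfy \<open>\<lambda>(f\<inverse> A) \<lambda>(B) = \<lambda>(A) \<lambda>(f\<inverse> B)\<close>, and the unit ball \<open>B\<close> is
  invariant under \<open>f\<close>.\<close>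

lemma lborel_distr_orthogonal:
  fixes f :: "'a::euclidean_space \<Rightarrow> 'a"
  assumes f: "orthogonal_transformation f"
  shows "distr lborel borel f = lborel"
proof (rule measure_eqI)
  fix A assume "A \<in> sets (distr lborel borel f)"
  then have A [measurable]: "A \<in> sets borel" by simp
  have lin: "linear f" using f by (rule orthogonal_transformation_linear)
  have [measurable]: "f \<in> borel_measurable borel"
    using lin by (intro borel_measurable_continuous_onI linear_continuous_on linear_conv_bounded_linear[THEN iffD1])
  define B where "B = ball (0::'a) 1"
  have [measurable]: "B \<in> sets borel" by (simp add: B_def)
  have fB: "f x \<in> B \<longleftrightarrow> x \<in> B" for x
    using f by (simp add: B_def orthogonal_transformation_norm)
  obtain g where fg: "\<And>y. f (g y) = y"
    using orthogonal_transformation_surj[OF f] by (metis surjD)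
  have trans: "(\<integral>\<^sup>+x. h (c + x) \<partial>lborel) = (\<integral>\<^sup>+x. h x \<partial>lborel)"
    if [measurable]: "h \<in> borel_measurable borel" for h :: "'a \<Rightarrow> ennreal" and c
  proof -
    have "(\<integral>\<^sup>+x. h x \<partial>lborel) = (\<integral>\<^sup>+x. h x \<partial>distr lborel borel ((+) c))"
      by (simp add: lborel_distr_plus)
    also have "\<dots> = (\<integral>\<^sup>+x. h (c + x) \<partial>lborel)"
      by (subst nn_integral_distr) auto
    finally show ?thesis by simp
  qed
  have refl: "(\<integral>\<^sup>+x. h (c - x) \<partial>lborel) = (\<integral>\<^sup>+x. h x \<partial>lborel)"
    if [measurable]: "h \<in> borel_measurable borel" for h :: "'a \<Rightarrow> ennreal" and c
  proof -
    have "(\<integral>\<^sup>+x. h x \<partial>lborel) = (\<integral>\<^sup>+x. h x \<partial>distr lborel borel (\<lambda>x. c + (- 1) *\<^sub>R x))"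
      using lborel_affine[of "-1" c] by (simp add: density_1)
    also have "\<dots> = (\<integral>\<^sup>+x. h (c - x) \<partial>lborel)"
      by (subst nn_integral_distr) auto
    finally show ?thesis by simp
  qed
  let ?\<mu> = "\<lambda>C. emeasure (distr lborel borel f) C"
  have mu: "(\<integral>\<^sup>+x. indicator C (f x) \<partial>lborel) = ?\<mu> C" if [measurable]: "C \<in> sets borel" for C
    using nn_integral_distr[of f lborel borel "indicator C"] by simp
  have "?\<mu> A * emeasure lborel B =
      (\<integral>\<^sup>+x. \<integral>\<^sup>+y. indicator A (f x) * indicator B (f x + y) \<partial>lborel \<partial>lborel)"
    by (simp add: nn_integral_cmult trans[of "indicator B"] nn_integral_multc mu)
  also have "\<dots> = (\<integral>\<^sup>+y. \<integral>\<^sup>+x. indicator A (f x) * indicator B (f x + y) \<partial>lborel \<partial>lborel)"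
    by (rule lborel_pair.Fubini'[symmetric]) measurable
  also have "\<dots> = (\<integral>\<^sup>+y. \<integral>\<^sup>+x. indicator A (f x - y) * indicator B (f x) \<partial>lborel \<partial>lborel)"
  proof (rule nn_integral_cong)
    fix y
    \<comment> \<open>\<open>g (- y)\<close> is a preimage of - y under f, so translating x by it
      turns f x + y into f x and f x into f x - y.\<close>
    have "f (g (- y) + x) = f x - y" for x
      using lin fg[of "- y"] by (simp add: linear_add)
    then show "(\<integral>\<^sup>+x. indicator A (f x) * indicator B (f x + y) \<partial>lborel) =
        (\<integral>\<^sup>+x. indicator A (f x - y) * indicator B (f x) \<partial>lborel :: ennreal)"
      using trans[of "\<lambda>x. indicator A (f x) * indicator B (f x + y)" "g (- y)"] by simp
  qed
  also have "\<dots> = (\<integral>\<^sup>+x. \<integral>\<^sup>+y. indicator A (f x - y) * indicator B (f x) \<partial>lborel \<partial>lborel)"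
    by (rule lborel_pair.Fubini') measurable
  also have "\<dots> = emeasure lborel A * ?\<mu> B"
    by (simp add: nn_integral_multc nn_integral_cmult refl[of "indicator A"] mu)
  also have "?\<mu> B = emeasure lborel B"
  proof -
    have "indicator B (f x) = (indicator B x :: ennreal)" for x
      by (simp add: indicator_def fB)
    then show ?thesis using mu[of B] by simp
  qed
  finally have "emeasure lborel B * ?\<mu> A = emeasure lborel B * emeasure lborel A"
    by (simp add: mult.commute)
  moreover have "emeasure lborel B \<noteq> 0" "emeasure lborel B \<noteq> \<infinity>"
    unfolding B_def by (rule emeasure_ball_nontrivial)+
  ultimately show "?\<mu> A = emeasure lborel A"
    by (simp add: ennreal_mult_cancel_left)
qed simp

text \<open>The value of the radial projection at the origin is irrelevant.\<close>

definition radial_projection :: "'a::euclidean_space \<Rightarrow> 'a" where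
  "radial_projection x = (if x = 0 then (SOME b. b \<in> Basis) else x /\<^sub>R norm x)"

text \<open>Normalized surface measure, obtained by projecting the uniform distribution of the ball:
  its rotation invariance is then inherited from Lebesgue measure.\<close>

definition sphere_measure :: "'a::euclidean_space measure" where
  "sphere_measure =
     distr (uniform_measure lborel (ball 0 1)) (restrict_space borel (sphere 0 1)) radial_projection"

abbreviation sphere_mean :: "('a::euclidean_space \<Rightarrow> 'b::{banach, second_countable_topology}) \<Rightarrow> 'b"
    (binder \<open>\<ointegral>\<close> 10) where
  "sphere_mean f \<equiv> integral\<^sup>L sphere_measure f"

lemma radial_projection_in_sphere: "radial_projection x \<in> sphere 0 1"
proof -
  have "norm (SOME b::'a. b \<in> Basis) = 1" by (intro norm_Basis SOME_Basis)
  then show ?thesis by (simp add: radial_projection_def)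
qed

lemma measurable_radial_projection [measurable]:
  "radial_projection \<in> borel \<rightarrow>\<^sub>M restrict_space borel (sphere 0 1)"
proof (rule measurable_restrict_space2)
  show "radial_projection \<in> borel_measurable borel"
    unfolding radial_projection_def by measurable
qed (use radial_projection_in_sphere in auto)

lemma space_sphere_measure [simp]: "space sphere_measure = sphere 0 1"
  by (simp add: sphere_measure_def space_restrict_space)

lemma sets_sphere_measure [measurable_cong]:
  "sets sphere_measure = sets (restrict_space borel (sphere 0 1))"
  by (simp add: sphere_measure_def)

lemma emeasure_sphere_measure [simp]:
  "emeasure (sphere_measure :: 'a::euclidean_space measure) (sphere 0 1) = 1"
proof -
  have "emeasure (sphere_measure :: 'a measure) (sphere 0 1) =
      emeasure (uniform_measure lborel (ball (0::'a) 1)) (radial_projection -` sphere 0 1)"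
    unfolding sphere_measure_def
    by (subst emeasure_distr) (auto simp: sets_restrict_space cong: measurable_cong_sets)
  also have "radial_projection -` sphere 0 1 = (UNIV :: 'a set)"
    using radial_projection_in_sphere by auto
  also have "emeasure (uniform_measure lborel (ball (0::'a) 1)) UNIV = 1"
    using emeasure_ball_nontrivial[where 'a = 'a] emeasure_uniform_measure_1[of lborel "ball (0::'a) 1"]
    by simp
  finally show ?thesis .
qed

interpretation sphere_measure: finite_measure sphere_measure
  by (rule finite_measureI) simp

lemma measure_sphere_measure [simp]: "measure sphere_measure (sphere 0 1) = 1"
  by (simp add: measure_def)

lemma integrable_sphere_measure:
  fixes f :: "'a::euclidean_space \<Rightarrow> 'b::{banach, second_countable_topology}"
  assumes "continuous_on (sphere 0 1) f"
  shows "integrable sphere_measure f"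
proof -
  have "compact (f ` sphere 0 1)"
    using assms by (intro compact_continuous_image) auto
  then obtain B where B: "\<And>x. x \<in> sphere 0 1 \<Longrightarrow> norm (f x) \<le> B"
    using compact_imp_bounded bounded_iff by (metis imageI)
  show ?thesis
  proof (rule sphere_measure.integrable_const_bound[where B = B])
    show "f \<in> borel_measurable sphere_measure"
      using borel_measurable_continuous_on_restrict[OF assms]
      by (simp cong: measurable_cong_sets add: sets_sphere_measure)
  qed (use B in auto)
qed

lemma integral_sphere_measure_bound:
  fixes f :: "'a::euclidean_space \<Rightarrow> 'b::{banach, second_countable_topology}"
  assumes "continuous_on (sphere 0 1) f" "\<And>x. x \<in> sphere 0 1 \<Longrightarrow> norm (f x) \<le> B"
  shows "norm (sphere_mean f) \<le> B"
proof -
  have "norm (sphere_mean f) \<le> (\<ointegral>x. norm (f x))"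
    by (rule integral_norm_bound)
  also have "\<dots> \<le> (\<integral>x. B \<partial>(sphere_measure :: 'a measure))"
    using assms by (intro integral_mono integrable_sphere_measure continuous_intros) auto
  finally show ?thesis by simp
qed

text \<open>T preserves Lebesgue measure and the ball, hence the uniform distribution on the ball,
  and it commutes with the radial projection away from the origin, which is a null set.\<close>

lemma integral_sphere_measure_orthogonal:
  fixes f :: "'a::euclidean_space \<Rightarrow> 'b::{banach, second_countable_topology}" and T :: "'a \<Rightarrow> 'a"
  assumes T: "orthogonal_transformation T" and f: "continuous_on (sphere 0 1) f"
  shows "(\<ointegral>x. f (T x)) = sphere_mean f"
proof -
  let ?U = "uniform_measure lborel (ball (0::'a) 1)"
  have [measurable]: "T \<in> borel_measurable borel"
    using orthogonal_transformation_linear[OF T]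
    by (intro borel_measurable_continuous_onI linear_continuous_on linear_conv_bounded_linear[THEN iffD1])
  have U [simp]: "sets ?U = sets borel" "space ?U = UNIV" by simp_all
  have TS: "T x \<in> sphere 0 1 \<longleftrightarrow> x \<in> sphere 0 1" for x
    using T by (simp add: orthogonal_transformation_norm)
  have f' [measurable]: "f \<in> borel_measurable (restrict_space borel (sphere 0 1))"
    by (rule borel_measurable_continuous_on_restrict[OF f])
  have Tm [measurable]: "T \<in> restrict_space borel (sphere 0 1) \<rightarrow>\<^sub>M restrict_space borel (sphere 0 1)"
    using TS by (intro measurable_restrict_space2 measurable_restrict_space1) (auto simp: space_restrict_space)
  have pU [measurable]: "radial_projection \<in> ?U \<rightarrow>\<^sub>M restrict_space borel (sphere 0 1)"
    by (simp cong: measurable_cong_sets)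
  have inv: "distr ?U borel T = ?U"
  proof (rule measure_eqI)
    fix A assume "A \<in> sets (distr ?U borel T)"
    then have A [measurable]: "A \<in> sets borel" by simp
    have pre: "T -` C \<in> sets borel" if "C \<in> sets borel" for C
      using measurable_sets[OF \<open>T \<in> borel_measurable borel\<close> that] by simp
    have "emeasure (distr ?U borel T) A = emeasure ?U (T -` A)"
      by (subst emeasure_distr) (auto cong: measurable_cong_sets)
    also have "\<dots> = emeasure lborel (ball 0 1 \<inter> T -` A) / emeasure lborel (ball (0::'a) 1)"
      using pre[OF A] by (subst emeasure_uniform_measure) auto
    also have "ball 0 1 \<inter> T -` A = T -` (ball 0 1 \<inter> A)"
      using T by (auto simp: orthogonal_transformation_norm)
    also have "emeasure lborel (T -` (ball 0 1 \<inter> A)) = emeasure (distr lborel borel T) (ball 0 1 \<inter> A)"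
      by (subst emeasure_distr) auto
    also have "\<dots> / emeasure lborel (ball (0::'a) 1) = emeasure ?U A"
      unfolding lborel_distr_orthogonal[OF T] by (subst emeasure_uniform_measure) auto
    finally show "emeasure (distr ?U borel T) A = emeasure ?U A" .
  qed simp
  have "(\<ointegral>x. f (T x)) = (\<integral>x. f (T (radial_projection x)) \<partial>?U)"
    unfolding sphere_measure_def by (subst integral_distr) auto
  also have "\<dots> = (\<integral>x. f (radial_projection (T x)) \<partial>?U)"
  proof (rule integral_cong_AE)
    show "(\<lambda>x. f (T (radial_projection x))) \<in> borel_measurable ?U"
      by (rule measurable_compose[OF pU]) simp
    have "(\<lambda>x. f (radial_projection (T x))) \<in> borel_measurable borel" by measurable
    then show "(\<lambda>x. f (radial_projection (T x))) \<in> borel_measurable ?U"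
      by (simp cong: measurable_cong_sets)
    have "AE x in lborel. x \<noteq> (0::'a)"
      using AE_lborel_singleton[of "0::'a"] by simp
    then have "AE x in ?U. x \<noteq> 0"
      by (intro AE_uniform_measureI) auto
    then show "AE x in ?U. f (T (radial_projection x)) = f (radial_projection (T x))"
    proof (rule AE_mp, intro AE_I2 impI)
      fix x :: 'a assume "x \<noteq> 0"
      then have "T x \<noteq> 0" using orthogonal_transformation_norm[OF T, of x] by auto
      then show "f (T (radial_projection x)) = f (radial_projection (T x))"
        using \<open>x \<noteq> 0\<close> by (simp add: radial_projection_def orthogonal_transformation_norm[OF T]
            orthogonal_transformation_scaleR[OF T])
    qed
  qed
  also have "\<dots> = (\<integral>x. f (radial_projection x) \<partial>distr ?U borel T)"
    by (subst integral_distr) (auto cong: measurable_cong_sets)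
  also have "\<dots> = sphere_mean f"
    unfolding inv sphere_measure_def by (subst integral_distr) auto
  finally show ?thesis .
qed

section \<open>Zonal integrals\<close>

text \<open>Some orthogonal map takes norm v times a fixed unit vector to v, so by invariance the
  integral depends on v through its norm only. The constant m serves all v at once.\<close>

lemma sphere_moment:
  obtains m where "\<And>v :: real ^ 'n. (\<ointegral>x. (x \<bullet> v) ^ N) = norm v ^ N * m"
proof -
  define e :: "real ^ 'n" where "e = (SOME b. b \<in> Basis)"
  have e: "norm e = 1"
    unfolding e_def by (intro norm_Basis SOME_Basis)
  have "(\<ointegral>x. (x \<bullet> v) ^ N) = norm v ^ N * (\<ointegral>x. (x \<bullet> e) ^ N)"
    for v :: "real ^ 'n"
  proof -
    obtain T where T: "orthogonal_transformation T" "T (norm v *\<^sub>R e) = v"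
      using orthogonal_transformation_exists[of "norm v *\<^sub>R e" v] e by auto
    have "T x \<bullet> v = norm v * (x \<bullet> e)" for x
      using T by (metis inner_scaleR_right orthogonal_transformation_def)
    then have "(\<ointegral>x. (T x \<bullet> v) ^ N) = norm v ^ N * (\<ointegral>x. (x \<bullet> e) ^ N)"
      by (simp add: power_mult_distrib)
    moreover have "(\<ointegral>x. (T x \<bullet> v) ^ N) = (\<ointegral>x. (x \<bullet> v) ^ N)"
      by (rule integral_sphere_measure_orthogonal[OF T(1)]) (intro continuous_intros)
    ultimately show ?thesis by simp
  qed
  then show thesis by (rule that)
qed

lemma sphere_moment_odd:
  fixes v :: "real ^ 'n"
  assumes "odd N"
  shows "(\<ointegral>x. (x \<bullet> v) ^ N) = 0"
proof -
  have "(\<ointegral>x. (x \<bullet> v) ^ N) = (\<ointegral>x. (- x \<bullet> v) ^ N)"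
    by (rule integral_sphere_measure_orthogonal[symmetric, of uminus])
       (auto intro!: continuous_intros simp: orthogonal_transformation_neg)
  then show ?thesis using assms by (simp add: power_minus_odd)
qed

locale orthonormal_pair =
  fixes y u :: "real ^ 'n"
  assumes y: "norm y = 1" and u: "norm u = 1" and yu: "y \<bullet> u = 0"
begin

definition moment :: "nat \<Rightarrow> nat \<Rightarrow> real" where
  "moment a b = (\<ointegral>x. (x \<bullet> y) ^ a * (x \<bullet> u) ^ b)"

text \<open>The moments of \<open>y + s u\<close> are \<open>(1 + s\<^sup>2)\<^sup>N\<^sup>/\<^sup>2\<close> times a constant; the recurrence is the
  resulting differential equation in \<open>s\<close>, read off at the coefficients.\<close>

lemma moment_recurrence:
  shows "moment a 1 = 0" and "real (a + 1) * moment a (j + 2) = real (j + 1) * moment (a + 2) j"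
proof -
  define C where "C N j = real (N choose j) * moment (N - j) j" for N j
  define P where "P N = (\<Sum>j\<le>N. monom (C N j) j)" for N
  have coeff_P: "coeff (P N) j = C N j" for N j
  proof -
    have "coeff (P N) j = (\<Sum>i\<le>N. if i = j then C N i else 0)"
      by (simp add: P_def coeff_sum)
    then show ?thesis by (simp add: C_def)
  qed
  have poly_P: "poly (P N) s = (\<ointegral>x. (x \<bullet> (y + s *\<^sub>R u)) ^ N)" for N s
  proof -
    have "(\<ointegral>x. (x \<bullet> (y + s *\<^sub>R u)) ^ N)
      = (\<ointegral>x. (\<Sum>j\<le>N. real (N choose j) * s ^ j * ((x \<bullet> y) ^ (N - j) * (x \<bullet> u) ^ j)))"
      by (simp add: inner_add_right add.commute[of "_ \<bullet> y"] binomial_ring power_mult_distrib mult_ac)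
    also have "\<dots> = (\<Sum>j\<le>N. real (N choose j) * s ^ j * moment (N - j) j)"
      by (subst Bochner_Integration.integral_sum)
         (auto simp: moment_def intro!: integrable_sphere_measure continuous_intros)
    finally show ?thesis
      by (simp add: P_def poly_sum poly_monom C_def mult_ac)
  qed
  \<comment> \<open>The equation (1 + s^2) P' = N s P of m (1 + s^2)^(N/2). It can stay within
    polynomials: half-integer exponents would need N odd, and then P vanishes.\<close>
  have ode: "[:1, 0, 1:] * pderiv (P N) = Polynomial.smult (real N) (pCons 0 (P N))" for N
  proof (cases "odd N")
    case True
    then have "poly (P N) s = poly 0 s" for s
      by (simp add: poly_P sphere_moment_odd)
    then have "P N = 0" by (metis poly_eq_poly_eq_iff ext)
    then show ?thesis by simp
  next
    case False
    then obtain M where M: "N = 2 * M" by (auto elim: evenE)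
    obtain m where m: "\<And>v :: real ^ 'n. (\<ointegral>x. (x \<bullet> v) ^ N) = norm v ^ N * m"
      using sphere_moment[where N = N and 'n = 'n] by blast
    have ns: "(norm (y + s *\<^sub>R u))\<^sup>2 = 1 + s\<^sup>2" for s
    proof -
      have "(norm (y + s *\<^sub>R u))\<^sup>2 = (norm y)\<^sup>2 + s\<^sup>2 * (norm u)\<^sup>2 + 2 * s * (y \<bullet> u)"
        unfolding power2_norm_eq_inner
        by (simp add: inner_add_left inner_add_right inner_commute power2_eq_square algebra_simps)
      then show ?thesis using y u yu by simp
    qed
    have "\<And>s. poly (P N) s = poly (Polynomial.smult m ([:1, 0, 1:] ^ M)) s"
    proof -
      fix s :: real
      have "norm (y + s *\<^sub>R u) ^ N = (1 + s\<^sup>2) ^ M" by (simp only: M power_mult ns)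
      then show "poly (P N) s = poly (Polynomial.smult m ([:1, 0, 1:] ^ M)) s"
        unfolding poly_P m by (simp add: power2_eq_square mult.commute)
    qed
    then have P: "P N = Polynomial.smult m ([:1, 0, 1:] ^ M)"
      by (metis poly_eq_poly_eq_iff ext)
    show ?thesis
    proof (cases M)
      case 0
      then show ?thesis unfolding P by (simp add: M pderiv_smult)
    next
      case (Suc M')
      have d: "pderiv [:1, 0, 1:] = [:0, 2::real:]" by (simp add: pderiv_pCons)
      have "[:1, 0, 1:] * pderiv (P N)
        = Polynomial.smult m (Polynomial.smult (real M) ([:1, 0, 1:] * [:1, 0, 1:] ^ M' * [:0, 2:]))"
        by (simp only: P pderiv_smult Suc pderiv_power_Suc d mult_smult_right mult_smult_left mult.assoc)
      also have "[:1, 0, 1:] * [:1, 0, 1:] ^ M' = ([:1, 0, 1::real:]) ^ M"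
        by (simp only: Suc power_Suc)
      also have "Polynomial.smult m (Polynomial.smult (real M) ([:1, 0, 1:] ^ M * [:0, 2:]))
          = Polynomial.smult (real N) (pCons 0 (P N))"
        unfolding P by (simp add: M mult_ac)
      finally show ?thesis .
    qed
  qed
  have c0: "C N 1 = 0" for N
    using arg_cong[OF ode[of N], of "\<lambda>p. coeff p 0"] by (simp add: coeff_pderiv coeff_P)
  then have m1: "moment (N - 1) 1 = 0" if "N > 0" for N
    using that c0[of N] by (simp add: C_def)
  show "moment a 1 = 0" using m1[of "a + 1"] by simp
  show "real (a + 1) * moment a (j + 2) = real (j + 1) * moment (a + 2) j"
  proof -
    define N where "N = a + j + 2"
    \<comment> \<open>The coefficient of s^(j+1) in the differential equation.\<close>
    have "real (j + 2) * C N (j + 2) + real j * C N j = real N * C N j"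
    proof -
      have "coeff ([:1, 0, 1:] * pderiv (P N)) (Suc j) = coeff (Polynomial.smult (real N) (pCons 0 (P N))) (Suc j)"
        by (simp only: ode)
      then show ?thesis
        by (cases j) (simp_all add: coeff_pderiv coeff_P algebra_simps)
    qed
    then have 1: "real (j + 2) * C N (j + 2) = real (a + 2) * C N j"
      by (simp add: N_def algebra_simps)
    \<comment> \<open>Two applications of binomial absorption express N choose j + 2 through N
      choose j; the common factor (a + 2) (N choose j) then cancels from the relation between the
      moments.\<close>
    have b: "Suc i * (N choose Suc i) = (N - i) * (N choose i)" for i
      by (metis binomial_absorb_comp binomial_absorption)
    have Na: "N - (j + 1) = a + 1" "N - j = a + 2" "N - (j + 2) = a" by (simp_all add: N_def)
    have b1: "(j + 2) * (N choose (j + 2)) = (a + 1) * (N choose (j + 1))"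
      using b[of "j + 1"] by (simp only: Na Suc_eq_plus1 add.assoc one_add_one)
    have b2: "(j + 1) * (N choose (j + 1)) = (a + 2) * (N choose j)"
      using b[of j] by (simp only: Na Suc_eq_plus1)
    have "(j + 1) * ((j + 2) * (N choose (j + 2))) = (a + 1) * ((j + 1) * (N choose (j + 1)))"
      by (simp only: b1 mult.left_commute)
    also have "\<dots> = (a + 1) * ((a + 2) * (N choose j))"
      by (simp only: b2)
    finally have 2: "(j + 1) * ((j + 2) * (N choose (j + 2))) = (a + 1) * ((a + 2) * (N choose j))" .
    have "real (j + 1) * (real (j + 2) * real (N choose (j + 2))) * moment a (j + 2)
        = real (j + 1) * (real (a + 2) * real (N choose j)) * moment (a + 2) j"
      using arg_cong[OF 1, of "(*) (real (j + 1))"] unfolding C_def Na by (simp only: mult_ac)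
    also have "real (j + 1) * (real (j + 2) * real (N choose (j + 2))) = real (a + 1) * (real (a + 2) * real (N choose j))"
      using 2 by (metis of_nat_mult)
    finally have "(real (a + 2) * real (N choose j)) * (real (a + 1) * moment a (j + 2))
        = (real (a + 2) * real (N choose j)) * (real (j + 1) * moment (a + 2) j)"
      by (simp only: mult_ac)
    moreover have "real (a + 2) * real (N choose j) \<noteq> 0"
      by (simp add: N_def)
    ultimately show ?thesis by simp
  qed
qed

lemma moment_odd: "odd b \<Longrightarrow> moment a b = 0"
proof (induction b arbitrary: a rule: less_induct)
  case (less b)
  show ?case
  proof (cases "b = 1")
    case False
    then obtain j where b: "b = j + 2" using less.prems by (metis add_2_eq_Suc' not0_implies_Suc One_nat_def odd_pos less_not_refl2)
    then have "moment (a + 2) j = 0" using less by simp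
    then have "real (a + 1) * moment a b = 0" using moment_recurrence(2)[of a j] b by simp
    then show ?thesis by simp
  qed (simp add: moment_recurrence(1)[unfolded One_nat_def])
qed

text \<open>On the sphere the squares of the coordinates sum to 1. Inserting this sum into the
  moment of order a along a basis vector e, the term of e itself gives the moment m' of order a + 2,
  and each of the n - 1 other coordinates gives m' / (a + 1) by \<open>moment_recurrence\<close>.
  Rotation invariance replaces e by y.\<close>

lemma moment_zonal:
  assumes n: "CARD('n) > 2"
  shows "real (a + 1) * moment a 0 = (real a + real CARD('n)) * moment (a + 2) 0"
proof -
  define e :: "real ^ 'n" where "e = (SOME b. b \<in> Basis)"
  have e: "e \<in> Basis" unfolding e_def by (rule SOME_Basis)
  obtain m where m: "\<And>v :: real ^ 'n. (\<ointegral>x. (x \<bullet> v) ^ a) = norm v ^ a * m"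
    using sphere_moment[where N = a and 'n = 'n] by blast
  obtain m' where m': "\<And>v :: real ^ 'n. (\<ointegral>x. (x \<bullet> v) ^ (a + 2)) = norm v ^ (a + 2) * m'"
    using sphere_moment[where N = "a + 2" and 'n = 'n] by blast
  have mixed: "real (a + 1) * (\<ointegral>x. (x \<bullet> e) ^ a * (x \<bullet> b) ^ 2) = m'"
    if b: "b \<in> Basis - {e}" for b :: "real ^ 'n"
  proof -
    interpret eb: orthonormal_pair e b
      using e b by unfold_locales (auto simp: inner_Basis)
    show ?thesis
      using eb.moment_recurrence(2)[of a 0] m'[of e] e unfolding eb.moment_def add_0 by simp
  qed
  have "m = (\<ointegral>x. (x \<bullet> e) ^ a * (\<Sum>b\<in>Basis. (x \<bullet> b)\<^sup>2))"
  proof -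
    have "(\<Sum>b\<in>Basis. (x \<bullet> b)\<^sup>2) = 1" if "x \<in> sphere 0 1" for x :: "real ^ 'n"
      using that euclidean_inner[of x x] by (simp add: power2_eq_square norm_eq_1)
    then have "(\<ointegral>x. (x \<bullet> e) ^ a * (\<Sum>b\<in>Basis. (x \<bullet> b)\<^sup>2)) = (\<ointegral>x. (x \<bullet> e) ^ a)"
      by (intro Bochner_Integration.integral_cong) auto
    then show ?thesis using m[of e] e by simp
  qed
  also have "\<dots> = (\<Sum>b\<in>Basis. \<ointegral>x. (x \<bullet> e) ^ a * (x \<bullet> b)\<^sup>2)"
    unfolding sum_distrib_left
    by (intro Bochner_Integration.integral_sum integrable_sphere_measure continuous_intros)
  also have "\<dots> = (\<ointegral>x. (x \<bullet> e) ^ a * (x \<bullet> e)\<^sup>2)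
      + (\<Sum>b\<in>Basis - {e}. \<ointegral>x. (x \<bullet> e) ^ a * (x \<bullet> b)\<^sup>2)"
    using e by (intro sum.remove) auto
  also have "(\<ointegral>x. (x \<bullet> e) ^ a * (x \<bullet> e)\<^sup>2) = m'"
    using m'[of e] e by (simp flip: power_add)
  also have "(\<Sum>b\<in>Basis - {e}. \<ointegral>x. (x \<bullet> e) ^ a * (x \<bullet> b)\<^sup>2) = (\<Sum>b\<in>Basis - {e}. m' / real (a + 1))"
    using mixed by (intro sum.cong refl) (simp add: field_simps)
  also have "\<dots> = (real CARD('n) - 1) * (m' / real (a + 1))"
    using e by (simp add: card_Diff_subset of_nat_diff)
  finally have "real (a + 1) * m = (real a + real CARD('n)) * m'"
    by (simp add: field_simps)
  then show ?thesis
    using m[of y] m'[of y] y by (simp add: moment_def)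
qed

end

section \<open>Spherical moments as weighted integrals over [-1, 1]\<close>

text \<open>For p = (n - 3) / 2 the initial value normalizes the distribution of one coordinate on
  the sphere, and the factor of each step is the ratio of consecutive even moments of a coordinate
  on the sphere of one dimension less, orthogonal to the pole.\<close>

primrec zonal_coeff :: "real \<Rightarrow> nat \<Rightarrow> real" where
  "zonal_coeff p 0 = 1 / integral {-1..1} (\<lambda>t. (1 - t\<^sup>2) powr p)"
| "zonal_coeff p (Suc k) = real (2 * k + 1) / (2 * (real k + p + 1)) * zonal_coeff p k"

text \<open>For p = (n - 3) / 2 the constant 2p + 3 is n, so the weighted moments obey the
  recurrence of \<open>moment_zonal\<close>.\<close>

lemma weight_moment_step:
  assumes "0 \<le> p"
  shows "real (a + 1) * integral {-1..1} (\<lambda>t. t ^ a * (1 - t\<^sup>2) powr p) =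
    (real a + (2 * p + 3)) * integral {-1..1} (\<lambda>t. t ^ (a + 2) * (1 - t\<^sup>2) powr p)"
proof -
  have "integral {-1..1} (\<lambda>t. t ^ a * (1 - t\<^sup>2) powr p) - integral {-1..1} (\<lambda>t. t ^ (a + 2) * (1 - t\<^sup>2) powr p)
      = integral {-1..1} (\<lambda>t. t ^ a * (1 - t\<^sup>2) powr p - t ^ (a + 2) * (1 - t\<^sup>2) powr p)"
    using assms by (intro integral_diff[symmetric] integrable_weight continuous_intros)
  also have "\<dots> = integral {-1..1} (\<lambda>t. t ^ a * (1 - t\<^sup>2) powr (p + 1))"
    by (rule integral_cong) (simp only: weight_Suc, simp add: algebra_simps power2_eq_square)
  finally show ?thesis
    using weight_moment_rec[OF assms, of a] by (simp add: algebra_simps)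
qed

text \<open>The detour through the exponent p + 1 supplies a weight that is continuous on the closed
  interval even for p = 0, so that a vanishing integral would force it to vanish at 0, where it is
  1. The moment recurrences carry positivity back to p.\<close>

lemma integral_weight_pos:
  assumes "0 \<le> p"
  shows "0 < integral {-1..1} (\<lambda>t::real. (1 - t\<^sup>2) powr p)"
proof -
  let ?f = "\<lambda>t::real. (1 - t\<^sup>2) powr (p + 1)"
  have nn: "0 \<le> integral {-1..1} (\<lambda>t::real. (1 - t\<^sup>2) powr q)" for q
  proof (cases "(\<lambda>t::real. (1 - t\<^sup>2) powr q) integrable_on {-1..1}")
    case True
    then show ?thesis by (rule integral_nonneg) simp
  qed (simp add: not_integrable_integral)
  have "integral {-1..1} ?f \<noteq> 0"
  proof
    assume "integral {-1..1} ?f = 0"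
    moreover have "continuous_on {-1..1} ?f"
      using assms by (intro continuous_on_weight) simp
    ultimately have "\<forall>t\<in>{-1..1}. ?f t = 0"
      using integral_eq_0_iff[of "-1" 1 ?f] by simp
    then have "?f 0 = 0" by (rule bspec) simp
    then show False by simp
  qed
  moreover have "integral {-1..1} ?f = 2 * (p + 1) / (2 * p + 3) * integral {-1..1} (\<lambda>t::real. (1 - t\<^sup>2) powr p)"
    using weight_moment_rec[OF assms, of 0] weight_moment_step[OF assms, of 0] assms by (simp add: field_simps)
  ultimately show ?thesis using nn[of p] by (auto simp: less_le)
qed

context orthonormal_pair
begin

text \<open>No parametrization of the sphere is involved; both sides obey the same recurrences. For
  k = 0, \<open>moment_zonal\<close> matches \<open>weight_moment_step\<close>, starting from a = 0
  (the normalization) and a = 1 (both sides vanish). The step in k matches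
  \<open>moment_recurrence\<close> with \<open>weight_moment_rec\<close>.\<close>

lemma moment_eq_integral:
  assumes n: "CARD('n) > 2"
  defines "p \<equiv> (real CARD('n) - 3) / 2"
  shows "moment a (2 * k) = zonal_coeff p k * integral {-1..1} (\<lambda>t. t ^ a * (1 - t\<^sup>2) powr (real k + p))"
proof (induction k arbitrary: a)
  case 0
  have p: "0 \<le> p" "real CARD('n) = 2 * p + 3" using n by (simp_all add: p_def field_simps)
  let ?J = "\<lambda>a. integral {-1..1} (\<lambda>t. t ^ a * (1 - t\<^sup>2) powr p)"
  have "moment a 0 = zonal_coeff p 0 * ?J a"
  proof (induction a rule: less_induct)
    case (less a)
    consider "a = 0" | "a = 1" | b where "a = b + 2"
      by (metis One_nat_def add_2_eq_Suc' not0_implies_Suc)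
    then show ?case
    proof cases
      case 1
      then show ?thesis
        using integral_weight_pos[OF p(1)] by (simp add: moment_def)
    next
      case 2
      have "?J 1 = 0" by (rule integral_odd_eq_0) simp
      moreover have "moment 1 0 = 0"
        using sphere_moment_odd[of 1 y] by (simp add: moment_def)
      ultimately show ?thesis using 2 by simp
    next
      case (3 b)
      have "(real b + real CARD('n)) * moment a 0 = real (b + 1) * moment b 0"
        using moment_zonal[OF n, of b] 3 by simp
      also have "\<dots> = zonal_coeff p 0 * (real (b + 1) * ?J b)"
        using less[of b] 3 by simp
      also have "\<dots> = (real b + real CARD('n)) * (zonal_coeff p 0 * ?J a)"
        using weight_moment_step[OF p(1), of b] 3 p(2) by simp
      finally show ?thesis
        by (rule mult_left_cancel[THEN iffD1, rotated]) (use n in linarith)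
    qed
  qed
  then show ?case by simp
next
  case (Suc k)
  have p: "0 \<le> p" using n by (simp add: p_def)
  let ?J = "\<lambda>a k. integral {-1..1} (\<lambda>t. t ^ a * (1 - t\<^sup>2) powr (real k + p))"
  have "real (a + 1) * moment a (2 * Suc k) = real (2 * k + 1) * moment (a + 2) (2 * k)"
    using moment_recurrence(2)[of a "2 * k"] by simp
  also have "\<dots> = zonal_coeff p (Suc k) * (2 * (real k + p + 1) * ?J (a + 2) k)"
    using p Suc.IH[of "a + 2"] by simp
  also have "\<dots> = zonal_coeff p (Suc k) * (real (a + 1) * ?J a (Suc k))"
  proof -
    have e: "real (Suc k) + p = real k + p + 1" by simp
    show ?thesis
      unfolding e using weight_moment_rec[of "real k + p" a] p by simp
  qed
  also have "\<dots> = real (a + 1) * (zonal_coeff p (Suc k) * ?J a (Suc k))"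
    by (simp only: mult_ac)
  finally show ?case
    by (rule mult_left_cancel[THEN iffD1, rotated]) simp
qed

lemma integral_sphere_poly:
  fixes q :: "real poly"
  assumes n: "CARD('n) > 2"
  defines "p \<equiv> (real CARD('n) - 3) / 2"
  shows "(\<ointegral>x. poly q (x \<bullet> y) * (x \<bullet> u) ^ (2 * k)) =
      zonal_coeff p k * integral {-1..1} (\<lambda>t. poly q t * (1 - t\<^sup>2) powr (real k + p))"
    and "odd b \<Longrightarrow> (\<ointegral>x. poly q (x \<bullet> y) * (x \<bullet> u) ^ b) = 0"
proof -
  have p: "0 \<le> p" using n by (simp add: p_def)
  have expand: "(\<ointegral>x. poly q (x \<bullet> y) * (x \<bullet> u) ^ b) = (\<Sum>i\<le>degree q. coeff q i * moment i b)" for b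
  proof -
    have "(\<ointegral>x. poly q (x \<bullet> y) * (x \<bullet> u) ^ b) =
        (\<ointegral>x. (\<Sum>i\<le>degree q. coeff q i * ((x \<bullet> y) ^ i * (x \<bullet> u) ^ b)))"
      by (simp add: poly_altdef sum_distrib_right mult.assoc)
    also have "\<dots> = (\<Sum>i\<le>degree q. coeff q i * moment i b)"
      by (subst Bochner_Integration.integral_sum)
         (auto simp: moment_def intro!: integrable_sphere_measure continuous_intros)
    finally show ?thesis .
  qed
  show "odd b \<Longrightarrow> (\<ointegral>x. poly q (x \<bullet> y) * (x \<bullet> u) ^ b) = 0"
    unfolding expand by (simp add: moment_odd)
  have "(\<Sum>i\<le>degree q. coeff q i * moment i (2 * k)) = zonal_coeff p k *
      (\<Sum>i\<le>degree q. integral {-1..1} (\<lambda>t. coeff q i * (t ^ i * (1 - t\<^sup>2) powr (real k + p))))"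
    unfolding moment_eq_integral[OF n, folded p_def] integral_mult_right sum_distrib_left
    by (simp only: mult_ac)
  also have "(\<Sum>i\<le>degree q. integral {-1..1} (\<lambda>t. coeff q i * (t ^ i * (1 - t\<^sup>2) powr (real k + p)))) =
      integral {-1..1} (\<lambda>t. \<Sum>i\<le>degree q. coeff q i * (t ^ i * (1 - t\<^sup>2) powr (real k + p)))"
    using p by (intro integral_sum[symmetric] integrable_on_mult_right integrable_weight continuous_intros) auto
  also have "(\<lambda>t. \<Sum>i\<le>degree q. coeff q i * (t ^ i * (1 - t\<^sup>2) powr (real k + p))) =
      (\<lambda>t. poly q t * (1 - t\<^sup>2) powr (real k + p))"
    by (simp add: poly_altdef sum_distrib_right mult.assoc)
  finally show "(\<ointegral>x. poly q (x \<bullet> y) * (x \<bullet> u) ^ (2 * k)) =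
      zonal_coeff p k * integral {-1..1} (\<lambda>t. poly q t * (1 - t\<^sup>2) powr (real k + p))"
    unfolding expand .
qed

end

lemma unit_orthogonal_decomposition:
  fixes y v :: "real ^ 'n"
  assumes n: "CARD('n) > 2" and y: "norm y = 1"
  obtains u r where "orthonormal_pair y u" "v = (v \<bullet> y) *\<^sub>R y + r *\<^sub>R u" "r\<^sup>2 = (norm v)\<^sup>2 - (v \<bullet> y)\<^sup>2"
proof -
  define w where "w = v - (v \<bullet> y) *\<^sub>R y"
  have yy: "y \<bullet> y = 1" using y by (simp add: norm_eq_1)
  have wy: "y \<bullet> w = 0" by (simp add: w_def inner_diff_right yy inner_commute)
  have nw: "(norm w)\<^sup>2 = (norm v)\<^sup>2 - (v \<bullet> y)\<^sup>2"
  proof -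
    have "(norm w)\<^sup>2 = (norm v)\<^sup>2 - 2 * (v \<bullet> y) * (v \<bullet> y) + (v \<bullet> y)\<^sup>2 * (y \<bullet> y)"
      unfolding power2_norm_eq_inner w_def
      by (simp add: inner_diff_left inner_diff_right inner_commute power2_eq_square algebra_simps)
    then show ?thesis by (simp add: yy power2_eq_square)
  qed
  show thesis
  proof (cases "w = 0")
    case True
    obtain u' where u': "u' \<noteq> 0" "orthogonal y u'"
      using orthogonal_to_vector_exists[of y] n by auto
    have "orthonormal_pair y (u' /\<^sub>R norm u')"
      using y u' by unfold_locales (auto simp: orthogonal_def)
    then show thesis
      using that[of "u' /\<^sub>R norm u'" 0] True nw by (simp add: w_def)
  next
    case False
    have "orthonormal_pair y (w /\<^sub>R norm w)"
      using y wy False by unfold_locales auto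
    then show thesis
      using that[of "w /\<^sub>R norm w" "norm w"] False nw by (simp add: w_def)
  qed
qed

text \<open>The extension from polynomials to continuous functions is needed for the absolute value
  of the kernel. Both sides are means of total mass 1, so approximating \<open>\<psi>\<close>
  uniformly within e costs at most e on each of them.\<close>

lemma integral_sphere_zonal:
  fixes y :: "real ^ 'n" and \<psi> :: "real \<Rightarrow> real"
  assumes n: "CARD('n) > 2" and y: "norm y = 1" and cont: "continuous_on {-1..1} \<psi>"
  defines "p \<equiv> (real CARD('n) - 3) / 2"
  shows "(\<ointegral>x. \<psi> (x \<bullet> y)) =
      zonal_coeff p 0 * integral {-1..1} (\<lambda>t. \<psi> t * (1 - t\<^sup>2) powr p)"
proof -
  have p: "0 \<le> p" using n by (simp add: p_def)
  obtain u where "orthonormal_pair y u"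
    using unit_orthogonal_decomposition[OF n y] by metis
  then interpret orthonormal_pair y u .
  have range: "x \<bullet> y \<in> {-1..1}" if "x \<in> sphere 0 1" for x
    using Cauchy_Schwarz_ineq2[of x y] that y by (auto simp: abs_le_iff)
  let ?w = "\<lambda>t::real. (1 - t\<^sup>2) powr p"
  let ?J\<psi> = "integral {-1..1} (\<lambda>t. \<psi> t * ?w t)"
  let ?c = "zonal_coeff p 0"
  have c: "?c * integral {-1..1} ?w = 1"
    using integral_weight_pos[OF p] by simp
  have "\<bar>(\<ointegral>x. \<psi> (x \<bullet> y)) - ?c * ?J\<psi>\<bar> \<le> 2 * e" if e: "e > 0" for e
  proof -
    obtain g where g: "real_polynomial_function g" "\<And>t. t \<in> {-1..1} \<Longrightarrow> \<bar>\<psi> t - g t\<bar> < e"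
      using Stone_Weierstrass_real_polynomial_function[OF _ cont e] by auto
    obtain a N where aN: "g = (\<lambda>t. \<Sum>i\<le>N. a i * t ^ i)"
      using g(1) by (auto simp: real_polynomial_function_iff_sum)
    define q where "q = (\<Sum>i\<le>N. monom (a i) i)"
    have gq: "g = poly q" by (auto simp: aN q_def poly_sum poly_monom)
    let ?Jg = "integral {-1..1} (\<lambda>t. g t * ?w t)"
    have int_g: "(\<ointegral>x. g (x \<bullet> y)) = ?c * ?Jg"
      using integral_sphere_poly(1)[OF n, of q 0] by (simp add: gq p_def)
    have cont': "continuous_on (sphere 0 1) (\<lambda>x. \<psi> (x \<bullet> y))"
      by (rule continuous_on_compose2[OF cont]) (use range in \<open>auto intro!: continuous_intros\<close>)
    have cg: "continuous_on A g" for A unfolding gq by (intro continuous_intros)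
    have cg': "continuous_on (sphere 0 1) (\<lambda>x. g (x \<bullet> y))"
      unfolding gq by (intro continuous_intros)
    have "(\<ointegral>x. \<psi> (x \<bullet> y)) - (\<ointegral>x. g (x \<bullet> y))
        = (\<ointegral>x. \<psi> (x \<bullet> y) - g (x \<bullet> y))"
      by (intro Bochner_Integration.integral_diff[symmetric] integrable_sphere_measure cont' cg')
    also have "\<bar>\<dots>\<bar> \<le> e"
      using integral_sphere_measure_bound[OF continuous_on_diff[OF cont' cg'], of e] g(2)[OF range]
      by (simp add: less_imp_le)
    finally have 1: "\<bar>(\<ointegral>x. \<psi> (x \<bullet> y)) - (\<ointegral>x. g (x \<bullet> y))\<bar> \<le> e" .
    have ig: "(\<lambda>t. g t * ?w t) integrable_on {-1..1}" "(\<lambda>t. \<psi> t * ?w t) integrable_on {-1..1}"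
      using p cont cg by (intro integrable_weight; simp)+
    have iw: "(\<lambda>t. e * ?w t) integrable_on {-1..1}"
      using p by (intro integrable_weight continuous_intros)
    have "?J\<psi> - ?Jg
        = integral {-1..1} (\<lambda>t. \<psi> t * ?w t - g t * ?w t)"
      using ig by (intro integral_diff[symmetric])
    also have "\<bar>\<dots>\<bar> \<le> integral {-1..1} (\<lambda>t. e * ?w t)"
    proof -
      have "norm (integral {-1..1} (\<lambda>t. \<psi> t * ?w t - g t * ?w t)) \<le> integral {-1..1} (\<lambda>t. e * ?w t)"
      proof (rule integral_norm_bound_integral)
        show "(\<lambda>t. \<psi> t * ?w t - g t * ?w t) integrable_on {-1..1}"
          using ig by (intro integrable_diff)
        show "norm (\<psi> t * ?w t - g t * ?w t) \<le> e * ?w t" if "t \<in> {-1..1}" for t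
        proof -
          have "norm (\<psi> t * ?w t - g t * ?w t) = \<bar>\<psi> t - g t\<bar> * ?w t"
            by (simp add: left_diff_distrib[symmetric] abs_mult)
          also have "\<dots> \<le> e * ?w t"
            using g(2)[OF that] by (intro mult_right_mono) auto
          finally show ?thesis .
        qed
      qed (use iw in auto)
      then show ?thesis by simp
    qed
    finally have "\<bar>?J\<psi> - ?Jg\<bar> \<le> e * integral {-1..1} ?w"
      by simp
    then have "?c * \<bar>?J\<psi> - ?Jg\<bar> \<le> ?c * (e * integral {-1..1} ?w)"
      using integral_weight_pos[OF p] by (intro mult_left_mono) auto
    also have "\<dots> = e * (?c * integral {-1..1} ?w)" by (simp only: mult_ac)
    also have "\<dots> = e" by (simp only: c mult_1_right)
    finally have le: "?c * \<bar>?J\<psi> - ?Jg\<bar> \<le> e" .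
    have "\<bar>?c * ?J\<psi> - ?c * ?Jg\<bar> \<le> e"
    proof -
      have "0 \<le> ?c" using integral_weight_pos[OF p] by simp
      then have "?c * \<bar>r - s\<bar> = \<bar>?c * r - ?c * s\<bar>" for r s
        by (simp only: right_diff_distrib[symmetric] abs_mult abs_of_nonneg)
      with le show ?thesis by (simp only:)
    qed
    with 1 int_g show ?thesis by linarith
  qed
  note bound = this
  have "\<bar>(\<ointegral>x. \<psi> (x \<bullet> y)) - ?c * ?J\<psi>\<bar> \<le> 0"
  proof (rule field_le_epsilon)
    fix e :: real assume "0 < e"
    then show "\<bar>(\<ointegral>x. \<psi> (x \<bullet> y)) - ?c * ?J\<psi>\<bar> \<le> 0 + e"
      using bound[of "e / 2"] by simp
  qed
  then show ?thesis by simp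
qed

section \<open>Homogeneous polynomials and the zonal kernel\<close>

lemma finite_multi_indices: "finite {a :: 'n::finite \<Rightarrow> nat. (\<Sum>i\<in>UNIV. a i) = d}"
proof (rule finite_subset)
  show "{a :: 'n \<Rightarrow> nat. (\<Sum>i\<in>UNIV. a i) = d} \<subseteq> PiE UNIV (\<lambda>_. {..d})"
  proof
    fix a :: "'n \<Rightarrow> nat" assume "a \<in> {a. (\<Sum>i\<in>UNIV. a i) = d}"
    then have "a i \<le> d" for i
      using member_le_sum[of i UNIV a] by simp
    then show "a \<in> PiE UNIV (\<lambda>_. {..d})" by auto
  qed
qed (simp add: finite_PiE)

lemma homogeneous_polynomialsE:
  assumes "f \<in> homogeneous_polynomials d"
  obtains c where
    "f = (\<lambda>x. \<Sum>a | (\<Sum>i\<in>UNIV. a i) = d. c a * complex_of_real (\<Prod>i\<in>UNIV. (x $ i) ^ a i))"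
  using assms unfolding homogeneous_polynomials_def by blast

lemma homogeneous_polynomials_add:
  assumes "f \<in> homogeneous_polynomials d" "g \<in> homogeneous_polynomials d"
  shows "(\<lambda>x. f x + g x) \<in> homogeneous_polynomials d"
proof -
  obtain c where "f = (\<lambda>x. \<Sum>a | (\<Sum>i\<in>UNIV. a i) = d. c a * complex_of_real (\<Prod>i\<in>UNIV. (x $ i) ^ a i))"
    using assms(1) by (rule homogeneous_polynomialsE)
  moreover obtain c' where "g = (\<lambda>x. \<Sum>a | (\<Sum>i\<in>UNIV. a i) = d. c' a * complex_of_real (\<Prod>i\<in>UNIV. (x $ i) ^ a i))"
    using assms(2) by (rule homogeneous_polynomialsE)
  ultimately show ?thesis
    unfolding homogeneous_polynomials_def
    by (auto intro!: exI[of _ "\<lambda>a. c a + c' a"] simp: sum.distrib distrib_right)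
qed

lemma homogeneous_polynomials_scale:
  assumes "f \<in> homogeneous_polynomials d"
  shows "(\<lambda>x. b * f x) \<in> homogeneous_polynomials d"
proof -
  obtain c where "f = (\<lambda>x. \<Sum>a | (\<Sum>i\<in>UNIV. a i) = d. c a * complex_of_real (\<Prod>i\<in>UNIV. (x $ i) ^ a i))"
    using assms by (rule homogeneous_polynomialsE)
  then show ?thesis
    unfolding homogeneous_polynomials_def
    by (auto intro!: exI[of _ "\<lambda>a. b * c a"] simp: sum_distrib_left mult.assoc)
qed

lemma homogeneous_polynomials_zero: "(\<lambda>x. 0) \<in> homogeneous_polynomials d"
  unfolding homogeneous_polynomials_def by (auto intro!: exI[of _ "\<lambda>a. 0"])

lemma homogeneous_polynomials_sum:
  assumes "finite I" "\<And>i. i \<in> I \<Longrightarrow> f i \<in> homogeneous_polynomials d"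
  shows "(\<lambda>x. \<Sum>i\<in>I. f i x) \<in> homogeneous_polynomials d"
  using assms by (induction I rule: finite_induct)
    (auto intro: homogeneous_polynomials_zero homogeneous_polynomials_add)

lemma continuous_on_homogeneous_polynomial:
  assumes "f \<in> homogeneous_polynomials d"
  shows "continuous_on A f"
proof -
  obtain c where "f = (\<lambda>x. \<Sum>a | (\<Sum>i\<in>UNIV. a i) = d. c a * complex_of_real (\<Prod>i\<in>UNIV. (x $ i) ^ a i))"
    using assms by (rule homogeneous_polynomialsE)
  then show ?thesis by (simp only:) (intro continuous_intros)
qed

lemma homogeneous_polynomials_const: "(\<lambda>x :: real ^ 'n. c) \<in> homogeneous_polynomials 0"
proof -
  have "{a :: 'n \<Rightarrow> nat. (\<Sum>i\<in>UNIV. a i) = 0} = {\<lambda>_. 0}" by (auto simp: fun_eq_iff)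
  then show ?thesis
    unfolding homogeneous_polynomials_def by (auto intro!: exI[of _ "\<lambda>a. c"])
qed

lemma homogeneous_polynomials_coordinate:
  fixes f :: "real ^ 'n \<Rightarrow> complex"
  assumes "f \<in> homogeneous_polynomials d"
  shows "(\<lambda>x. complex_of_real (x $ i) * f x) \<in> homogeneous_polynomials (Suc d)"
proof -
  let ?A = "\<lambda>d. {a :: 'n \<Rightarrow> nat. (\<Sum>i\<in>UNIV. a i) = d}"
  let ?m = "\<lambda>a (x :: real ^ 'n). \<Prod>i\<in>UNIV. (x $ i) ^ a i"
  obtain c where f: "f = (\<lambda>x. \<Sum>a\<in>?A d. c a * complex_of_real (?m a x))"
    using assms by (rule homogeneous_polynomialsE)
  define c' where "c' a = (if a i = 0 then 0 else c (a(i := a i - 1)))" for a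
  have up: "?m (a(i := Suc (a i))) x = x $ i * ?m a x" for a x
    using prod.remove[of UNIV i "\<lambda>j. (x $ j) ^ (a(i := Suc (a i))) j"] prod.remove[of UNIV i "\<lambda>j. (x $ j) ^ a j"]
    by (simp add: mult.assoc cong: prod.cong_simp)
  have deg: "(\<Sum>j\<in>UNIV. (a(i := Suc (a i))) j) = Suc (\<Sum>j\<in>UNIV. a j)" for a :: "'n \<Rightarrow> nat"
    using sum.remove[of UNIV i "a(i := Suc (a i))"] sum.remove[of UNIV i a] by (simp cong: sum.cong_simp)
  have "complex_of_real (x $ i) * f x = (\<Sum>b\<in>?A (Suc d). c' b * complex_of_real (?m b x))" for x
  proof -
    have "(\<Sum>b\<in>?A (Suc d). c' b * complex_of_real (?m b x)) =
        (\<Sum>b\<in>{b \<in> ?A (Suc d). b i \<noteq> 0}. c' b * complex_of_real (?m b x))"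
      by (rule sum.mono_neutral_right) (auto simp: finite_multi_indices c'_def)
    also have "\<dots> = (\<Sum>a\<in>?A d. c a * complex_of_real (x $ i * ?m a x))"
    proof (rule sum.reindex_bij_witness[where j = "\<lambda>b. b(i := b i - 1)" and i = "\<lambda>a. a(i := Suc (a i))"])
      fix b assume b: "b \<in> {b \<in> ?A (Suc d). b i \<noteq> 0}"
      then have "(b(i := b i - 1))(i := Suc ((b(i := b i - 1)) i)) = b" by auto
      then show "(b(i := b i - 1))(i := Suc ((b(i := b i - 1)) i)) = b"
        "b(i := b i - 1) \<in> ?A d"
        "c (b(i := b i - 1)) * complex_of_real (x $ i * ?m (b(i := b i - 1)) x) = c' b * complex_of_real (?m b x)"
        using b deg[of "b(i := b i - 1)"] up[where a = "b(i := b i - 1)" and x = x] by (auto simp: c'_def)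
    qed (use deg in auto)
    finally show ?thesis by (simp add: f sum_distrib_left mult_ac)
  qed
  then show ?thesis unfolding homogeneous_polynomials_def by blast
qed

lemma homogeneous_polynomials_inner:
  assumes "f \<in> homogeneous_polynomials d"
  shows "(\<lambda>x. complex_of_real (x \<bullet> v) * f x) \<in> homogeneous_polynomials (Suc d)"
proof -
  have "(\<lambda>x. \<Sum>i\<in>UNIV. complex_of_real (v $ i) * (complex_of_real (x $ i) * f x)) \<in> homogeneous_polynomials (Suc d)"
    by (intro homogeneous_polynomials_sum homogeneous_polynomials_scale homogeneous_polynomials_coordinate assms) simp
  then show ?thesis
    unfolding inner_vec_def of_real_sum sum_distrib_right by (simp add: mult_ac)
qed

lemma homogeneous_polynomials_norm:
  assumes "f \<in> homogeneous_polynomials d"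
  shows "(\<lambda>x. complex_of_real ((norm x)\<^sup>2) * f x) \<in> homogeneous_polynomials (Suc (Suc d))"
proof -
  have "(\<lambda>x. \<Sum>i\<in>UNIV. complex_of_real (x $ i) * (complex_of_real (x $ i) * f x)) \<in> homogeneous_polynomials (Suc (Suc d))"
    by (intro homogeneous_polynomials_sum homogeneous_polynomials_coordinate assms) simp
  then show ?thesis
    unfolding power2_norm_eq_inner inner_vec_def of_real_sum sum_distrib_right by (simp add: mult_ac)
qed

text \<open>Powers of the squared norm, which are 1 on the sphere, fill up the degree: this is how
  zonal polynomials of lower degree but equal parity become homogeneous of degree d.\<close>

lemma homogeneous_polynomials_zonal:
  "(\<lambda>x. complex_of_real (((norm x)\<^sup>2 - (x \<bullet> z)\<^sup>2) ^ m * (x \<bullet> z) ^ l * ((norm x)\<^sup>2) ^ k))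
     \<in> homogeneous_polynomials (2 * m + l + 2 * k)"
proof (induction m)
  case 0
  show ?case
  proof (induction l)
    case 0
    show ?case
    proof (induction k)
      case 0
      show ?case using homogeneous_polynomials_const[of 1] by simp
    next
      case (Suc k)
      from homogeneous_polynomials_norm[OF this] show ?case by simp
    qed
  next
    case (Suc l)
    from homogeneous_polynomials_inner[OF this, of z] show ?case by (simp add: mult_ac)
  qed
next
  case (Suc m)
  let ?f = "\<lambda>x. complex_of_real (((norm x)\<^sup>2 - (x \<bullet> z)\<^sup>2) ^ m * (x \<bullet> z) ^ l * ((norm x)\<^sup>2) ^ k)"
  have "(\<lambda>x. complex_of_real ((norm x)\<^sup>2) * ?f x + (- 1) * (complex_of_real (x \<bullet> z) * (complex_of_real (x \<bullet> z) * ?f x)))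
      \<in> homogeneous_polynomials (Suc (Suc (2 * m + l + 2 * k)))"
    by (intro homogeneous_polynomials_add homogeneous_polynomials_norm homogeneous_polynomials_scale
        homogeneous_polynomials_inner Suc)
  also have "(\<lambda>x. complex_of_real ((norm x)\<^sup>2) * ?f x + (- 1) * (complex_of_real (x \<bullet> z) * (complex_of_real (x \<bullet> z) * ?f x)))
      = (\<lambda>x. complex_of_real (((norm x)\<^sup>2 - (x \<bullet> z)\<^sup>2) ^ Suc m * (x \<bullet> z) ^ l * ((norm x)\<^sup>2) ^ k))"
    by (rule ext) (simp add: algebra_simps power2_eq_square)
  finally show ?case by simp
qed

text \<open>Polarization: the powers of linear forms span the homogeneous polynomials. A coordinate is
  split off by comparing coefficients of \<open>s\<close> in the powers of \<open>v + s e\<^sub>i\<close>.\<close>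

lemma linear_functional_monomial_eq_0:
  fixes L :: "(real ^ 'n \<Rightarrow> real) \<Rightarrow> real"
  assumes lin: "\<And>N c f. (\<And>j. continuous_on UNIV (f j)) \<Longrightarrow>
      L (\<lambda>x. \<Sum>j\<le>(N::nat). c j * f j x) = (\<Sum>j\<le>N. c j * L (f j))"
    and pow: "\<And>v. L (\<lambda>x. (x \<bullet> v) ^ d) = 0"
    and a: "(\<Sum>i\<in>UNIV. a i) = d"
  shows "L (\<lambda>x. \<Prod>i\<in>UNIV. (x $ i) ^ a i) = 0"
proof -
  \<comment> \<open>This interpolates between the hypothesis \<open>pow\<close> (A empty, k = d) and
    the goal (A everything, k = 0): A holds the coordinates already split off, k is the exponent
    left to the linear form.\<close>
  have "k + (\<Sum>i\<in>A. a i) = d \<Longrightarrow> L (\<lambda>x. (x \<bullet> v) ^ k * (\<Prod>i\<in>A. (x $ i) ^ a i)) = 0"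
    if "finite A" for A k v
    using that
  proof (induction A arbitrary: k v rule: finite_induct)
    case empty
    then show ?case using pow by simp
  next
    case (insert i A)
    define N where "N = k + a i"
    define f where "f j x = (x $ i) ^ j * (x \<bullet> v) ^ (N - j) * (\<Prod>i\<in>A. (x $ i) ^ a i)" for j and x :: "real ^ 'n"
    have "poly (\<Sum>j\<le>N. monom (real (N choose j) * L (f j)) j) s = poly 0 s" for s
    proof -
      have "0 = L (\<lambda>x. (x \<bullet> (v + s *\<^sub>R axis i 1)) ^ N * (\<Prod>i\<in>A. (x $ i) ^ a i))"
        using insert by (intro insert.IH[symmetric]) (simp add: N_def)
      also have "(\<lambda>x. (x \<bullet> (v + s *\<^sub>R axis i 1)) ^ N * (\<Prod>i\<in>A. (x $ i) ^ a i)) =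
          (\<lambda>x. \<Sum>j\<le>N. (real (N choose j) * s ^ j) * f j x)"
      proof
        fix x :: "real ^ 'n"
        have e: "x \<bullet> (v + s *\<^sub>R axis i 1) = s * x $ i + x \<bullet> v"
          by (simp add: inner_add_right inner_axis)
        show "(x \<bullet> (v + s *\<^sub>R axis i 1)) ^ N * (\<Prod>i\<in>A. (x $ i) ^ a i) =
            (\<Sum>j\<le>N. (real (N choose j) * s ^ j) * f j x)"
          unfolding e binomial_ring sum_distrib_right
          by (intro sum.cong refl) (simp add: power_mult_distrib f_def mult_ac)
      qed
      also have "L \<dots> = (\<Sum>j\<le>N. (real (N choose j) * s ^ j) * L (f j))"
        by (rule lin) (auto simp: f_def[abs_def] intro!: continuous_intros)
      finally show ?thesis by (simp add: poly_sum poly_monom mult_ac)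
    qed
    then have "(\<Sum>j\<le>N. monom (real (N choose j) * L (f j)) j) = 0"
      by (intro poly_eq_poly_eq_iff[THEN iffD1] ext)
    then have "coeff (\<Sum>j\<le>N. monom (real (N choose j) * L (f j)) j) (a i) = 0" by simp
    then have "(\<Sum>j\<le>N. if j = a i then real (N choose j) * L (f j) else 0) = 0"
      by (simp add: coeff_sum)
    then have "L (f (a i)) = 0" by (simp add: N_def)
    moreover have "f (a i) = (\<lambda>x. (x \<bullet> v) ^ k * (\<Prod>i\<in>insert i A. (x $ i) ^ a i))"
      using insert by (auto simp: f_def N_def mult_ac)
    ultimately show ?case by simp
  qed
  from this[of UNIV 0] show ?thesis using a by simp
qed

section \<open>The reproducing kernel and convolution with zonal functions\<close>

text \<open>With v = (v . y) y + r u, binomial expansion leaves only even powers of x . u. Hence r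
  enters through its square alone, and that is determined by v and y whatever u is.\<close>

lemma integral_sphere_poly_times_power:
  fixes q :: "real poly" and y v :: "real ^ 'n"
  assumes n: "CARD('n) > 2" and y: "norm y = 1"
  defines "p \<equiv> (real CARD('n) - 3) / 2"
  shows "(\<ointegral>x. poly q (x \<bullet> y) * (x \<bullet> v) ^ m) =
    (\<Sum>j\<le>m. if odd j then 0 else real (m choose j) * ((norm v)\<^sup>2 - (v \<bullet> y)\<^sup>2) ^ (j div 2) * (v \<bullet> y) ^ (m - j) *
      (zonal_coeff p (j div 2) *
        integral {-1..1} (\<lambda>t. poly q t * t ^ (m - j) * (1 - t\<^sup>2) powr (real (j div 2) + p))))"
proof -
  let ?r = "\<lambda>j. if odd j then 0 else real (m choose j) * ((norm v)\<^sup>2 - (v \<bullet> y)\<^sup>2) ^ (j div 2) * (v \<bullet> y) ^ (m - j) *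
      (zonal_coeff p (j div 2) *
        integral {-1..1} (\<lambda>t. poly q t * t ^ (m - j) * (1 - t\<^sup>2) powr (real (j div 2) + p)))"
  obtain u r where ou: "orthonormal_pair y u" and v: "v = (v \<bullet> y) *\<^sub>R y + r *\<^sub>R u"
    and r: "r\<^sup>2 = (norm v)\<^sup>2 - (v \<bullet> y)\<^sup>2"
    using unit_orthogonal_decomposition[OF n y] by metis
  interpret orthonormal_pair y u by (rule ou)
  let ?\<tau> = "v \<bullet> y"
  have "x \<bullet> v = r * (x \<bullet> u) + ?\<tau> * (x \<bullet> y)" for x
    by (subst v) (simp add: inner_add_right)
  then have "(\<ointegral>x. poly q (x \<bullet> y) * (x \<bullet> v) ^ m) =
      (\<ointegral>x. (\<Sum>j\<le>m. real (m choose j) * r ^ j * ?\<tau> ^ (m - j) *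
        (poly (q * monom 1 (m - j)) (x \<bullet> y) * (x \<bullet> u) ^ j)))"
    by (simp add: binomial_ring sum_distrib_left power_mult_distrib poly_monom mult_ac)
  also have "\<dots> = (\<Sum>j\<le>m. real (m choose j) * r ^ j * ?\<tau> ^ (m - j) *
        (\<ointegral>x. poly (q * monom 1 (m - j)) (x \<bullet> y) * (x \<bullet> u) ^ j))"
    by (subst Bochner_Integration.integral_sum) (auto intro!: integrable_sphere_measure continuous_intros)
  also have "\<dots> = (\<Sum>j\<le>m. ?r j)"
  proof (rule sum.cong[OF refl])
    fix j
    show "real (m choose j) * r ^ j * ?\<tau> ^ (m - j) *
        (\<ointegral>x. poly (q * monom 1 (m - j)) (x \<bullet> y) * (x \<bullet> u) ^ j) =
      ?r j"
    proof (cases "odd j")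
      case True
      then show ?thesis using integral_sphere_poly(2)[OF n True, of "q * monom 1 (m - j)"] by simp
    next
      case False
      then have j: "j = 2 * (j div 2)" by simp
      have "r ^ j = (r\<^sup>2) ^ (j div 2)" by (subst j) (simp only: power_mult)
      moreover have "(\<ointegral>x. poly (q * monom 1 (m - j)) (x \<bullet> y) * (x \<bullet> u) ^ j) =
          zonal_coeff p (j div 2) *
          integral {-1..1} (\<lambda>t. poly q t * t ^ (m - j) * (1 - t\<^sup>2) powr (real (j div 2) + p))"
        using integral_sphere_poly(1)[OF n, of "q * monom 1 (m - j)" "j div 2"] False
        by (simp add: p_def poly_monom)
      ultimately show ?thesis using False by (simp only: r if_False)
    qed
  qed
  finally show ?thesis .
qed

text \<open>The condition on the coefficients makes q(x . y) agree on the sphere with a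
  d-homogeneous polynomial in x: every missing degree is even and can be filled by the squared norm.
  The type argument fixes the dimension.\<close>

definition zonal_kernel :: "'n::finite itself \<Rightarrow> nat \<Rightarrow> real poly \<Rightarrow> bool" where
  "zonal_kernel _ d q \<longleftrightarrow> (\<forall>i. coeff q i \<noteq> 0 \<longrightarrow> i \<le> d \<and> even (d + i)) \<and>
     (\<forall>f\<in>homogeneous_polynomials d. \<forall>y :: real ^ 'n. norm y = 1 \<longrightarrow>
        (\<ointegral>x. complex_of_real (poly q (x \<bullet> y)) * f x) = f y)"

text \<open>By polarization, the difference of the two sides, a linear functional of f, vanishes on
  all monomials once it vanishes on powers of linear forms.\<close>

lemma reproducing_from_powers:
  fixes y :: "real ^ 'n"
  assumes y: "norm y = 1"
    and pow: "\<And>v :: real ^ 'n. (\<ointegral>x. poly q (x \<bullet> y) * (x \<bullet> v) ^ d) = (y \<bullet> v) ^ d"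
    and f: "f \<in> homogeneous_polynomials d"
  shows "(\<ointegral>x. complex_of_real (poly q (x \<bullet> y)) * f x) = f y"
proof -
  let ?A = "{a :: 'n \<Rightarrow> nat. (\<Sum>i\<in>UNIV. a i) = d}"
  let ?m = "\<lambda>a (x :: real ^ 'n). \<Prod>i\<in>UNIV. (x $ i) ^ a i"
  obtain c where c: "f = (\<lambda>x. \<Sum>a\<in>?A. c a * complex_of_real (?m a x))"
    using f by (rule homogeneous_polynomialsE)
  define L where "L g = (\<ointegral>x. poly q (x \<bullet> y) * g x) - g y" for g :: "real ^ 'n \<Rightarrow> real"
  have L0: "L (?m a) = 0" if "a \<in> ?A" for a
  proof (rule linear_functional_monomial_eq_0[where d = d])
    fix N b and g :: "nat \<Rightarrow> real ^ 'n \<Rightarrow> real"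
    assume "\<And>j. continuous_on UNIV (g j)"
    then have g: "continuous_on (sphere 0 1) (g j)" for j using continuous_on_subset by blast
    have "(\<ointegral>x. poly q (x \<bullet> y) * (\<Sum>j\<le>N. b j * g j x))
      = (\<ointegral>x. (\<Sum>j\<le>N. b j * (poly q (x \<bullet> y) * g j x)))"
      by (simp add: sum_distrib_left mult_ac)
    also have "\<dots> = (\<Sum>j\<le>N. b j * (\<ointegral>x. poly q (x \<bullet> y) * g j x))"
      by (subst Bochner_Integration.integral_sum)
         (auto intro!: integrable_sphere_measure continuous_intros g)
    finally show "L (\<lambda>x. \<Sum>j\<le>N. b j * g j x) = (\<Sum>j\<le>N. b j * L (g j))"
      by (simp add: L_def right_diff_distrib sum_subtractf)
  qed (use that pow in \<open>simp_all add: L_def\<close>)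
  have "(\<ointegral>x. complex_of_real (poly q (x \<bullet> y)) * f x)
      = (\<ointegral>x. (\<Sum>a\<in>?A. c a * complex_of_real (poly q (x \<bullet> y) * ?m a x)))"
    by (simp add: c sum_distrib_left mult_ac)
  also have "\<dots> = (\<Sum>a\<in>?A. c a * (\<ointegral>x. complex_of_real (poly q (x \<bullet> y) * ?m a x)))"
    by (subst Bochner_Integration.integral_sum) (auto intro!: integrable_sphere_measure continuous_intros)
  also have "\<dots> = f y"
    unfolding c using L0 by (intro sum.cong refl) (simp add: L_def del: of_real_mult of_real_prod)
  finally show ?thesis .
qed

lemma zonal_kernelE:
  fixes n d :: nat
  assumes "CARD('n::finite) = n" "n > 2"
  obtains q :: "real poly" where "zonal_kernel TYPE('n) d q"
    "\<And>y :: real ^ 'n. norm y = 1 \<Longrightarrow> (\<ointegral>x. \<bar>poly q (x \<bullet> y)\<bar>) = jacobi_integral n d"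
proof -
  define p where "p = (real n - 3) / 2"
  have p: "0 \<le> p" using assms by (simp add: p_def)
  have n: "CARD('n) > 2" "p = (real CARD('n) - 3) / 2" using assms by (simp_all add: p_def)
  obtain q where q: "\<And>i. coeff q i \<noteq> 0 \<Longrightarrow> i \<le> d \<and> even (d + i)"
    "integral {-1..1} (\<lambda>t. poly q t * t ^ d * (1 - t\<^sup>2) powr p) = 1"
    "\<And>k. 0 < k \<Longrightarrow> 2 * k \<le> d \<Longrightarrow>
       integral {-1..1} (\<lambda>t. poly q t * t ^ (d - 2 * k) * (1 - t\<^sup>2) powr (real k + p)) = 0"
    "integral {-1..1} (\<lambda>t. \<bar>poly q t\<bar> * (1 - t\<^sup>2) powr p) = jacobi_integral n d"
    by (rule zonal_kernel_exists[OF assms(2), of d, folded p_def]) (rule that)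
  \<comment> \<open>Total mass of the weight. Means over the sphere are normalized whereas q was
    normalized for the bare weight, so q is scaled by \<open>W\<close>. In the absolute integral the
    factor cancels again.\<close>
  define W where "W = integral {-1..1} (\<lambda>t. (1 - t\<^sup>2) powr p)"
  have W: "W > 0" unfolding W_def by (rule integral_weight_pos[OF p])
  have W0: "zonal_coeff p 0 = 1 / W" by (simp add: W_def)
  show thesis
  proof (rule that[of "Polynomial.smult W q"])
    show "zonal_kernel TYPE('n) d (Polynomial.smult W q)"
      unfolding zonal_kernel_def
    proof (intro conjI allI ballI impI)
      fix i assume "coeff (Polynomial.smult W q) i \<noteq> 0"
      then show "i \<le> d" "even (d + i)" using q(1)[of i] by auto
    next
      fix f :: "real ^ 'n \<Rightarrow> complex" and y :: "real ^ 'n"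
      assume f: "f \<in> homogeneous_polynomials d" and y: "norm y = 1"
      show "(\<ointegral>x. complex_of_real (poly (Polynomial.smult W q) (x \<bullet> y)) * f x) = f y"
      proof (rule reproducing_from_powers[OF y _ f])
        fix v :: "real ^ 'n"
        have "(\<ointegral>x. poly q (x \<bullet> y) * (x \<bullet> v) ^ d) =
          (\<Sum>j\<le>d. if j = 0 then 1 / W * (y \<bullet> v) ^ d else 0)"
          unfolding integral_sphere_poly_times_power[OF n(1) y, folded n(2)]
        proof (rule sum.cong[OF refl])
          fix j assume "j \<in> {..d}"
          show "(if odd j then 0 else real (d choose j) * ((norm v)\<^sup>2 - (v \<bullet> y)\<^sup>2) ^ (j div 2) * (v \<bullet> y) ^ (d - j) *
              (zonal_coeff p (j div 2) *
              integral {-1..1} (\<lambda>t. poly q t * t ^ (d - j) * (1 - t\<^sup>2) powr (real (j div 2) + p))))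
              = (if j = 0 then 1 / W * (y \<bullet> v) ^ d else 0)"
          proof (cases "odd j \<or> j = 0")
            case True
            then show ?thesis using q(2) W0 by (auto simp: inner_commute simp del: zonal_coeff.simps)
          next
            case False
            then have "0 < j div 2" "2 * (j div 2) = j" "2 * (j div 2) \<le> d"
              using \<open>j \<in> {..d}\<close> by auto
            with q(3)[of "j div 2"] False show ?thesis by simp
          qed
        qed
        then show "(\<ointegral>x. poly (Polynomial.smult W q) (x \<bullet> y) * (x \<bullet> v) ^ d) = (y \<bullet> v) ^ d"
          using W by (simp add: mult.assoc)
      qed
    qed
    fix y :: "real ^ 'n" assume y: "norm y = 1"
    have "(\<ointegral>x. \<bar>poly (Polynomial.smult W q) (x \<bullet> y)\<bar>) = W * (\<ointegral>x. \<bar>poly q (x \<bullet> y)\<bar>)"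
      using W by (simp add: abs_mult)
    also have "\<dots> = integral {-1..1} (\<lambda>t. \<bar>poly q t\<bar> * (1 - t\<^sup>2) powr p)"
      using integral_sphere_zonal[OF n(1) y, of "\<lambda>t. \<bar>poly q t\<bar>", folded n(2)] W W0
      by (simp add: continuous_intros del: zonal_coeff.simps)
    finally show "(\<ointegral>x. \<bar>poly (Polynomial.smult W q) (x \<bullet> y)\<bar>) = jacobi_integral n d"
      using q(4) by (simp only:)
  qed
qed

text \<open>Convolution with \<open>\<phi>\<close>, of whatever degree, preserves the spherical
  polynomials. Each power (x . z)^i integrates to a combination of (1 - (y . z)^2)^(j/2) (y .
  z)^(i-j) with j even; replacing 1 by the squared norm of y and padding with it gives degree
  d.\<close>

lemma zonal_convolution_homogeneous:
  fixes z :: "real ^ 'n"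
  assumes n: "CARD('n) > 2" and z: "norm z = 1" and q: "zonal_kernel TYPE('n) d q"
  obtains f where "f \<in> homogeneous_polynomials d"
    "\<And>y. norm y = 1 \<Longrightarrow> complex_of_real (\<ointegral>x. poly \<phi> (x \<bullet> y) * poly q (x \<bullet> z)) = f y"
proof -
  let ?I = "{i. i \<le> degree q \<and> coeff q i \<noteq> 0}"
  define p where "p = (real CARD('n) - 3) / 2"
  define J where "J i j = zonal_coeff p (j div 2) *
        integral {-1..1} (\<lambda>t. poly \<phi> t * t ^ (i - j) * (1 - t\<^sup>2) powr (real (j div 2) + p))" for i j
  define f where "f y = (\<Sum>i\<in>?I. complex_of_real (coeff q i) *
    (\<Sum>j\<in>{j. j \<le> i \<and> even j}. complex_of_real (real (i choose j) * J i j) *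
      complex_of_real (((norm y)\<^sup>2 - (y \<bullet> z)\<^sup>2) ^ (j div 2) * (y \<bullet> z) ^ (i - j) * ((norm y)\<^sup>2) ^ ((d - i) div 2))))"
    for y
  show thesis
  proof (rule that[of f])
    show "f \<in> homogeneous_polynomials d"
      unfolding f_def[abs_def]
    proof (intro homogeneous_polynomials_sum homogeneous_polynomials_scale)
      fix i j assume i: "i \<in> ?I" and j: "j \<in> {j. j \<le> i \<and> even j}"
      then have "i \<le> d" "even (d + i)" using q by (auto simp: zonal_kernel_def)
      then have "2 * (j div 2) + (i - j) + 2 * ((d - i) div 2) = d" using j by auto
      then show "(\<lambda>y. complex_of_real (((norm y)\<^sup>2 - (y \<bullet> z)\<^sup>2) ^ (j div 2) * (y \<bullet> z) ^ (i - j) * ((norm y)\<^sup>2) ^ ((d - i) div 2)))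
          \<in> homogeneous_polynomials d"
        using homogeneous_polynomials_zonal[of z "j div 2" "i - j" "(d - i) div 2"] by metis
    qed auto
    fix y :: "real ^ 'n" assume y: "norm y = 1"
    have "(\<ointegral>x. poly \<phi> (x \<bullet> y) * poly q (x \<bullet> z)) =
      (\<ointegral>x. (\<Sum>i\<in>?I. coeff q i * (poly \<phi> (x \<bullet> y) * (x \<bullet> z) ^ i)))"
    proof (rule Bochner_Integration.integral_cong[OF refl])
      fix x
      have "poly q (x \<bullet> z) = (\<Sum>i\<in>?I. coeff q i * (x \<bullet> z) ^ i)"
        unfolding poly_altdef by (rule sum.mono_neutral_right) auto
      then show "poly \<phi> (x \<bullet> y) * poly q (x \<bullet> z) = (\<Sum>i\<in>?I. coeff q i * (poly \<phi> (x \<bullet> y) * (x \<bullet> z) ^ i))"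
        by (simp add: sum_distrib_left mult_ac)
    qed
    also have "\<dots> = (\<Sum>i\<in>?I. coeff q i * (\<ointegral>x. poly \<phi> (x \<bullet> y) * (x \<bullet> z) ^ i))"
      by (subst Bochner_Integration.integral_sum) (auto intro!: integrable_sphere_measure continuous_intros)
    also have "\<dots> = (\<Sum>i\<in>?I. coeff q i *
      (\<Sum>j\<in>{j. j \<le> i \<and> even j}. real (i choose j) * J i j * ((1 - (y \<bullet> z)\<^sup>2) ^ (j div 2) * (y \<bullet> z) ^ (i - j))))"
    proof (intro sum.cong refl arg_cong2[where f = "(*)"])
      fix i
      have "(\<ointegral>x. poly \<phi> (x \<bullet> y) * (x \<bullet> z) ^ i) =
         (\<Sum>j\<le>i. if even j then real (i choose j) * J i j * ((1 - (y \<bullet> z)\<^sup>2) ^ (j div 2) * (y \<bullet> z) ^ (i - j)) else 0)"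
        unfolding integral_sphere_poly_times_power[OF n y, folded p_def]
        by (intro sum.cong refl) (simp add: J_def z inner_commute mult_ac)
      also have "\<dots> = (\<Sum>j\<in>{j. j \<le> i \<and> even j}. real (i choose j) * J i j * ((1 - (y \<bullet> z)\<^sup>2) ^ (j div 2) * (y \<bullet> z) ^ (i - j)))"
        by (rule sum.mono_neutral_cong_right) auto
      finally show "(\<ointegral>x. poly \<phi> (x \<bullet> y) * (x \<bullet> z) ^ i) = \<dots>" .
    qed
    finally show "complex_of_real (\<ointegral>x. poly \<phi> (x \<bullet> y) * poly q (x \<bullet> z)) = f y"
      by (simp add: f_def y)
  qed
qed

section \<open>Degenerate kernels\<close>

text \<open>Any linear functional of the second variable, even one without measurability, can be
  applied term by term, and the result is a combination of the left factors, hence stays in their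
  span. Lists make sums of kernels a concatenation.\<close>

definition finite_rank :: "('a::real_normed_vector \<Rightarrow> complex) set \<Rightarrow> ('a \<Rightarrow> 'a \<Rightarrow> complex) \<Rightarrow> bool" where
  "finite_rank X K \<longleftrightarrow> (\<exists>xs. (\<forall>(g, h)\<in>set xs. g \<in> X \<and> continuous_on (sphere 0 1) h) \<and>
     (\<forall>x\<in>sphere 0 1. \<forall>z. K x z = (\<Sum>(g, h)\<leftarrow>xs. g x * h z)))"

lemma finite_rank_add:
  assumes "finite_rank X K" "finite_rank X K'"
  shows "finite_rank X (\<lambda>x z. K x z + K' x z)"
proof -
  obtain xs where xs: "\<forall>(g, h)\<in>set xs. g \<in> X \<and> continuous_on (sphere 0 1) h"
    "\<forall>x\<in>sphere 0 1. \<forall>z. K x z = (\<Sum>(g, h)\<leftarrow>xs. g x * h z)"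
    using assms(1) unfolding finite_rank_def by blast
  obtain ys where ys: "\<forall>(g, h)\<in>set ys. g \<in> X \<and> continuous_on (sphere 0 1) h"
    "\<forall>x\<in>sphere 0 1. \<forall>z. K' x z = (\<Sum>(g, h)\<leftarrow>ys. g x * h z)"
    using assms(2) unfolding finite_rank_def by blast
  show ?thesis
    unfolding finite_rank_def using xs ys by (intro exI[of _ "xs @ ys"]) auto
qed

lemma finite_rank_zero: "finite_rank X (\<lambda>x z. 0)"
  unfolding finite_rank_def by (intro exI[of _ "[]"]) simp

lemma finite_rank_sum:
  assumes "finite I" "\<And>i. i \<in> I \<Longrightarrow> finite_rank X (K i)"
  shows "finite_rank X (\<lambda>x z. \<Sum>i\<in>I. K i x z)"
  using assms by (induction I rule: finite_induct) (auto intro: finite_rank_zero finite_rank_add)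

lemma finite_rank_cong:
  assumes "finite_rank X K" "\<And>x z. norm x = 1 \<Longrightarrow> K' x z = K x z"
  shows "finite_rank X K'"
  using assms unfolding finite_rank_def by simp

lemma finite_rank_mult:
  assumes K: "finite_rank X K" and \<alpha>: "\<And>g. g \<in> X \<Longrightarrow> (\<lambda>x. \<alpha> x * g x) \<in> Y"
    and \<beta>: "continuous_on (sphere 0 1) \<beta>"
  shows "finite_rank Y (\<lambda>x z. \<alpha> x * \<beta> z * K x z)"
proof -
  obtain xs where xs: "\<forall>(g, h)\<in>set xs. g \<in> X \<and> continuous_on (sphere 0 1) h"
    "\<forall>x\<in>sphere 0 1. \<forall>z. K x z = (\<Sum>(g, h)\<leftarrow>xs. g x * h z)"
    using K unfolding finite_rank_def by blast
  have "\<alpha> x * \<beta> z * (\<Sum>(g, h)\<leftarrow>xs. g x * h z) =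
      (\<Sum>(g, h)\<leftarrow>map (\<lambda>(g, h). (\<lambda>x. \<alpha> x * g x, \<lambda>z. \<beta> z * h z)) xs. g x * h z)" for x z
    by (simp add: sum_list_const_mult[symmetric] o_def case_prod_unfold mult_ac)
  with xs \<alpha> \<beta> show ?thesis
    unfolding finite_rank_def
    by (intro exI[of _ "map (\<lambda>(g, h). (\<lambda>x. \<alpha> x * g x, \<lambda>z. \<beta> z * h z)) xs"])
       (auto intro!: continuous_on_mult)
qed

lemma finite_rank_inner_power:
  "finite_rank (homogeneous_polynomials m) (\<lambda>x z :: real ^ 'n. complex_of_real ((x \<bullet> z) ^ m))"
proof (induction m)
  case 0
  show ?case
    unfolding finite_rank_def
    by (intro exI[of _ "[(\<lambda>_. 1, \<lambda>_. 1)]"]) (auto intro: homogeneous_polynomials_const continuous_intros)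
next
  case (Suc m)
  have "finite_rank (homogeneous_polynomials (Suc m))
     (\<lambda>x z :: real ^ 'n. \<Sum>i\<in>UNIV. complex_of_real (x $ i) * complex_of_real (z $ i) * complex_of_real ((x \<bullet> z) ^ m))"
    by (intro finite_rank_sum finite_rank_mult[OF Suc] homogeneous_polynomials_coordinate continuous_intros) simp
  then show ?case
    by (rule finite_rank_cong) (simp add: inner_vec_def sum_distrib_right)
qed

text \<open>Having homogeneous polynomials as left factors is what later puts the values of the
  constructed projection into the polynomial space.\<close>

lemma finite_rank_zonal_kernel:
  assumes "zonal_kernel TYPE('n::finite) d q"
  shows "finite_rank (homogeneous_polynomials d) (\<lambda>x z :: real ^ 'n. complex_of_real (poly q (x \<bullet> z)))"
proof -
  let ?I = "{i. i \<le> degree q \<and> coeff q i \<noteq> 0}"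
  have "finite_rank (homogeneous_polynomials d)
     (\<lambda>x z :: real ^ 'n. \<Sum>i\<in>?I.
        (complex_of_real (coeff q i) * complex_of_real (((norm x)\<^sup>2) ^ ((d - i) div 2))) * 1 * complex_of_real ((x \<bullet> z) ^ i))"
  proof (intro finite_rank_sum finite_rank_mult[OF finite_rank_inner_power])
    fix i and g :: "real ^ 'n \<Rightarrow> complex"
    assume "i \<in> ?I" and g: "g \<in> homogeneous_polynomials i"
    then have "i \<le> d" "even (d + i)" using assms by (auto simp: zonal_kernel_def)
    then have d: "d = i + 2 * ((d - i) div 2)" by auto
    have "(\<lambda>x. complex_of_real (((norm x)\<^sup>2) ^ k) * g x) \<in> homogeneous_polynomials (i + 2 * k)" for k
    proof (induction k)
      case 0
      then show ?case using g by simp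
    next
      case (Suc k)
      from homogeneous_polynomials_norm[OF this] show ?case by (simp add: mult_ac)
    qed
    then have "(\<lambda>x. complex_of_real (coeff q i) * (complex_of_real (((norm x)\<^sup>2) ^ ((d - i) div 2)) * g x)) \<in> homogeneous_polynomials d"
      by (subst d) (intro homogeneous_polynomials_scale)
    then show "(\<lambda>x. complex_of_real (coeff q i) * complex_of_real (((norm x)\<^sup>2) ^ ((d - i) div 2)) * g x) \<in> homogeneous_polynomials d"
      by (simp only: mult.assoc)
  qed (auto intro: continuous_intros)
  then show ?thesis
  proof (rule finite_rank_cong)
    fix x z :: "real ^ 'n" assume "norm x = 1"
    moreover have "poly q (x \<bullet> z) = (\<Sum>i\<in>?I. coeff q i * (x \<bullet> z) ^ i)"
      unfolding poly_altdef by (rule sum.mono_neutral_right) auto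
    ultimately show "complex_of_real (poly q (x \<bullet> z)) = (\<Sum>i\<in>?I.
        (complex_of_real (coeff q i) * complex_of_real (((norm x)\<^sup>2) ^ ((d - i) div 2))) * 1 * complex_of_real ((x \<bullet> z) ^ i))"
      by simp
  qed
qed

lemma finite_rank_poly:
  "finite_rank {g. continuous_on (sphere 0 1) g} (\<lambda>x z :: real ^ 'n. complex_of_real (poly q (x \<bullet> z)))"
proof -
  have "finite_rank {g. continuous_on (sphere 0 1) g}
     (\<lambda>x z :: real ^ 'n. \<Sum>i\<le>degree q. complex_of_real (coeff q i) * 1 * complex_of_real ((x \<bullet> z) ^ i))"
    by (intro finite_rank_sum finite_rank_mult[OF finite_rank_inner_power])
       (auto intro!: continuous_on_mult continuous_on_const intro: continuous_on_homogeneous_polynomial)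
  then show ?thesis
    by (rule finite_rank_cong) (simp add: poly_altdef)
qed

section \<open>The Hahn-Banach theorem for complex modules\<close>

lemma complex_field_simps [simp]:
  "carrier complex_field = UNIV" "x \<otimes>\<^bsub>complex_field\<^esub> y = x * y" "\<one>\<^bsub>complex_field\<^esub> = 1"
  "\<zero>\<^bsub>complex_field\<^esub> = 0" "x \<oplus>\<^bsub>complex_field\<^esub> y = x + y"
  by (simp_all add: complex_field_def)

lemma cring_complex_field: "cring complex_field"
proof (rule cringI)
  show "abelian_group complex_field"
    by (rule abelian_groupI) (auto simp: algebra_simps intro: exI[of _ "- x" for x])
  show "comm_monoid complex_field"
    by (rule comm_monoidI) (auto simp: algebra_simps)
qed (simp add: algebra_simps)

text \<open>A real-linear functional on a part of \<open>V\<close> is represented by its graph. Single-valuedness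
  need not be demanded, since domination by \<open>p\<close> enforces it.\<close>

definition dominated_graph :: "('a, 'b) cnormed_scheme \<Rightarrow> ('a \<Rightarrow> real) \<Rightarrow> ('a \<times> real) set \<Rightarrow> bool" where
  "dominated_graph V p G \<longleftrightarrow> fst ` G \<subseteq> carrier V \<and> (\<zero>\<^bsub>V\<^esub>, 0) \<in> G \<and>
     (\<forall>x r y s. (x, r) \<in> G \<longrightarrow> (y, s) \<in> G \<longrightarrow> (x \<oplus>\<^bsub>V\<^esub> y, r + s) \<in> G) \<and>
     (\<forall>c x r. (x, r) \<in> G \<longrightarrow> (complex_of_real c \<odot>\<^bsub>V\<^esub> x, c * r) \<in> G) \<and>
     (\<forall>x r. (x, r) \<in> G \<longrightarrow> r \<le> p x)"

locale complex_module = Module.module complex_field V for V :: "'a cnormed" (structure)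
begin

lemma smult_closed' [simp]: "x \<in> carrier V \<Longrightarrow> c \<odot> x \<in> carrier V"
  using smult_closed by simp

lemma smult_l_distr': "x \<in> carrier V \<Longrightarrow> (a + b) \<odot> x = a \<odot> x \<oplus> b \<odot> x"
  using smult_l_distr by simp

lemma smult_r_distr': "x \<in> carrier V \<Longrightarrow> y \<in> carrier V \<Longrightarrow> a \<odot> (x \<oplus> y) = a \<odot> x \<oplus> a \<odot> y"
  using smult_r_distr by simp

lemma smult_assoc': "x \<in> carrier V \<Longrightarrow> a \<odot> (b \<odot> x) = (a * b) \<odot> x"
  using smult_assoc1 by simp

lemma smult_one' [simp]: "x \<in> carrier V \<Longrightarrow> 1 \<odot> x = x"
  using smult_one by simp

lemma smult_zero' [simp]: "x \<in> carrier V \<Longrightarrow> 0 \<odot> x = \<zero>"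
  using smult_l_null by simp

lemma smult_zero_right' [simp]: "c \<odot> \<zero> = \<zero>"
  using smult_r_null by simp

lemma minus_eq_smult: "x \<in> carrier V \<Longrightarrow> \<ominus> x = (- 1) \<odot> x"
proof (rule M.minus_equality)
  assume x: "x \<in> carrier V"
  show "(- 1) \<odot> x \<oplus> x = \<zero>"
    using smult_l_distr'[OF x, of "-1" 1] x by simp
qed simp_all

lemma diff_eq_smult: "x \<in> carrier V \<Longrightarrow> y \<in> carrier V \<Longrightarrow> x \<ominus> y = x \<oplus> (- 1) \<odot> y"
  by (simp add: a_minus_def minus_eq_smult)

end

locale sublinear = complex_module V for V :: "'a cnormed" (structure) +
  fixes p :: "'a \<Rightarrow> real"
  assumes subadd: "x \<in> carrier V \<Longrightarrow> y \<in> carrier V \<Longrightarrow> p (x \<oplus> y) \<le> p x + p y"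
    and poshom: "x \<in> carrier V \<Longrightarrow> 0 \<le> c \<Longrightarrow> p (complex_of_real c \<odot> x) = c * p x"
begin

lemma dominated_graph_extend:
  assumes G: "dominated_graph V p G" and v: "v \<in> carrier V"
  obtains G' \<alpha> where "dominated_graph V p G'" "G \<subseteq> G'" "(v, \<alpha>) \<in> G'"
proof -
  have Gc: "\<And>x r. (x, r) \<in> G \<Longrightarrow> x \<in> carrier V" and G0: "(\<zero>, 0) \<in> G"
    and Ga: "\<And>x r y s. (x, r) \<in> G \<Longrightarrow> (y, s) \<in> G \<Longrightarrow> (x \<oplus> y, r + s) \<in> G"
    and Gm: "\<And>c x r. (x, r) \<in> G \<Longrightarrow> (complex_of_real c \<odot> x, c * r) \<in> G"
    and Gp: "\<And>x r. (x, r) \<in> G \<Longrightarrow> r \<le> p x"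
    using G unfolding dominated_graph_def by (auto simp: image_subset_iff)
  have sep: "r - p (x \<oplus> (- 1) \<odot> v) \<le> p (y \<oplus> v) - s" if "(x, r) \<in> G" "(y, s) \<in> G" for x r y s
  proof -
    have [simp]: "x \<in> carrier V" "y \<in> carrier V" using that Gc by auto
    have "x \<oplus> y = (x \<oplus> y) \<oplus> ((- 1) \<odot> v \<oplus> v)"
      using smult_l_distr'[OF v, of "-1" 1] v by simp
    also have "\<dots> = (x \<oplus> (- 1) \<odot> v) \<oplus> (y \<oplus> v)"
      using v by (simp add: M.a_ac)
    finally have "p (x \<oplus> y) \<le> p (x \<oplus> (- 1) \<odot> v) + p (y \<oplus> v)"
      using subadd[of "x \<oplus> (- 1) \<odot> v" "y \<oplus> v"] v by simp
    then show ?thesis using Gp[OF Ga[OF that]] by simp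
  qed
  define A where "A = (\<lambda>(x, r). r - p (x \<oplus> (- 1) \<odot> v)) ` G"
  define \<alpha> where "\<alpha> = Sup A"
  have "A \<noteq> {}" using G0 by (auto simp: A_def)
  have up: "\<alpha> \<le> p (y \<oplus> v) - s" if "(y, s) \<in> G" for y s
    unfolding \<alpha>_def using sep that \<open>A \<noteq> {}\<close> by (intro cSup_least) (auto simp: A_def)
  have "bdd_above A"
    using sep[OF _ G0] by (auto simp: A_def intro!: bdd_aboveI)
  then have lo: "r - p (x \<oplus> (- 1) \<odot> v) \<le> \<alpha>" if "(x, r) \<in> G" for x r
    unfolding \<alpha>_def using that by (intro cSup_upper) (auto simp: A_def image_iff intro!: bexI[of _ "(x, r)"])
  have dom: "r + t * \<alpha> \<le> p (x \<oplus> complex_of_real t \<odot> v)" if xr: "(x, r) \<in> G" for x r t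
  proof -
    have [simp]: "x \<in> carrier V" using Gc xr by auto
    \<comment> \<open>Positive homogeneity, after division by the absolute value of t, reduces the
      three cases to \<open>Gp\<close>, \<open>up\<close> and \<open>lo\<close>.\<close>
    consider "t = 0" | "t > 0" | "t < 0" by linarith
    then show ?thesis
    proof cases
      case 1
      then show ?thesis using Gp[OF xr] v by simp
    next
      case 2
      have "\<alpha> \<le> p (complex_of_real (1 / t) \<odot> x \<oplus> v) - 1 / t * r"
        using up[OF Gm[OF xr, of "1 / t"]] .
      also have "complex_of_real (1 / t) \<odot> x \<oplus> v = complex_of_real (1 / t) \<odot> (x \<oplus> complex_of_real t \<odot> v)"
        using 2 v by (simp add: smult_r_distr' smult_assoc' del: of_real_divide flip: of_real_mult)
      also have "p \<dots> = 1 / t * p (x \<oplus> complex_of_real t \<odot> v)"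
        using 2 v by (intro poshom) auto
      finally show ?thesis using 2 by (simp add: field_simps)
    next
      case 3
      have "1 / (- t) * r - p (complex_of_real (1 / (- t)) \<odot> x \<oplus> (- 1) \<odot> v) \<le> \<alpha>"
        using lo[OF Gm[OF xr, of "1 / (- t)"]] .
      also have "complex_of_real (1 / (- t)) \<odot> x \<oplus> (- 1) \<odot> v
          = complex_of_real (1 / (- t)) \<odot> (x \<oplus> complex_of_real t \<odot> v)"
      proof -
        have "complex_of_real (1 / (- t)) * complex_of_real t = - 1" using 3 by simp
        then show ?thesis using v by (simp only: smult_r_distr' smult_assoc' smult_closed' \<open>x \<in> carrier V\<close>)
      qed
      also have "p \<dots> = 1 / (- t) * p (x \<oplus> complex_of_real t \<odot> v)"
        using 3 v by (intro poshom) auto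
      finally show ?thesis using 3 by (simp add: field_simps)
    qed
  qed
  define G' where "G' = {(x \<oplus> complex_of_real t \<odot> v, r + t * \<alpha>) | x r t. (x, r) \<in> G}"
  show thesis
  proof (rule that[of G' \<alpha>])
    show "G \<subseteq> G'"
    proof safe
      fix x r assume xr: "(x, r) \<in> G"
      then have "(x \<oplus> complex_of_real 0 \<odot> v, r + 0 * \<alpha>) \<in> G'"
        unfolding G'_def by blast
      then show "(x, r) \<in> G'" using v Gc[OF xr] by simp
    qed
    have "(\<zero> \<oplus> complex_of_real 1 \<odot> v, 0 + 1 * \<alpha>) \<in> G'"
      unfolding G'_def using G0 by blast
    then show "(v, \<alpha>) \<in> G'" using v by simp
    show "dominated_graph V p G'"
      unfolding dominated_graph_def
    proof (intro conjI allI impI)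
      show "fst ` G' \<subseteq> carrier V" using v Gc by (auto simp: G'_def)
      show "(\<zero>, 0) \<in> G'" using \<open>G \<subseteq> G'\<close> G0 by blast
      show "(a \<oplus> b, r + s) \<in> G'" if ab: "(a, r) \<in> G'" "(b, s) \<in> G'" for a r b s
      proof -
        obtain x r' t where x: "a = x \<oplus> complex_of_real t \<odot> v" "r = r' + t * \<alpha>" "(x, r') \<in> G"
          using ab(1) by (auto simp: G'_def)
        obtain y s' u where y: "b = y \<oplus> complex_of_real u \<odot> v" "s = s' + u * \<alpha>" "(y, s') \<in> G"
          using ab(2) by (auto simp: G'_def)
        have "(x \<oplus> y \<oplus> complex_of_real (t + u) \<odot> v, r' + s' + (t + u) * \<alpha>) \<in> G'"
          unfolding G'_def using Ga[OF x(3) y(3)] by blast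
        moreover have "x \<oplus> y \<oplus> complex_of_real (t + u) \<odot> v = a \<oplus> b"
          using Gc[OF x(3)] Gc[OF y(3)] v by (simp add: x y smult_l_distr' M.a_ac)
        ultimately show ?thesis by (simp add: x y algebra_simps)
      qed
      show "(complex_of_real c \<odot> a, c * r) \<in> G'" if a: "(a, r) \<in> G'" for c a r
      proof -
        obtain x r' t where x: "a = x \<oplus> complex_of_real t \<odot> v" "r = r' + t * \<alpha>" "(x, r') \<in> G"
          using a by (auto simp: G'_def)
        have "(complex_of_real c \<odot> x \<oplus> complex_of_real (c * t) \<odot> v, c * r' + (c * t) * \<alpha>) \<in> G'"
          unfolding G'_def using Gm[OF x(3)] by blast
        then show ?thesis
          using Gc[OF x(3)] v by (simp add: x smult_r_distr' smult_assoc' algebra_simps)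
      qed
      show "r \<le> p a" if "(a, r) \<in> G'" for a r
        using that dom by (auto simp: G'_def)
    qed
  qed
qed

text \<open>Zorn's lemma: unions of chains stay dominated graphs, and a maximal one is total since
  any missing vector could be added by \<open>dominated_graph_extend\<close>.\<close>

lemma dominated_graph_total:
  assumes G: "dominated_graph V p G"
  obtains G' where "dominated_graph V p G'" "G \<subseteq> G'" "fst ` G' = carrier V"
proof -
  let ?A = "{H. dominated_graph V p H \<and> G \<subseteq> H}"
  have "\<exists>M\<in>?A. \<forall>X\<in>?A. M \<subseteq> X \<longrightarrow> X = M"
  proof (rule subset_Zorn_nonempty)
    show "?A \<noteq> {}" using G by auto
    fix C assume ne: "C \<noteq> {}" and ch: "subset.chain ?A C"
    then have C: "\<And>H. H \<in> C \<Longrightarrow> dominated_graph V p H" "\<And>H. H \<in> C \<Longrightarrow> G \<subseteq> H"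
      and lin: "\<And>H K. H \<in> C \<Longrightarrow> K \<in> C \<Longrightarrow> H \<subseteq> K \<or> K \<subseteq> H"
      unfolding subset_chain_def by blast+
    have "dominated_graph V p (\<Union>C)"
      unfolding dominated_graph_def
    proof (intro conjI allI impI)
      show "fst ` \<Union>C \<subseteq> carrier V" using C(1) unfolding dominated_graph_def by blast
      show "(\<zero>, 0) \<in> \<Union>C" using C(1) ne unfolding dominated_graph_def by blast
      show "(x \<oplus> y, r + s) \<in> \<Union>C" if xy: "(x, r) \<in> \<Union>C" "(y, s) \<in> \<Union>C" for x r y s
      proof -
        obtain H K where H: "(x, r) \<in> H" "H \<in> C" and K: "(y, s) \<in> K" "K \<in> C"
          using xy by auto
        then obtain L where L: "L \<in> C" "(x, r) \<in> L" "(y, s) \<in> L"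
          using lin[of H K] by blast
        then have "(x \<oplus> y, r + s) \<in> L"
          using C(1)[OF L(1)] unfolding dominated_graph_def by blast
        then show ?thesis using L(1) by blast
      qed
      show "(complex_of_real c \<odot> x, c * r) \<in> \<Union>C" if "(x, r) \<in> \<Union>C" for c x r
        using that C(1) unfolding dominated_graph_def by blast
      show "r \<le> p x" if "(x, r) \<in> \<Union>C" for x r
        using that C(1) unfolding dominated_graph_def by blast
    qed
    then show "\<Union>C \<in> ?A" using C(2) ne by auto
  qed
  then obtain M where M: "dominated_graph V p M" "G \<subseteq> M"
    and max: "\<And>X. dominated_graph V p X \<Longrightarrow> M \<subseteq> X \<Longrightarrow> X = M"
    by (smt (verit) mem_Collect_eq order_trans)
  have "carrier V \<subseteq> fst ` M"
  proof
    fix v assume "v \<in> carrier V"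
    then obtain G' \<alpha> where "dominated_graph V p G'" "M \<subseteq> G'" "(v, \<alpha>) \<in> G'"
      using dominated_graph_extend[OF M(1)] by metis
    with max show "v \<in> fst ` M" by force
  qed
  moreover have "fst ` M \<subseteq> carrier V" using M(1) by (simp add: dominated_graph_def)
  ultimately show thesis using that M by blast
qed

end

text \<open>The real part of f is extended as a real-linear functional u. A complex-linear
  functional is determined by its real part, and a rotation by a phase turns the one-sided bound for
  u into a bound for the modulus.\<close>

theorem (in complex_module) hahn_banach:
  fixes p :: "'a \<Rightarrow> real" and f :: "'a \<Rightarrow> complex"
  assumes p_add: "\<And>x y. x \<in> carrier V \<Longrightarrow> y \<in> carrier V \<Longrightarrow> p (x \<oplus> y) \<le> p x + p y"
    and p_smult: "\<And>c x. x \<in> carrier V \<Longrightarrow> p (c \<odot> x) = cmod c * p x"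
    and U: "U \<subseteq> carrier V" "\<zero> \<in> U" "\<And>x y. x \<in> U \<Longrightarrow> y \<in> U \<Longrightarrow> x \<oplus> y \<in> U"
      "\<And>c x. x \<in> U \<Longrightarrow> c \<odot> x \<in> U"
    and f_add: "\<And>x y. x \<in> U \<Longrightarrow> y \<in> U \<Longrightarrow> f (x \<oplus> y) = f x + f y"
    and f_smult: "\<And>c x. x \<in> U \<Longrightarrow> f (c \<odot> x) = c * f x"
    and f_le: "\<And>x. x \<in> U \<Longrightarrow> cmod (f x) \<le> p x"
  obtains F where
    "\<And>x y. x \<in> carrier V \<Longrightarrow> y \<in> carrier V \<Longrightarrow> F (x \<oplus> y) = F x + F y"
    "\<And>c x. x \<in> carrier V \<Longrightarrow> F (c \<odot> x) = c * F x"
    "\<And>x. x \<in> carrier V \<Longrightarrow> cmod (F x) \<le> p x"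
    "\<And>x. x \<in> U \<Longrightarrow> F x = f x"
proof -
  interpret sublinear V p
    by unfold_locales (simp_all add: p_add p_smult)
  have p0: "p \<zero> = 0" using p_smult[of \<zero> 0] by simp
  define G where "G = (\<lambda>x. (x, Re (f x))) ` U"
  have "dominated_graph V p G"
    unfolding dominated_graph_def
  proof (intro conjI allI impI)
    have "f \<zero> = 0" using f_smult[OF U(2), of 0] by simp
    then show "(\<zero>, 0) \<in> G" using U(2) by (auto simp: G_def image_iff)
    show "r \<le> p x" if "(x, r) \<in> G" for x r
      using that f_le complex_Re_le_cmod order_trans by (fastforce simp: G_def)
  qed (use U f_add f_smult in \<open>auto simp: G_def\<close>)
  from dominated_graph_total[OF this] obtain G' where
    G': "dominated_graph V p G'" "G \<subseteq> G'" "fst ` G' = carrier V" .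
  have Ga: "\<And>x r y s. (x, r) \<in> G' \<Longrightarrow> (y, s) \<in> G' \<Longrightarrow> (x \<oplus> y, r + s) \<in> G'"
    and Gm: "\<And>c x r. (x, r) \<in> G' \<Longrightarrow> (complex_of_real c \<odot> x, c * r) \<in> G'"
    and Gp: "\<And>x r. (x, r) \<in> G' \<Longrightarrow> r \<le> p x" and Gc: "\<And>x r. (x, r) \<in> G' \<Longrightarrow> x \<in> carrier V"
    using G'(1,3) unfolding dominated_graph_def by (blast, blast, blast, force)
  \<comment> \<open>Two values r, s at x put (0, r - s) into the graph, and domination gives r - s
    <= p(0) = 0.\<close>
  have uniq: "r = s" if "(x, r) \<in> G'" "(x, s) \<in> G'" for x r s
  proof -
    have le: "r \<le> s" if rs: "(x, r) \<in> G'" "(x, s) \<in> G'" for r s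
    proof -
      have "(x \<oplus> complex_of_real (- 1) \<odot> x, r + (- 1) * s) \<in> G'"
        using Ga[OF rs(1) Gm[OF rs(2)]] .
      then have "r - s \<le> p (x \<oplus> complex_of_real (- 1) \<odot> x)" using Gp by fastforce
      also have "x \<oplus> complex_of_real (- 1) \<odot> x = \<zero>"
        using smult_l_distr'[of x 1 "-1"] Gc[OF rs(1)] by simp
      finally show ?thesis using p0 by simp
    qed
    show ?thesis using le that by (meson antisym)
  qed
  define u where "u x = (THE r. (x, r) \<in> G')" for x
  have u_eq: "u x = r" if "(x, r) \<in> G'" for x r
    unfolding u_def using that uniq by blast
  have uG: "(x, u x) \<in> G'" if "x \<in> carrier V" for x
    using that G'(3) u_eq by force
  have u_add: "u (x \<oplus> y) = u x + u y" if "x \<in> carrier V" "y \<in> carrier V" for x y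
    using u_eq[OF Ga[OF uG uG]] that by simp
  have u_smult: "u (complex_of_real c \<odot> x) = c * u x" if "x \<in> carrier V" for x c
    using u_eq[OF Gm[OF uG]] that by simp
  have u_f: "u x = Re (f x)" if "x \<in> U" for x
    using u_eq G'(2) that by (auto simp: G_def)
  \<comment> \<open>The only complex-linear choice with real part u: the imaginary part of F x is
    minus the real part of F(i x).\<close>
  define F where "F x = Complex (u x) (- u (\<i> \<odot> x))" for x
  have F_add: "F (x \<oplus> y) = F x + F y" if "x \<in> carrier V" "y \<in> carrier V" for x y
    using that by (simp add: F_def u_add smult_r_distr' complex_eq_iff)
  have F_smult: "F (c \<odot> x) = c * F x" if x: "x \<in> carrier V" for c x
  proof -
    have "u (c \<odot> x) = Re c * u x + Im c * u (\<i> \<odot> x)" for c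
    proof -
      have "c = complex_of_real (Re c) + complex_of_real (Im c) * \<i>"
        by (simp add: complex_eq_iff)
      then have "c \<odot> x = (complex_of_real (Re c) + complex_of_real (Im c) * \<i>) \<odot> x"
        by (rule arg_cong)
      also have "\<dots> = complex_of_real (Re c) \<odot> x \<oplus> complex_of_real (Im c) \<odot> (\<i> \<odot> x)"
        using x by (simp add: smult_l_distr' smult_assoc')
      finally show ?thesis using x by (simp add: u_add u_smult)
    qed
    from this[of c] this[of "\<i> * c"] show ?thesis
      using x by (simp add: F_def smult_assoc' complex_eq_iff)
  qed
  show thesis
  proof (rule that[of F])
    show "cmod (F x) \<le> p x" if x: "x \<in> carrier V" for x
    proof (cases "F x = 0")
      case True
      have "p \<zero> \<le> p x + p ((- 1) \<odot> x)"
        using p_add[of x "(- 1) \<odot> x"] smult_l_distr'[OF x, of 1 "-1"] x by simp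
      then show ?thesis using True p0 p_smult[OF x, of "-1"] by simp
    next
      case False
      \<comment> \<open>The conjugate phase of \<open>F x\<close>: it makes F(c x) real and equal to
        the modulus, so that the bound for u applies.\<close>
      define c where "c = cnj (F x) / cmod (F x)"
      have c: "cmod c = 1" "c * F x = cmod (F x)"
        using False by (simp_all add: c_def norm_divide complex_norm_square[symmetric] power2_eq_square flip: of_real_mult)
           (metis complex_norm_square mult.commute nonzero_mult_div_cancel_right norm_eq_zero of_real_eq_0_iff power2_eq_square of_real_mult)
      have "cmod (F x) = Re (F (c \<odot> x))"
        using F_smult[OF x] c(2) by simp
      also have "\<dots> = u (c \<odot> x)" by (simp add: F_def)
      also have "\<dots> \<le> p (c \<odot> x)" using Gp uG x by simp
      also have "\<dots> = p x" using p_smult[OF x] c(1) by simp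
      finally show ?thesis .
    qed
    show "F x = f x" if "x \<in> U" for x
      using that U(4)[OF that, of \<i>] by (simp add: F_def u_f f_smult complex_eq_iff)
  qed (fact F_add F_smult)+
qed

section \<open>Normed spaces on explicit carriers\<close>

sublocale complex_normed_space \<subseteq> complex_module Y ..

context complex_normed_space
begin

lemma nrm_zero [simp]: "nrm Y \<zero> = 0"
  using nrm_eq_0_iff by simp

lemma nrm_nonneg: "x \<in> carrier Y \<Longrightarrow> 0 \<le> nrm Y x"
proof -
  assume x: "x \<in> carrier Y"
  have "nrm Y (x \<oplus> (- 1) \<odot> x) \<le> nrm Y x + nrm Y ((- 1) \<odot> x)"
    using x by (intro nrm_triangle) auto
  also have "x \<oplus> (- 1) \<odot> x = \<zero>"
    using smult_l_distr'[OF x, of 1 "-1"] x by simp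
  finally show ?thesis using nrm_smult[OF x, of "-1"] by simp
qed

lemma Metric_space_nrm_dist: "Metric_space (carrier Y) (nrm_dist Y)"
proof
  have sym: "nrm Y (x \<ominus> y) = nrm Y (y \<ominus> x)" if "x \<in> carrier Y" "y \<in> carrier Y" for x y
  proof -
    have "y \<ominus> x = (- 1) \<odot> (x \<ominus> y)"
      using that by (simp add: diff_eq_smult smult_r_distr' smult_assoc' M.a_comm)
    then show ?thesis using nrm_smult[of "x \<ominus> y" "-1"] that by simp
  qed
  show "0 \<le> nrm_dist Y x y" for x y
    by (simp add: nrm_dist_def nrm_nonneg)
  show "nrm_dist Y x y = nrm_dist Y y x" for x y
    using sym by (simp add: nrm_dist_def)
  show "nrm_dist Y x y = 0 \<longleftrightarrow> x = y" if "x \<in> carrier Y" "y \<in> carrier Y" for x y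
  proof -
    have "x \<ominus> y = \<zero> \<longleftrightarrow> x = y"
    proof
      assume "x \<ominus> y = \<zero>"
      then have "\<ominus> y = \<ominus> x"
        using that by (intro M.minus_equality[symmetric]) (auto simp: a_minus_def M.a_comm)
      then show "x = y" using that by (metis M.minus_minus)
    qed (use that in \<open>simp add: a_minus_def M.r_neg\<close>)
    then show ?thesis using that by (simp add: nrm_dist_def nrm_eq_0_iff)
  qed
  show "nrm_dist Y x z \<le> nrm_dist Y x y + nrm_dist Y y z"
    if "x \<in> carrier Y" "y \<in> carrier Y" "z \<in> carrier Y" for x y z
  proof -
    have "(x \<ominus> y) \<oplus> (y \<ominus> z) = x \<oplus> ((\<ominus> y \<oplus> y) \<oplus> \<ominus> z)"
      using that by (simp only: a_minus_def M.a_assoc M.a_inv_closed M.a_closed)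
    also have "\<dots> = x \<ominus> z"
      using that by (simp add: M.l_neg a_minus_def)
    finally have "nrm Y (x \<ominus> z) \<le> nrm Y (x \<ominus> y) + nrm Y (y \<ominus> z)"
      using nrm_triangle[of "x \<ominus> y" "y \<ominus> z"] that by simp
    then show ?thesis using that by (simp add: nrm_dist_def)
  qed
qed

end

text \<open>Values must lie in \<open>Y\<close> everywhere, also off S, so that the pointwise
  operations form a module; a bound is asked for on S only. Functions differing off S remain
  distinct, hence quantities computed on S, such as \<open>upper_norm\<close>, are
  seminorms.\<close>

definition bounded_functions :: "'i set \<Rightarrow> 'a cnormed \<Rightarrow> ('i \<Rightarrow> 'a) cnormed" where
  "bounded_functions S Y =
     \<lparr>carrier = {F. (\<forall>i. F i \<in> carrier Y) \<and> (\<exists>B. \<forall>i\<in>S. nrm Y (F i) \<le> B)},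
      monoid.mult = undefined, one = undefined,
      zero = (\<lambda>i. \<zero>\<^bsub>Y\<^esub>), add = (\<lambda>F G i. F i \<oplus>\<^bsub>Y\<^esub> G i), module.smult = (\<lambda>c F i. c \<odot>\<^bsub>Y\<^esub> F i),
      nrm = (\<lambda>F. SUP i\<in>S. nrm Y (F i))\<rparr>"

lemma bounded_functions_simps [simp]:
  "F \<in> carrier (bounded_functions S Y) \<longleftrightarrow> (\<forall>i. F i \<in> carrier Y) \<and> (\<exists>B. \<forall>i\<in>S. nrm Y (F i) \<le> B)"
  "\<zero>\<^bsub>bounded_functions S Y\<^esub> = (\<lambda>i. \<zero>\<^bsub>Y\<^esub>)"
  "F \<oplus>\<^bsub>bounded_functions S Y\<^esub> G = (\<lambda>i. F i \<oplus>\<^bsub>Y\<^esub> G i)"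
  "c \<odot>\<^bsub>bounded_functions S Y\<^esub> F = (\<lambda>i. c \<odot>\<^bsub>Y\<^esub> F i)"
  by (simp_all add: bounded_functions_def)

lemma (in complex_normed_space) complex_module_bounded_functions:
  "complex_module (bounded_functions S Y)"
  unfolding complex_module_def
proof (rule Module.moduleI)
  show "cring complex_field" by (rule cring_complex_field)
  have smult: "c \<odot>\<^bsub>bounded_functions S Y\<^esub> F \<in> carrier (bounded_functions S Y)"
    if "F \<in> carrier (bounded_functions S Y)" for c F
  proof -
    obtain B where "\<And>i. F i \<in> carrier Y" "\<And>i. i \<in> S \<Longrightarrow> nrm Y (F i) \<le> B"
      using \<open>F \<in> _\<close> by auto
    then have "\<And>i. i \<in> S \<Longrightarrow> nrm Y (c \<odot> F i) \<le> cmod c * B"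
      by (simp add: nrm_smult mult_left_mono)
    then show ?thesis using \<open>\<And>i. F i \<in> carrier Y\<close> by auto
  qed
  then show "c \<odot>\<^bsub>bounded_functions S Y\<^esub> F \<in> carrier (bounded_functions S Y)"
    if "c \<in> carrier complex_field" "F \<in> carrier (bounded_functions S Y)" for c F
    using that by blast
  show "abelian_group (bounded_functions S Y)"
  proof (rule abelian_groupI)
    fix F G assume F: "F \<in> carrier (bounded_functions S Y)" and G: "G \<in> carrier (bounded_functions S Y)"
    obtain B where B: "\<And>i. F i \<in> carrier Y" "\<And>i. i \<in> S \<Longrightarrow> nrm Y (F i) \<le> B"
      using F by auto
    obtain B' where B': "\<And>i. G i \<in> carrier Y" "\<And>i. i \<in> S \<Longrightarrow> nrm Y (G i) \<le> B'"
      using G by auto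
    have "\<And>i. i \<in> S \<Longrightarrow> nrm Y (F i \<oplus> G i) \<le> B + B'"
      using B B' nrm_triangle add_mono order_trans by meson
    then show "F \<oplus>\<^bsub>bounded_functions S Y\<^esub> G \<in> carrier (bounded_functions S Y)"
      using B(1) B'(1) by auto
    show "F \<oplus>\<^bsub>bounded_functions S Y\<^esub> G = G \<oplus>\<^bsub>bounded_functions S Y\<^esub> F"
      using B(1) B'(1) by (simp add: M.a_comm)
  next
    fix F assume F: "F \<in> carrier (bounded_functions S Y)"
    have "(- 1) \<odot>\<^bsub>bounded_functions S Y\<^esub> F \<in> carrier (bounded_functions S Y)"
      by (rule smult[OF F])
    moreover have "(- 1) \<odot>\<^bsub>bounded_functions S Y\<^esub> F \<oplus>\<^bsub>bounded_functions S Y\<^esub> F = \<zero>\<^bsub>bounded_functions S Y\<^esub>"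
      using F by (auto simp: minus_eq_smult[symmetric] M.l_neg)
    ultimately show "\<exists>G\<in>carrier (bounded_functions S Y). G \<oplus>\<^bsub>bounded_functions S Y\<^esub> F = \<zero>\<^bsub>bounded_functions S Y\<^esub>"
      by blast
  qed (auto simp: M.a_assoc)
qed (auto simp: smult_l_distr' smult_r_distr' smult_assoc')

section \<open>The space of spherical polynomials\<close>

lemma sphere_polynomials_simps [simp]:
  "carrier (sphere_polynomials d) = (\<lambda>f. restrict f (sphere 0 1)) ` homogeneous_polynomials d"
  "f \<oplus>\<^bsub>sphere_polynomials d\<^esub> g = (\<lambda>x\<in>sphere 0 1. f x + g x)"
  "c \<odot>\<^bsub>sphere_polynomials d\<^esub> f = (\<lambda>x\<in>sphere 0 1. c * f x)"
  "nrm (sphere_polynomials d) f = (SUP x\<in>sphere 0 1. cmod (f x))"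
  by (simp_all add: sphere_polynomials_def)

lemma sphere_polynomials_closed:
  assumes "f \<in> carrier (sphere_polynomials d)" "g \<in> carrier (sphere_polynomials d)"
  shows "f \<oplus>\<^bsub>sphere_polynomials d\<^esub> g \<in> carrier (sphere_polynomials d)"
    and "c \<odot>\<^bsub>sphere_polynomials d\<^esub> f \<in> carrier (sphere_polynomials d)"
proof -
  obtain f' g' where f': "f = restrict f' (sphere 0 1)" "f' \<in> homogeneous_polynomials d"
    and g': "g = restrict g' (sphere 0 1)" "g' \<in> homogeneous_polynomials d"
    using assms by auto
  have "f \<oplus>\<^bsub>sphere_polynomials d\<^esub> g = restrict (\<lambda>x. f' x + g' x) (sphere 0 1)"
    by (auto simp: f' g' restrict_def)
  then show "f \<oplus>\<^bsub>sphere_polynomials d\<^esub> g \<in> carrier (sphere_polynomials d)"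
    using homogeneous_polynomials_add[OF f'(2) g'(2)] by auto
  have "c \<odot>\<^bsub>sphere_polynomials d\<^esub> f = restrict (\<lambda>x. c * f' x) (sphere 0 1)"
    by (auto simp: f' restrict_def)
  then show "c \<odot>\<^bsub>sphere_polynomials d\<^esub> f \<in> carrier (sphere_polynomials d)"
    using homogeneous_polynomials_scale[OF f'(2)] by auto
qed

lemma continuous_on_sphere_polynomials:
  assumes "f \<in> carrier (sphere_polynomials d)"
  shows "continuous_on (sphere 0 1) f"
proof -
  obtain f' where f': "f = restrict f' (sphere 0 1)" "f' \<in> homogeneous_polynomials d"
    using assms by auto
  have "continuous_on (sphere 0 1) f'" by (rule continuous_on_homogeneous_polynomial[OF f'(2)])
  then show ?thesis by (rule continuous_on_eq) (simp add: f'(1))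
qed

lemma cmod_le_nrm_sphere_polynomials:
  assumes "f \<in> carrier (sphere_polynomials d)" "x \<in> sphere 0 1"
  shows "cmod (f x) \<le> nrm (sphere_polynomials d) f"
proof -
  have "compact ((\<lambda>x. cmod (f x)) ` sphere 0 1)"
    by (intro compact_continuous_image continuous_intros continuous_on_sphere_polynomials[OF assms(1)]) auto
  then have "bdd_above ((\<lambda>x. cmod (f x)) ` sphere 0 1)"
    by (intro bounded_imp_bdd_above compact_imp_bounded)
  then show ?thesis
    unfolding sphere_polynomials_simps by (intro cSUP_upper assms(2))
qed

lemma sphere_nonempty: "sphere (0 :: real ^ 'n) 1 \<noteq> {}"
  using radial_projection_in_sphere by blast

lemma nrm_sphere_polynomials_le:
  fixes f :: "real ^ 'n \<Rightarrow> complex"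
  assumes "\<And>x. x \<in> sphere 0 1 \<Longrightarrow> cmod (f x) \<le> B"
  shows "nrm (sphere_polynomials d) f \<le> B"
  unfolding sphere_polynomials_simps by (intro cSUP_least sphere_nonempty assms)

lemma zonal_kernel_reproducing:
  fixes x :: "real ^ 'n"
  assumes q: "zonal_kernel TYPE('n) d q" and f: "f \<in> carrier (sphere_polynomials d)"
    and x: "x \<in> sphere 0 1"
  shows "(\<ointegral>z. complex_of_real (poly q (x \<bullet> z)) * f z) = f x"
proof -
  obtain f' where f': "f = restrict f' (sphere 0 1)" "f' \<in> homogeneous_polynomials d"
    using f by auto
  have "(\<ointegral>z. complex_of_real (poly q (x \<bullet> z)) * f z)
      = (\<ointegral>z. complex_of_real (poly q (z \<bullet> x)) * f' z)"
    by (rule Bochner_Integration.integral_cong) (auto simp: f'(1) inner_commute)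
  also have "\<dots> = f' x"
    using q f'(2) x by (simp add: zonal_kernel_def)
  finally show ?thesis using x f'(1) by simp
qed

section \<open>The upper bound\<close>

text \<open>An upper integral of \<open>\<parallel>F\<parallel>\<close>; the functions \<open>F\<close> obtained from a bounded operator need not be
  measurable.\<close>

definition upper_norm :: "'b cnormed \<Rightarrow> ('a::euclidean_space \<Rightarrow> 'b) \<Rightarrow> real" where
  "upper_norm Y F =
     (INF h\<in>{h. continuous_on (sphere 0 1) h \<and> (\<forall>z\<in>sphere 0 1. nrm Y (F z) \<le> h z)}. sphere_mean h)"

context complex_normed_space
begin

lemma upper_norm_le:
  fixes F :: "'b::euclidean_space \<Rightarrow> 'a"
  assumes "\<And>z. F z \<in> carrier Y" "continuous_on (sphere 0 1) h" "\<And>z. z \<in> sphere 0 1 \<Longrightarrow> nrm Y (F z) \<le> h z"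
  shows "upper_norm Y F \<le> sphere_mean h"
  unfolding upper_norm_def
proof (rule cINF_lower)
  \<comment> \<open>The infimum is over reals and needs a lower bound: majorants are nonnegative on
    the sphere.\<close>
  show "bdd_below (sphere_mean ` {h. continuous_on (sphere 0 1) h \<and> (\<forall>z\<in>sphere 0 1. nrm Y (F z) \<le> h z)})"
  proof (rule bdd_belowI2[where m = 0])
    fix h assume h: "h \<in> {h. continuous_on (sphere 0 1) h \<and> (\<forall>z\<in>sphere 0 1. nrm Y (F z) \<le> h z)}"
    show "0 \<le> sphere_mean h"
    proof (rule Bochner_Integration.integral_nonneg)
      fix z :: 'b assume "z \<in> space sphere_measure"
      then have "nrm Y (F z) \<le> h z" using h by auto
      with nrm_nonneg[OF assms(1)[of z]] show "0 \<le> h z" by linarith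
    qed
  qed
qed (use assms in auto)

text \<open>Boundedness of F provides a constant majorant, without which the infimum would be over
  the empty set.\<close>

lemma upper_norm_greatest:
  fixes F :: "'b::euclidean_space \<Rightarrow> 'a"
  assumes F: "F \<in> carrier (bounded_functions (sphere 0 1) Y)"
    and le: "\<And>h. continuous_on (sphere 0 1) h \<Longrightarrow> (\<And>z. z \<in> sphere 0 1 \<Longrightarrow> nrm Y (F z) \<le> h z) \<Longrightarrow> b \<le> sphere_mean h"
  shows "b \<le> upper_norm Y F"
  unfolding upper_norm_def
proof (rule cINF_greatest)
  obtain B where "\<forall>z\<in>sphere 0 1. nrm Y (F z) \<le> B" using F by auto
  then have "(\<lambda>_. B) \<in> {h. continuous_on (sphere 0 1) h \<and> (\<forall>z\<in>sphere 0 1. nrm Y (F z) \<le> h z)}"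
    by simp
  then show "{h. continuous_on (sphere 0 1) h \<and> (\<forall>z\<in>sphere 0 1. nrm Y (F z) \<le> h z)} \<noteq> {}" by blast
qed (use le in auto)

lemma upper_norm_add:
  fixes F G :: "'b::euclidean_space \<Rightarrow> 'a"
  assumes F: "F \<in> carrier (bounded_functions (sphere 0 1) Y)" and G: "G \<in> carrier (bounded_functions (sphere 0 1) Y)"
  shows "upper_norm Y (\<lambda>z. F z \<oplus> G z) \<le> upper_norm Y F + upper_norm Y G"
proof -
  have Fc: "F z \<in> carrier Y" and Gc: "G z \<in> carrier Y" for z using F G by auto
  have "upper_norm Y (\<lambda>z. F z \<oplus> G z) - upper_norm Y F \<le> upper_norm Y G"
  proof (rule upper_norm_greatest[OF G])
    fix k assume k: "continuous_on (sphere 0 1) k" "\<And>z. z \<in> sphere 0 1 \<Longrightarrow> nrm Y (G z) \<le> k z"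
    have "upper_norm Y (\<lambda>z. F z \<oplus> G z) - sphere_mean k \<le> upper_norm Y F"
    proof (rule upper_norm_greatest[OF F])
      fix h assume h: "continuous_on (sphere 0 1) h" "\<And>z. z \<in> sphere 0 1 \<Longrightarrow> nrm Y (F z) \<le> h z"
      have "upper_norm Y (\<lambda>z. F z \<oplus> G z) \<le> (\<ointegral>z. h z + k z)"
      proof (rule upper_norm_le)
        show "nrm Y (F z \<oplus> G z) \<le> h z + k z" if "z \<in> sphere 0 1" for z
          using nrm_triangle[OF Fc Gc, of z z] h(2)[OF that] k(2)[OF that] by linarith
      qed (use h k Fc Gc in \<open>auto intro!: continuous_intros\<close>)
      also have "\<dots> = sphere_mean h + sphere_mean k"
        using h k by (intro Bochner_Integration.integral_add integrable_sphere_measure)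
      finally show "upper_norm Y (\<lambda>z. F z \<oplus> G z) - sphere_mean k \<le> sphere_mean h"
        by simp
    qed
    then show "upper_norm Y (\<lambda>z. F z \<oplus> G z) - upper_norm Y F \<le> sphere_mean k"
      by simp
  qed
  then show ?thesis by simp
qed

lemma upper_norm_nonneg:
  fixes F :: "'b::euclidean_space \<Rightarrow> 'a"
  assumes F: "F \<in> carrier (bounded_functions (sphere 0 1) Y)"
  shows "0 \<le> upper_norm Y F"
proof (rule upper_norm_greatest[OF F])
  fix h assume h: "\<And>z. z \<in> sphere (0::'b) 1 \<Longrightarrow> nrm Y (F z) \<le> h z"
  have nn: "0 \<le> nrm Y (F z)" for z using F by (intro nrm_nonneg) auto
  show "0 \<le> sphere_mean h"
  proof (rule Bochner_Integration.integral_nonneg)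
    fix z :: 'b assume "z \<in> space sphere_measure"
    then have "nrm Y (F z) \<le> h z" using h by simp
    with nn[of z] show "0 \<le> h z" by linarith
  qed
qed

text \<open>Scaling majorants gives one inequality for c not 0; the reverse is the same inequality
  for 1 / c. For c = 0 the zero function is a majorant.\<close>

lemma upper_norm_smult:
  fixes F :: "'b::euclidean_space \<Rightarrow> 'a"
  assumes F: "F \<in> carrier (bounded_functions (sphere 0 1) Y)"
  shows "upper_norm Y (\<lambda>z. c \<odot> F z) = cmod c * upper_norm Y F"
proof -
  interpret V: complex_module "bounded_functions (sphere (0::'b) 1) Y"
    by (rule complex_module_bounded_functions)
  have le: "upper_norm Y (\<lambda>z. c \<odot> G z) \<le> cmod c * upper_norm Y G"
    if G: "G \<in> carrier (bounded_functions (sphere 0 1) Y)" and c: "c \<noteq> 0" for c and G :: "'b \<Rightarrow> 'a"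
  proof -
    have "upper_norm Y (\<lambda>z. c \<odot> G z) / cmod c \<le> upper_norm Y G"
    proof (rule upper_norm_greatest[OF G])
      fix h assume h: "continuous_on (sphere 0 1) h" "\<And>z. z \<in> sphere 0 1 \<Longrightarrow> nrm Y (G z) \<le> h z"
      have "upper_norm Y (\<lambda>z. c \<odot> G z) \<le> (\<ointegral>z. cmod c * h z)"
        using G h by (intro upper_norm_le) (auto simp: nrm_smult mult_left_mono intro!: continuous_intros)
      then show "upper_norm Y (\<lambda>z. c \<odot> G z) / cmod c \<le> sphere_mean h"
        using c by (simp add: field_simps)
    qed
    then show ?thesis using c by (simp add: field_simps)
  qed
  show ?thesis
  proof (cases "c = 0")
    case True
    have "upper_norm Y (\<lambda>z. c \<odot> F z) \<le> (\<integral>z. 0 \<partial>(sphere_measure :: 'b measure))"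
      using F True by (intro upper_norm_le) auto
    moreover have "0 \<le> upper_norm Y (\<lambda>z. c \<odot> F z)"
      using upper_norm_nonneg[OF V.smult_closed'[OF F]] by simp
    ultimately show ?thesis using True by simp
  next
    case False
    have "upper_norm Y (\<lambda>z. (1 / c) \<odot> (c \<odot> F z)) \<le> cmod (1 / c) * upper_norm Y (\<lambda>z. c \<odot> F z)"
      using le[OF V.smult_closed'[OF F], of "1 / c" c] False by simp
    also have "(\<lambda>z. (1 / c) \<odot> (c \<odot> F z)) = F"
      using F False by (auto simp: smult_assoc')
    finally have "cmod c * upper_norm Y F \<le> upper_norm Y (\<lambda>z. c \<odot> F z)"
      using False by (simp add: norm_divide field_simps)
    then show ?thesis using le[OF F False] by simp
  qed
qed

end

section \<open>The projection built from the kernel\<close>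

lemma isometric_embedding_inj:
  fixes J :: "(real ^ 'n \<Rightarrow> complex) \<Rightarrow> 'b"
  assumes "complex_normed_space Y" and J: "isometric_embedding (sphere_polynomials d) Y J"
  shows "inj_on J (carrier (sphere_polynomials d))"
proof (rule inj_onI)
  interpret complex_normed_space Y by (rule assms(1))
  let ?X = "sphere_polynomials d :: (real ^ 'n \<Rightarrow> complex) cnormed"
  fix f g assume f: "f \<in> carrier ?X" and g: "g \<in> carrier ?X" and eq: "J f = J g"
  have Jf: "J f \<in> carrier Y"
    using J f unfolding isometric_embedding_def linear_between_def by blast
  define h where "h = f \<oplus>\<^bsub>?X\<^esub> (- 1) \<odot>\<^bsub>?X\<^esub> g"
  have g': "(- 1) \<odot>\<^bsub>?X\<^esub> g \<in> carrier ?X" and h: "h \<in> carrier ?X"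
    unfolding h_def using sphere_polynomials_closed(2)[OF g g] sphere_polynomials_closed(1)[OF f] by blast+
  have "J h = J f \<oplus>\<^bsub>Y\<^esub> (- 1) \<odot>\<^bsub>Y\<^esub> J g"
    using J f g g' unfolding isometric_embedding_def linear_between_def h_def by metis
  also have "\<dots> = \<zero>\<^bsub>Y\<^esub>"
    using smult_l_distr'[OF Jf, of 1 "-1"] Jf by (simp add: eq)
  finally have "nrm ?X h = 0"
    using J h unfolding isometric_embedding_def by (metis nrm_zero)
  then have "h x = 0" if "x \<in> sphere 0 1" for x
    using cmod_le_nrm_sphere_polynomials[OF h that] by simp
  then have "f x = g x" if "x \<in> sphere 0 1" for x
    using that by (simp add: h_def)
  then show "f = g" using f g by (auto simp: fun_eq_iff restrict_def)
qed

text \<open>\<open>R y\<close> at x plays the part of the integral over z of q(x . z) times an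
  extension to \<open>Y\<close> of evaluation at z. \<open>\<Phi>\<close> gives this a meaning:
  domination yields the norm, agreement with \<open>\<phi>\<close> on \<open>U\<close> yields the
  projection property, and the finite rank of the kernel yields polynomial values.\<close>

lemma projection_onto_sphere_polynomials:
  fixes q :: "real poly" and J :: "(real ^ 'n \<Rightarrow> complex) \<Rightarrow> 'b"
  assumes "complex_normed_space Y"
    and q: "zonal_kernel TYPE('n) d q"
    and K: "\<And>x :: real ^ 'n. norm x = 1 \<Longrightarrow> (\<ointegral>z. \<bar>poly q (z \<bullet> x)\<bar>) = K"
    and J: "isometric_embedding (sphere_polynomials d) Y J"
  shows "relative_projection_constant Y (J ` carrier (sphere_polynomials d)) \<le> ereal K"
proof -
  interpret complex_normed_space Y by (rule assms(1))
  let ?X = "sphere_polynomials d :: (real ^ 'n \<Rightarrow> complex) cnormed"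
  let ?S = "sphere (0 :: real ^ 'n) 1"
  let ?V = "bounded_functions ?S Y"
  interpret V: complex_module ?V by (rule complex_module_bounded_functions)
  have J_closed: "J f \<in> carrier Y" and J_nrm: "nrm Y (J f) = nrm ?X f"
    and J_smult: "J (c \<odot>\<^bsub>?X\<^esub> f) = c \<odot>\<^bsub>Y\<^esub> J f" if "f \<in> carrier ?X" for f c
    using J that unfolding isometric_embedding_def linear_between_def by blast+
  have J_add: "J (f \<oplus>\<^bsub>?X\<^esub> g) = J f \<oplus>\<^bsub>Y\<^esub> J g" if "f \<in> carrier ?X" "g \<in> carrier ?X" for f g
    using J that unfolding isometric_embedding_def linear_between_def by blast
  define Ji where "Ji = inv_into (carrier ?X) J"
  have Ji_J: "Ji (J f) = f" if "f \<in> carrier ?X" for f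
    unfolding Ji_def using isometric_embedding_inj[OF assms(1) J] that by (rule inv_into_f_f)
  \<comment> \<open>The functions for which the diagonal value of J^(-1) F(z) at z makes sense and
    is continuous in z, hence integrable.\<close>
  define U where "U = {F \<in> carrier ?V. (\<forall>z. F z \<in> J ` carrier ?X) \<and> continuous_on ?S (\<lambda>z. Ji (F z) z)}"
  define \<phi> where "\<phi> F = (\<ointegral>z. Ji (F z) z)" for F
  have zero_X: "(\<lambda>x\<in>?S. 0) \<in> carrier ?X"
    using homogeneous_polynomials_zero by auto
  have J_zero: "J (\<lambda>x\<in>?S. 0) = \<zero>\<^bsub>Y\<^esub>"
  proof -
    have "(\<lambda>x\<in>?S. 0) = 0 \<odot>\<^bsub>?X\<^esub> (\<lambda>x\<in>?S. 0)" by (auto simp: restrict_def)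
    then have "J (\<lambda>x\<in>?S. 0) = 0 \<odot>\<^bsub>Y\<^esub> J (\<lambda>x\<in>?S. 0)" using J_smult[OF zero_X, of 0] by metis
    then show ?thesis using J_closed[OF zero_X] by simp
  qed
  have Ji_add: "Ji (a \<oplus>\<^bsub>Y\<^esub> b) z = Ji a z + Ji b z"
    if "a \<in> J ` carrier ?X" "b \<in> J ` carrier ?X" "z \<in> ?S" for a b z
  proof -
    obtain f g where fg: "a = J f" "f \<in> carrier ?X" "b = J g" "g \<in> carrier ?X"
      using \<open>a \<in> _\<close> \<open>b \<in> _\<close> by blast
    have "Ji (a \<oplus>\<^bsub>Y\<^esub> b) = f \<oplus>\<^bsub>?X\<^esub> g"
      using fg Ji_J[OF sphere_polynomials_closed(1)[OF fg(2,4)]] J_add[OF fg(2,4)] by simp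
    then show ?thesis using fg that(3) by (simp add: Ji_J del: sphere_polynomials_simps(1))
  qed
  have Ji_smult: "Ji (c \<odot>\<^bsub>Y\<^esub> a) z = c * Ji a z"
    if "a \<in> J ` carrier ?X" "z \<in> ?S" for a c z
  proof -
    obtain f where f: "a = J f" "f \<in> carrier ?X"
      using \<open>a \<in> _\<close> by blast
    have "Ji (c \<odot>\<^bsub>Y\<^esub> a) = c \<odot>\<^bsub>?X\<^esub> f"
      using f Ji_J[OF sphere_polynomials_closed(2)[OF f(2,2)], of c] J_smult[OF f(2), of c] by simp
    then show ?thesis using f that(2) by (simp add: Ji_J del: sphere_polynomials_simps(1))
  qed
  have JX_add: "a \<oplus>\<^bsub>Y\<^esub> b \<in> J ` carrier ?X" if "a \<in> J ` carrier ?X" "b \<in> J ` carrier ?X" for a b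
    using that J_add sphere_polynomials_closed(1) by (metis (no_types, lifting) image_iff)
  have JX_smult: "c \<odot>\<^bsub>Y\<^esub> a \<in> J ` carrier ?X" if "a \<in> J ` carrier ?X" for a c
    using that J_smult sphere_polynomials_closed(2) by (metis (no_types, lifting) image_iff)
  obtain \<Phi> where
    \<Phi>_add: "\<And>F G. F \<in> carrier ?V \<Longrightarrow> G \<in> carrier ?V \<Longrightarrow> \<Phi> (F \<oplus>\<^bsub>?V\<^esub> G) = \<Phi> F + \<Phi> G" and
    \<Phi>_smult: "\<And>c F. F \<in> carrier ?V \<Longrightarrow> \<Phi> (c \<odot>\<^bsub>?V\<^esub> F) = c * \<Phi> F" and
    \<Phi>_le: "\<And>F. F \<in> carrier ?V \<Longrightarrow> cmod (\<Phi> F) \<le> upper_norm Y F" and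
    \<Phi>_\<phi>: "\<And>F. F \<in> U \<Longrightarrow> \<Phi> F = \<phi> F"
  proof (rule V.hahn_banach[of "upper_norm Y" U \<phi>])
    show "upper_norm Y (F \<oplus>\<^bsub>?V\<^esub> G) \<le> upper_norm Y F + upper_norm Y G"
      if "F \<in> carrier ?V" "G \<in> carrier ?V" for F G
      using upper_norm_add[OF that] by simp
    show "upper_norm Y (c \<odot>\<^bsub>?V\<^esub> F) = cmod c * upper_norm Y F" if "F \<in> carrier ?V" for c F
      using upper_norm_smult[OF that] by simp
    show "U \<subseteq> carrier ?V" unfolding U_def by blast
    have "continuous_on ?S (\<lambda>z. Ji \<zero>\<^bsub>Y\<^esub> z)"
      using continuous_on_sphere_polynomials[OF zero_X] Ji_J[OF zero_X] J_zero by simp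
    moreover have "\<zero>\<^bsub>Y\<^esub> \<in> J ` carrier ?X" using zero_X J_zero by (metis imageI)
    ultimately show "\<zero>\<^bsub>?V\<^esub> \<in> U" unfolding U_def using V.M.zero_closed by simp
    show "F \<oplus>\<^bsub>?V\<^esub> G \<in> U" if "F \<in> U" "G \<in> U" for F G
    proof -
      have "continuous_on ?S (\<lambda>z. Ji (F z) z + Ji (G z) z)"
        using that by (intro continuous_intros) (auto simp: U_def)
      then have "continuous_on ?S (\<lambda>z. Ji (F z \<oplus>\<^bsub>Y\<^esub> G z) z)"
        by (rule continuous_on_eq) (use that in \<open>simp add: U_def Ji_add del: sphere_polynomials_simps(1)\<close>)
      then show ?thesis
        using that JX_add V.M.a_closed[of F G] unfolding U_def by (simp del: sphere_polynomials_simps(1))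
    qed
    show "c \<odot>\<^bsub>?V\<^esub> F \<in> U" if "F \<in> U" for c F
    proof -
      have "continuous_on ?S (\<lambda>z. c * Ji (F z) z)"
        using that by (intro continuous_intros) (auto simp: U_def)
      then have "continuous_on ?S (\<lambda>z. Ji (c \<odot>\<^bsub>Y\<^esub> F z) z)"
        by (rule continuous_on_eq) (use that in \<open>simp add: U_def Ji_smult del: sphere_polynomials_simps(1)\<close>)
      then show ?thesis
        using that JX_smult V.smult_closed'[of F c] unfolding U_def by (simp del: sphere_polynomials_simps(1))
    qed
    show "\<phi> (F \<oplus>\<^bsub>?V\<^esub> G) = \<phi> F + \<phi> G" if "F \<in> U" "G \<in> U" for F G
    proof -
      have "\<phi> (F \<oplus>\<^bsub>?V\<^esub> G) = (\<ointegral>z. Ji (F z) z + Ji (G z) z)"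
        unfolding \<phi>_def using that
        by (intro Bochner_Integration.integral_cong) (auto simp: U_def Ji_add simp del: sphere_polynomials_simps(1))
      also have "\<dots> = \<phi> F + \<phi> G"
        unfolding \<phi>_def using that
        by (intro Bochner_Integration.integral_add integrable_sphere_measure) (auto simp: U_def)
      finally show ?thesis .
    qed
    show "\<phi> (c \<odot>\<^bsub>?V\<^esub> F) = c * \<phi> F" if "F \<in> U" for c F
    proof -
      have "\<phi> (c \<odot>\<^bsub>?V\<^esub> F) = (\<ointegral>z. c * Ji (F z) z)"
        unfolding \<phi>_def using that
        by (intro Bochner_Integration.integral_cong) (auto simp: U_def Ji_smult simp del: sphere_polynomials_simps(1))
      then show ?thesis by (simp add: \<phi>_def)
    qed
    \<comment> \<open>Evaluation at z has norm at most 1 on the polynomials and J is isometric, so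
      every continuous majorant of the norm of F(z) also majorizes the integrand of
      \<open>\<phi>\<close>.\<close>
    show "cmod (\<phi> F) \<le> upper_norm Y F" if F: "F \<in> U" for F
    proof (rule upper_norm_greatest)
      show "F \<in> carrier ?V" using F by (simp add: U_def)
      fix h assume h: "continuous_on ?S h" "\<And>z. z \<in> ?S \<Longrightarrow> nrm Y (F z) \<le> h z"
      have cont: "continuous_on ?S (\<lambda>z. Ji (F z) z)" using F by (simp add: U_def)
      have "cmod (\<phi> F) \<le> (\<ointegral>z. cmod (Ji (F z) z))"
        unfolding \<phi>_def by (rule integral_norm_bound)
      also have "\<dots> \<le> sphere_mean h"
      proof (rule integral_mono)
        fix z :: "real ^ 'n" assume "z \<in> space sphere_measure"
        then have z: "z \<in> ?S" by simp
        have "F z \<in> J ` carrier ?X" using F by (simp add: U_def)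
        then obtain f where f: "F z = J f" "f \<in> carrier ?X" by blast
        then show "cmod (Ji (F z) z) \<le> h z"
          using cmod_le_nrm_sphere_polynomials[OF f(2) z] h(2)[OF z] J_nrm[OF f(2)] Ji_J[OF f(2)] by simp
      qed (use cont h in \<open>auto intro!: integrable_sphere_measure continuous_intros\<close>)
      finally show "cmod (\<phi> F) \<le> sphere_mean h" .
    qed
  qed (rule that)
  define T where "T h y = (\<lambda>z. h z \<odot>\<^bsub>Y\<^esub> y)" for h :: "real ^ 'n \<Rightarrow> complex" and y
  have T_closed: "T h y \<in> carrier ?V" if h: "continuous_on ?S h" and y: "y \<in> carrier Y" for h y
  proof -
    have "compact (h ` ?S)" using h by (intro compact_continuous_image) auto
    then obtain B where B: "\<And>z. z \<in> ?S \<Longrightarrow> cmod (h z) \<le> B"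
      using compact_imp_bounded bounded_iff by (metis imageI)
    then have "\<forall>z\<in>?S. nrm Y (h z \<odot>\<^bsub>Y\<^esub> y) \<le> B * nrm Y y"
      using y nrm_nonneg by (simp add: nrm_smult mult_right_mono)
    then show ?thesis using y by (auto simp: T_def)
  qed
  define k where "k x z = complex_of_real (poly q (x \<bullet> z))" for x z :: "real ^ 'n"
  have k_cont: "continuous_on ?S (k x)" for x
    unfolding k_def[abs_def] by (intro continuous_intros)
  obtain xs where xs: "\<forall>(g, h)\<in>set xs. g \<in> homogeneous_polynomials d \<and> continuous_on ?S h"
    "\<And>x z. x \<in> ?S \<Longrightarrow> k x z = (\<Sum>(g, h)\<leftarrow>xs. g x * h z)"
    using finite_rank_zonal_kernel[OF q] unfolding finite_rank_def k_def by blast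
  define R where "R y = (\<lambda>x\<in>?S. \<Phi> (T (k x) y))" for y
  \<comment> \<open>By linearity \<open>\<Phi>\<close> passes through the finite sum for the kernel,
    so \<open>R y\<close> is a combination of the left factors g with coefficients
    \<open>\<Phi> (T h y)\<close>.\<close>
  have R_closed: "R y \<in> carrier ?X" if y: "y \<in> carrier Y" for y
  proof -
    have "(\<forall>(g, h)\<in>set xs. g \<in> homogeneous_polynomials d \<and> continuous_on ?S h) \<Longrightarrow>
      continuous_on ?S (\<lambda>z. \<Sum>(g, h)\<leftarrow>xs. g x * h z) \<and>
      \<Phi> (T (\<lambda>z. \<Sum>(g, h)\<leftarrow>xs. g x * h z) y) = (\<Sum>(g, h)\<leftarrow>xs. \<Phi> (T h y) * g x)" for x
    proof (induction xs)
      case Nil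
      have "\<Phi> (0 \<odot>\<^bsub>?V\<^esub> T (\<lambda>_. 0) y) = 0"
        using \<Phi>_smult[OF T_closed[OF _ y], of "\<lambda>_. 0" 0] by simp
      then show ?case using y by (simp add: T_def)
    next
      case (Cons gh xs)
      obtain g h where gh: "gh = (g, h)" by (cases gh)
      let ?r = "\<lambda>z. \<Sum>(g, h)\<leftarrow>xs. g x * h z"
      have h: "continuous_on ?S h" and r: "continuous_on ?S ?r"
        and IH: "\<Phi> (T ?r y) = (\<Sum>(g, h)\<leftarrow>xs. \<Phi> (T h y) * g x)"
        using Cons gh by auto
      have "T (\<lambda>z. g x * h z + ?r z) y = (g x \<odot>\<^bsub>?V\<^esub> T h y) \<oplus>\<^bsub>?V\<^esub> T ?r y"
        using y by (auto simp: T_def smult_l_distr' smult_assoc')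
      then have "\<Phi> (T (\<lambda>z. g x * h z + ?r z) y) = g x * \<Phi> (T h y) + \<Phi> (T ?r y)"
        using \<Phi>_add[OF V.smult_closed'[OF T_closed[OF h y]] T_closed[OF r y]] \<Phi>_smult[OF T_closed[OF h y]]
        by simp
      moreover have "continuous_on ?S (\<lambda>z. g x * h z + ?r z)"
        using h r by (intro continuous_intros)
      ultimately show ?case by (simp add: gh IH mult.commute)
    qed
    then have "\<Phi> (T (k x) y) = (\<Sum>(g, h)\<leftarrow>xs. \<Phi> (T h y) * g x)" if "x \<in> ?S" for x
      using xs(1) xs(2)[OF that] by (metis (no_types, lifting) ext)
    then have "R y = restrict (\<lambda>x. \<Sum>(g, h)\<leftarrow>xs. \<Phi> (T h y) * g x) ?S"
      by (auto simp: R_def restrict_def)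
    moreover have "(\<lambda>x. \<Sum>(g, h)\<leftarrow>xs. \<Phi> (T h y) * g x) \<in> homogeneous_polynomials d"
      using xs(1)
      by (induction xs) (auto intro: homogeneous_polynomials_zero homogeneous_polynomials_add homogeneous_polynomials_scale)
    ultimately show ?thesis by simp
  qed
  have R_add: "R (y \<oplus>\<^bsub>Y\<^esub> y') = R y \<oplus>\<^bsub>?X\<^esub> R y'" if y: "y \<in> carrier Y" "y' \<in> carrier Y" for y y'
  proof -
    have "T (k x) (y \<oplus>\<^bsub>Y\<^esub> y') = T (k x) y \<oplus>\<^bsub>?V\<^esub> T (k x) y'" for x
      using y by (auto simp: T_def smult_r_distr')
    then show ?thesis
      using \<Phi>_add[OF T_closed[OF k_cont y(1)] T_closed[OF k_cont y(2)]]
      by (auto simp: R_def restrict_def)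
  qed
  have R_smult: "R (c \<odot>\<^bsub>Y\<^esub> y) = c \<odot>\<^bsub>?X\<^esub> R y" if y: "y \<in> carrier Y" for y c
  proof -
    have "T (k x) (c \<odot>\<^bsub>Y\<^esub> y) = c \<odot>\<^bsub>?V\<^esub> T (k x) y" for x
      using y by (auto simp: T_def smult_assoc' mult.commute)
    then show ?thesis
      using \<Phi>_smult[OF T_closed[OF k_cont y]]
      by (auto simp: R_def restrict_def)
  qed
  \<comment> \<open>The function |q(z . x)| times the norm of y is itself a continuous majorant, and
    its mean is K times that norm, for every x.\<close>
  have R_nrm: "nrm ?X (R y) \<le> K * nrm Y y" if y: "y \<in> carrier Y" for y
  proof (rule nrm_sphere_polynomials_le)
    fix x :: "real ^ 'n" assume x: "x \<in> ?S"
    have "cmod (R y x) \<le> upper_norm Y (T (k x) y)"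
      using \<Phi>_le[OF T_closed[OF k_cont y]] x by (simp add: R_def)
    also have "\<dots> \<le> (\<ointegral>z. \<bar>poly q (z \<bullet> x)\<bar> * nrm Y y)"
      using y by (intro upper_norm_le)
        (auto simp: T_def k_def nrm_smult inner_commute intro!: continuous_intros)
    also have "\<dots> = K * nrm Y y" using K[of x] x by simp
    finally show "cmod (R y x) \<le> K * nrm Y y" .
  qed
  have R_J: "R (J f) = f" if f: "f \<in> carrier ?X" for f
  proof -
    have "R (J f) x = f x" if x: "x \<in> ?S" for x
    proof -
      have Ji_T: "Ji (T (k x) (J f) z) z = k x z * f z" if "z \<in> ?S" for z
        using Ji_smult[OF imageI[OF f] that] Ji_J[OF f] by (simp add: T_def)
      have "continuous_on ?S (\<lambda>z. k x z * f z)"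
        by (intro continuous_intros k_cont continuous_on_sphere_polynomials[OF f])
      then have "continuous_on ?S (\<lambda>z. Ji (T (k x) (J f) z) z)"
        by (rule continuous_on_eq) (simp add: Ji_T)
      then have "T (k x) (J f) \<in> U"
        using T_closed[OF k_cont J_closed[OF f]] JX_smult[OF imageI[OF f]]
        unfolding U_def by (simp add: T_def del: sphere_polynomials_simps(1) bounded_functions_simps(1))
      then have "R (J f) x = (\<ointegral>z. Ji (T (k x) (J f) z) z)"
        using \<Phi>_\<phi> x by (simp add: R_def \<phi>_def)
      also have "\<dots> = (\<ointegral>z. k x z * f z)"
        by (intro Bochner_Integration.integral_cong) (simp_all add: Ji_T)
      also have "\<dots> = f x"
        unfolding k_def by (rule zonal_kernel_reproducing[OF q f x])
      finally show ?thesis .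
    qed
    moreover have "R (J f) x = f x" if "x \<notin> ?S" for x
      using f that by (auto simp: R_def)
    ultimately show ?thesis by blast
  qed
  define P where "P y = J (R y)" for y
  have K0: "0 \<le> K"
  proof -
    obtain x where "x \<in> ?S" using sphere_nonempty by blast
    then have "K = (\<ointegral>z. \<bar>poly q (z \<bullet> x)\<bar>)" using K[of x] by simp
    then show ?thesis by simp
  qed
  have P_nrm: "nrm Y (P y) \<le> K * nrm Y y" if "y \<in> carrier Y" for y
    using R_nrm[OF that] J_nrm[OF R_closed[OF that]] by (simp add: P_def del: sphere_polynomials_simps)
  have "bounded_linear_between Y (Y\<lparr>carrier := J ` carrier ?X\<rparr>) P"
    unfolding bounded_linear_between_def linear_between_def
    using P_nrm R_closed J_add J_smult R_add R_smult
    by (auto simp: P_def simp del: sphere_polynomials_simps)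
  moreover have "\<forall>a\<in>J ` carrier ?X. P a = a"
    using R_J by (auto simp: P_def simp del: sphere_polynomials_simps)
  ultimately have "relative_projection_constant Y (J ` carrier ?X) \<le> ereal (op_norm Y (Y\<lparr>carrier := J ` carrier ?X\<rparr>) P)"
    unfolding relative_projection_constant_def by (intro INF_lower) simp
  also have "op_norm Y (Y\<lparr>carrier := J ` carrier ?X\<rparr>) P \<le> K"
    unfolding op_norm_def
  proof (rule cSUP_least)
    have "\<zero>\<^bsub>Y\<^esub> \<in> {y \<in> carrier Y. nrm Y y \<le> 1}" by simp
    then show "{y \<in> carrier Y. nrm Y y \<le> 1} \<noteq> {}" by blast
    fix y assume y: "y \<in> {y \<in> carrier Y. nrm Y y \<le> 1}"
    then have "nrm Y (P y) \<le> K * nrm Y y" using P_nrm by simp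
    also have "\<dots> \<le> K * 1" using y K0 by (intro mult_left_mono) auto
    finally show "nrm (Y\<lparr>carrier := J ` carrier ?X\<rparr>) (P y) \<le> K" by simp
  qed
  finally show ?thesis by simp
qed

section \<open>The lower bound\<close>

text \<open>The ambient space may be any Banach space containing all polynomials on the sphere; bounded
  functions are chosen since their completeness is immediate. Its elements are tagged with \<open>Inr\<close>
  only to inhabit the sum type.\<close>

definition sphere_functions :: "('u + (real ^ 'n \<Rightarrow> complex)) cnormed" where
  "sphere_functions =
     \<lparr>carrier = Inr ` {f. f \<in> extensional (sphere 0 1) \<and> bounded (f ` sphere 0 1)},
      monoid.mult = undefined, one = undefined,
      zero = Inr (\<lambda>x\<in>sphere 0 1. 0),
      add = (\<lambda>a b. Inr (\<lambda>x\<in>sphere 0 1. projr a x + projr b x)),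
      module.smult = (\<lambda>c a. Inr (\<lambda>x\<in>sphere 0 1. c * projr a x)),
      nrm = (\<lambda>a. SUP x\<in>sphere 0 1. cmod (projr a x))\<rparr>"

lemma sphere_functions_simps [simp]:
  "\<zero>\<^bsub>sphere_functions\<^esub> = Inr (\<lambda>x\<in>sphere 0 1. 0)"
  "a \<oplus>\<^bsub>sphere_functions\<^esub> b = Inr (\<lambda>x\<in>sphere 0 1. projr a x + projr b x)"
  "c \<odot>\<^bsub>sphere_functions\<^esub> a = Inr (\<lambda>x\<in>sphere 0 1. c * projr a x)"
  "nrm sphere_functions a = (SUP x\<in>sphere 0 1. cmod (projr a x))"
  by (simp_all add: sphere_functions_def)

lemma carrier_sphere_functions:
  "carrier sphere_functions = Inr ` {f. f \<in> extensional (sphere 0 1) \<and> bounded (f ` sphere 0 1)}"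
  by (simp add: sphere_functions_def)

lemma sphere_functionsE:
  assumes "a \<in> carrier sphere_functions"
  obtains f B where "a = Inr f" "f \<in> extensional (sphere 0 1)" "\<And>x. x \<in> sphere 0 1 \<Longrightarrow> cmod (f x) \<le> B"
proof -
  obtain f where f: "a = Inr f" "f \<in> extensional (sphere 0 1)" "bounded (f ` sphere 0 1)"
    using assms unfolding carrier_sphere_functions by blast
  then obtain B where "\<forall>y\<in>f ` sphere 0 1. cmod y \<le> B" unfolding bounded_iff by blast
  with f that show thesis by blast
qed

lemma sphere_functionsI:
  assumes "\<And>x. x \<in> sphere 0 1 \<Longrightarrow> cmod (f x) \<le> B"
  shows "Inr (restrict f (sphere 0 1)) \<in> carrier sphere_functions"
proof -
  have "bounded (restrict f (sphere 0 1) ` sphere 0 1)"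
    unfolding bounded_iff using assms by (intro exI[of _ B]) auto
  then show ?thesis
    unfolding carrier_sphere_functions by blast
qed

lemma cmod_le_nrm_sphere_functions:
  assumes "a \<in> carrier sphere_functions" "x \<in> sphere 0 1"
  shows "cmod (projr a x) \<le> nrm sphere_functions a"
proof -
  obtain f B where fB: "a = Inr f" "\<And>x. x \<in> sphere 0 1 \<Longrightarrow> cmod (f x) \<le> B"
    using assms(1) by (rule sphere_functionsE) blast
  have "bdd_above ((\<lambda>x. cmod (projr a x)) ` sphere 0 1)"
    using fB by (intro bdd_aboveI2[where M = B]) auto
  then show ?thesis
    unfolding sphere_functions_simps by (intro cSUP_upper assms(2))
qed

lemma nrm_sphere_functions_le:
  assumes "\<And>x. x \<in> sphere 0 1 \<Longrightarrow> cmod (projr a x) \<le> B"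
  shows "nrm sphere_functions a \<le> B"
  unfolding sphere_functions_simps by (intro cSUP_least sphere_nonempty assms)

lemma complex_normed_space_sphere_functions:
  "complex_normed_space (sphere_functions :: ('u + (real ^ 'n \<Rightarrow> complex)) cnormed)"
proof -
  let ?Y = "sphere_functions :: ('u + (real ^ 'n \<Rightarrow> complex)) cnormed"
  let ?S = "sphere (0 :: real ^ 'n) 1"
  have smult: "c \<odot>\<^bsub>?Y\<^esub> a \<in> carrier ?Y" if a: "a \<in> carrier ?Y" for c a
  proof -
    obtain f B where f: "a = Inr f" "\<And>x. x \<in> ?S \<Longrightarrow> cmod (f x) \<le> B"
      using a by (rule sphere_functionsE) blast
    then have "\<And>x. x \<in> ?S \<Longrightarrow> cmod (c * f x) \<le> cmod c * B"
      by (simp add: norm_mult mult_left_mono)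
    then show ?thesis unfolding f(1) sphere_functions_simps sum.sel by (rule sphere_functionsI)
  qed
  have add: "a \<oplus>\<^bsub>?Y\<^esub> b \<in> carrier ?Y" if a: "a \<in> carrier ?Y" and b: "b \<in> carrier ?Y" for a b
  proof -
    obtain f B where f: "a = Inr f" "\<And>x. x \<in> ?S \<Longrightarrow> cmod (f x) \<le> B"
      using a by (rule sphere_functionsE) blast
    obtain g B' where g: "b = Inr g" "\<And>x. x \<in> ?S \<Longrightarrow> cmod (g x) \<le> B'"
      using b by (rule sphere_functionsE) blast
    have "\<And>x. x \<in> ?S \<Longrightarrow> cmod (f x + g x) \<le> B + B'"
      using f(2) g(2) by (intro norm_triangle_mono)
    then show ?thesis unfolding f(1) g(1) sphere_functions_simps sum.sel by (rule sphere_functionsI)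
  qed
  have zero: "\<zero>\<^bsub>?Y\<^esub> \<in> carrier ?Y"
    unfolding sphere_functions_simps by (rule sphere_functionsI[of _ 0]) simp
  have ext: "a = Inr (\<lambda>x\<in>?S. projr a x)" if "a \<in> carrier ?Y" for a
    using that by (rule sphere_functionsE) (simp add: extensional_restrict)
  have "Module.module complex_field ?Y"
  proof (rule Module.moduleI)
    show "cring complex_field" by (rule cring_complex_field)
    show "abelian_group ?Y"
    proof (rule abelian_groupI)
      show "\<zero>\<^bsub>?Y\<^esub> \<oplus>\<^bsub>?Y\<^esub> a = a" if "a \<in> carrier ?Y" for a
        by (subst (2) ext[OF that]) (simp cong: restrict_cong)
      show "\<exists>b\<in>carrier ?Y. b \<oplus>\<^bsub>?Y\<^esub> a = \<zero>\<^bsub>?Y\<^esub>" if "a \<in> carrier ?Y" for a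
        by (rule bexI[OF _ smult[OF that, of "-1"]]) (simp cong: restrict_cong)
    qed (use add zero in \<open>simp_all add: add_ac cong: restrict_cong\<close>)
    show "\<one>\<^bsub>complex_field\<^esub> \<odot>\<^bsub>?Y\<^esub> a = a" if "a \<in> carrier ?Y" for a
      by (subst (2) ext[OF that]) simp
  qed (use smult in \<open>simp_all add: algebra_simps cong: restrict_cong\<close>)
  then interpret Module.module complex_field ?Y .
  show ?thesis
  proof
    fix a assume a: "a \<in> carrier ?Y"
    obtain f where f: "a = Inr f" "f \<in> extensional ?S" using a by (rule sphere_functionsE) blast
    show "nrm ?Y a = 0 \<longleftrightarrow> a = \<zero>\<^bsub>?Y\<^esub>"
    proof
      assume "nrm ?Y a = 0"
      then have "f x = 0" if "x \<in> ?S" for x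
        using cmod_le_nrm_sphere_functions[OF a that] f by simp
      then show "a = \<zero>\<^bsub>?Y\<^esub>" using f by (auto simp: extensional_def restrict_def)
    next
      assume "a = \<zero>\<^bsub>?Y\<^esub>"
      then show "nrm ?Y a = 0" using sphere_nonempty by simp
    qed
    show "nrm ?Y (a \<oplus>\<^bsub>?Y\<^esub> b) \<le> nrm ?Y a + nrm ?Y b" if b: "b \<in> carrier ?Y" for b
    proof (rule nrm_sphere_functions_le)
      fix x assume x: "x \<in> ?S"
      have "cmod (projr a x + projr b x) \<le> nrm ?Y a + nrm ?Y b"
        by (intro norm_triangle_mono cmod_le_nrm_sphere_functions a b x)
      then show "cmod (projr (a \<oplus>\<^bsub>?Y\<^esub> b) x) \<le> nrm ?Y a + nrm ?Y b" using x by simp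
    qed
    \<comment> \<open>One inequality suffices: for c not 0 the reverse follows by applying it to 1 /
      c.\<close>
    have le: "nrm ?Y (c \<odot>\<^bsub>?Y\<^esub> b) \<le> cmod c * nrm ?Y b" if b: "b \<in> carrier ?Y" for c b
    proof (rule nrm_sphere_functions_le)
      fix x assume x: "x \<in> ?S"
      have "cmod c * cmod (projr b x) \<le> cmod c * nrm ?Y b"
        by (intro mult_left_mono cmod_le_nrm_sphere_functions b x) simp
      then show "cmod (projr (c \<odot>\<^bsub>?Y\<^esub> b) x) \<le> cmod c * nrm ?Y b" using x by (simp add: norm_mult)
    qed
    show "nrm ?Y (c \<odot>\<^bsub>?Y\<^esub> a) = cmod c * nrm ?Y a" for c
    proof (cases "c = 0")
      case True
      then show ?thesis using sphere_nonempty by simp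
    next
      case False
      have "(1 / c) \<odot>\<^bsub>?Y\<^esub> (c \<odot>\<^bsub>?Y\<^esub> a) = a"
        using False by (subst (2) ext[OF a]) (simp cong: restrict_cong)
      then have "nrm ?Y a \<le> cmod (1 / c) * nrm ?Y (c \<odot>\<^bsub>?Y\<^esub> a)"
        using le[OF smult[OF a, of c], of "1 / c"] by metis
      then have "cmod c * nrm ?Y a \<le> nrm ?Y (c \<odot>\<^bsub>?Y\<^esub> a)"
        using False by (simp add: norm_divide field_simps del: sphere_functions_simps)
      then show ?thesis using le[OF a, of c] by linarith
    qed
  qed
qed

lemma complex_banach_space_sphere_functions:
  "complex_banach_space (sphere_functions :: ('u + (real ^ 'n \<Rightarrow> complex)) cnormed)"
proof -
  let ?Y = "sphere_functions :: ('u + (real ^ 'n \<Rightarrow> complex)) cnormed"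
  let ?S = "sphere (0 :: real ^ 'n) 1"
  interpret complex_normed_space ?Y by (rule complex_normed_space_sphere_functions)
  interpret M: Metric_space "carrier ?Y" "nrm_dist ?Y" by (rule Metric_space_nrm_dist)
  have dist_eq: "nrm_dist ?Y a b = nrm ?Y (a \<oplus>\<^bsub>?Y\<^esub> (- 1) \<odot>\<^bsub>?Y\<^esub> b)" if "a \<in> carrier ?Y" "b \<in> carrier ?Y" for a b
    using that unfolding nrm_dist_def by (simp only: diff_eq_smult if_True simp_thms)
  have dist_ge: "cmod (projr a x - projr b x) \<le> nrm_dist ?Y a b"
    if ab: "a \<in> carrier ?Y" "b \<in> carrier ?Y" and x: "x \<in> ?S" for a b x
    using cmod_le_nrm_sphere_functions[OF M.a_closed[OF ab(1) smult_closed'[OF ab(2), of "-1"]] x] x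
    unfolding dist_eq[OF ab] by simp
  have dist_le: "nrm_dist ?Y a b \<le> B"
    if ab: "a \<in> carrier ?Y" "b \<in> carrier ?Y" and B: "\<And>x. x \<in> ?S \<Longrightarrow> cmod (projr a x - projr b x) \<le> B" for a b B
    unfolding dist_eq[OF ab] using B by (intro nrm_sphere_functions_le) simp
  have "\<exists>a. limitin M.mtopology \<sigma> a sequentially" if \<sigma>: "M.MCauchy \<sigma>" for \<sigma>
  proof -
    have \<sigma>c: "\<sigma> n \<in> carrier ?Y" for n using \<sigma> unfolding M.MCauchy_def by blast
    define s where "s n = projr (\<sigma> n)" for n
    have unif: "\<exists>N. \<forall>m\<ge>N. \<forall>n\<ge>N. \<forall>x\<in>?S. cmod (s m x - s n x) < e" if "e > 0" for e
    proof -
      obtain N where "\<And>m n. N \<le> m \<Longrightarrow> N \<le> n \<Longrightarrow> nrm_dist ?Y (\<sigma> m) (\<sigma> n) < e"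
        using \<sigma> \<open>e > 0\<close> unfolding M.MCauchy_def by blast
      then show ?thesis
        unfolding s_def using dist_ge[OF \<sigma>c \<sigma>c] le_less_trans by (intro exI[of _ N]) blast
    qed
    define f where "f x = lim (\<lambda>n. s n x)" for x
    have lim: "(\<lambda>n. s n x) \<longlonglongrightarrow> f x" if "x \<in> ?S" for x
    proof -
      have "Cauchy (\<lambda>n. s n x)"
        unfolding Cauchy_def dist_norm using unif that by meson
      then show ?thesis unfolding f_def by (simp add: Cauchy_convergent_iff convergent_LIMSEQ_iff)
    qed
    have unif_lim: "\<exists>N. \<forall>m\<ge>N. \<forall>x\<in>?S. cmod (s m x - f x) \<le> e" if e: "e > 0" for e
    proof -
      obtain N where N: "\<And>m n x. m \<ge> N \<Longrightarrow> n \<ge> N \<Longrightarrow> x \<in> ?S \<Longrightarrow> cmod (s m x - s n x) < e"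
        using unif[OF e] by blast
      have "cmod (s m x - f x) \<le> e" if m: "m \<ge> N" and x: "x \<in> ?S" for m x
      proof (rule LIMSEQ_le_const2)
        show "(\<lambda>n. cmod (s m x - s n x)) \<longlonglongrightarrow> cmod (s m x - f x)"
          by (intro tendsto_intros lim x)
        show "\<exists>M. \<forall>n\<ge>M. cmod (s m x - s n x) \<le> e"
          using N[OF m _ x] less_imp_le by blast
      qed
      then show ?thesis by blast
    qed
    obtain N where N: "\<And>x. x \<in> ?S \<Longrightarrow> cmod (s N x - f x) \<le> 1"
      using unif_lim[of 1] by (meson order_refl zero_less_one)
    obtain B where B: "\<And>x. x \<in> ?S \<Longrightarrow> cmod (s N x) \<le> B"
      using cmod_le_nrm_sphere_functions[OF \<sigma>c[of N]] unfolding s_def by blast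
    have "cmod (f x) \<le> B + 1" if "x \<in> ?S" for x
      using N[OF that] B[OF that] norm_triangle_ineq3[of "s N x" "f x"] by linarith
    then have fc: "Inr (restrict f ?S) \<in> carrier ?Y"
      by (rule sphere_functionsI)
    have "limitin M.mtopology \<sigma> (Inr (restrict f ?S)) sequentially"
      unfolding M.limitin_metric eventually_sequentially
    proof (intro conjI allI impI fc)
      fix e :: real assume e: "e > 0"
      obtain N where N: "\<And>m x. m \<ge> N \<Longrightarrow> x \<in> ?S \<Longrightarrow> cmod (s m x - f x) \<le> e / 2"
        using unif_lim[OF half_gt_zero[OF e]] by blast
      have "nrm_dist ?Y (\<sigma> m) (Inr (restrict f ?S)) < e" if "m \<ge> N" for m
      proof -
        have "nrm_dist ?Y (\<sigma> m) (Inr (restrict f ?S)) \<le> e / 2"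
          using N[OF that] by (intro dist_le \<sigma>c fc) (simp add: s_def)
        then show ?thesis using e by simp
      qed
      then show "\<exists>N. \<forall>m\<ge>N. \<sigma> m \<in> carrier ?Y \<and> nrm_dist ?Y (\<sigma> m) (Inr (restrict f ?S)) < e"
        using \<sigma>c by blast
    qed
    then show ?thesis by blast
  qed
  then have "M.mcomplete" unfolding M.mcomplete_def by blast
  then show ?thesis
    by unfold_locales
qed

lemma isometric_embedding_Inr:
  "isometric_embedding (sphere_polynomials d)
     (sphere_functions :: ('u + (real ^ 'n \<Rightarrow> complex)) cnormed) Inr"
proof -
  have "Inr f \<in> carrier (sphere_functions :: ('u + (real ^ 'n \<Rightarrow> complex)) cnormed)"
    if f: "f \<in> carrier (sphere_polynomials d)" for f
  proof -
    have e: "f = restrict f (sphere 0 1)" using f by auto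
    show ?thesis
      by (subst e) (rule sphere_functionsI[OF cmod_le_nrm_sphere_polynomials[OF f]])
  qed
  then show ?thesis
    unfolding isometric_embedding_def linear_between_def
    by (auto simp del: sphere_polynomials_simps(1))
qed

section \<open>The trace of a projection\<close>

text \<open>In either order the iterated integral is the sum of the products of the means of the
  factors, by linearity alone.\<close>

lemma finite_rank_Fubini:
  assumes "finite_rank {g. continuous_on (sphere 0 1) g} L"
  shows "(\<ointegral>x. \<ointegral>z. L x z) = (\<ointegral>z. \<ointegral>x. L x z)"
    and "continuous_on (sphere 0 1) (\<lambda>x. \<ointegral>z. L x z)"
proof -
  let ?S = "sphere 0 1"
  obtain xs where xs: "\<forall>(g, h)\<in>set xs. continuous_on ?S g \<and> continuous_on ?S h"
    "\<And>x z. x \<in> ?S \<Longrightarrow> L x z = (\<Sum>(g, h)\<leftarrow>xs. g x * h z)"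
    using assms unfolding finite_rank_def by auto
  have "continuous_on ?S (\<lambda>x. \<Sum>(g, h)\<leftarrow>xs. g x * c h) \<and>
      integrable sphere_measure (\<lambda>x. \<Sum>(g, h)\<leftarrow>xs. g x * c h) \<and>
      (\<ointegral>x. (\<Sum>(g, h)\<leftarrow>xs. g x * c h)) = (\<Sum>(g, h)\<leftarrow>xs. sphere_mean g * c h)" for c
    using xs(1)
  proof (induction xs)
    case (Cons gh xs)
    then have "continuous_on ?S (\<lambda>x. fst gh x * c (snd gh))"
      by (auto intro!: continuous_intros)
    with Cons show ?case
      by (auto simp: case_prod_unfold integrable_sphere_measure intro!: continuous_intros)
  qed simp
  note first = this
  have "integrable sphere_measure (\<lambda>z. \<Sum>(g, h)\<leftarrow>xs. c g * h z) \<and>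
      (\<ointegral>z. (\<Sum>(g, h)\<leftarrow>xs. c g * h z)) = (\<Sum>(g, h)\<leftarrow>xs. c g * sphere_mean h)" for c
    using xs(1)
  proof (induction xs)
    case (Cons gh xs)
    then have "integrable sphere_measure (\<lambda>z. c (fst gh) * snd gh z)"
      by (intro integrable_sphere_measure) (auto intro!: continuous_intros)
    with Cons show ?case by (auto simp: case_prod_unfold)
  qed simp
  note second = this
  have inner: "(\<ointegral>z. L x z) = (\<Sum>(g, h)\<leftarrow>xs. g x * sphere_mean h)" if "x \<in> ?S" for x
    using second[of "\<lambda>g. g x"] xs(2)[OF that] by simp
  have "(\<ointegral>x. \<ointegral>z. L x z)
      = (\<ointegral>x. (\<Sum>(g, h)\<leftarrow>xs. g x * sphere_mean h))"
    by (rule Bochner_Integration.integral_cong[OF refl]) (rule inner, simp)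
  then have "(\<ointegral>x. \<ointegral>z. L x z)
      = (\<Sum>(g, h)\<leftarrow>xs. sphere_mean g * sphere_mean h)"
    using first[of "sphere_mean"] by simp
  moreover have "(\<ointegral>x. L x z) = (\<Sum>(g, h)\<leftarrow>xs. sphere_mean g * h z)" for z
  proof -
    have "(\<ointegral>x. L x z) = (\<ointegral>x. (\<Sum>(g, h)\<leftarrow>xs. g x * h z))"
      by (rule Bochner_Integration.integral_cong[OF refl]) (rule xs(2), simp)
    then show ?thesis using first[of "\<lambda>h. h z"] by simp
  qed
  then have "(\<ointegral>z. \<ointegral>x. L x z)
      = (\<Sum>(g, h)\<leftarrow>xs. sphere_mean g * sphere_mean h)"
    using second[of "sphere_mean"] by simp
  ultimately show "(\<ointegral>x. \<ointegral>z. L x z) = (\<ointegral>z. \<ointegral>x. L x z)"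
    by simp
  show "continuous_on ?S (\<lambda>x. \<ointegral>z. L x z)"
    using first[of "sphere_mean"] inner by (auto intro: continuous_on_eq)
qed

text \<open>The kernel L(x, z) = q(x . z) p(s x)(z) is integrated in both orders. Over z first, the
  reproducing property gives p(s x)(x), of modulus at most N. Over x first, it gives p applied to
  the convolution of \<open>\<phi>\<close> with the kernel at z; this is a spherical polynomial,
  hence fixed by p, and its value at z is the left-hand side whatever z is.\<close>

lemma projection_trace:
  fixes q \<phi> :: "real poly" and p :: "(real ^ 'n \<Rightarrow> complex) \<Rightarrow> real ^ 'n \<Rightarrow> complex" and e :: "real ^ 'n"
  assumes n: "CARD('n) > 2" and q: "zonal_kernel TYPE('n) d q" and e: "norm e = 1"
    and p_closed: "\<And>f. continuous_on (sphere 0 1) f \<Longrightarrow> p f \<in> carrier (sphere_polynomials d)"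
    and p_cong: "\<And>f g. (\<And>x. x \<in> sphere 0 1 \<Longrightarrow> f x = g x) \<Longrightarrow> p f = p g"
    and p_add: "\<And>f g x. continuous_on (sphere 0 1) f \<Longrightarrow> continuous_on (sphere 0 1) g \<Longrightarrow> x \<in> sphere 0 1 \<Longrightarrow>
        p (\<lambda>y. f y + g y) x = p f x + p g x"
    and p_smult: "\<And>c f x. continuous_on (sphere 0 1) f \<Longrightarrow> x \<in> sphere 0 1 \<Longrightarrow> p (\<lambda>y. c * f y) x = c * p f x"
    and p_id: "\<And>f x. f \<in> homogeneous_polynomials d \<Longrightarrow> x \<in> sphere 0 1 \<Longrightarrow> p f x = f x"
    and p_le: "\<And>f x. continuous_on (sphere 0 1) f \<Longrightarrow> (\<And>y. y \<in> sphere 0 1 \<Longrightarrow> cmod (f y) \<le> 1) \<Longrightarrow>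
        x \<in> sphere 0 1 \<Longrightarrow> cmod (p f x) \<le> N"
    and \<phi>: "\<And>t. t \<in> {-1..1} \<Longrightarrow> \<bar>poly \<phi> t\<bar> \<le> 1"
  shows "(\<ointegral>x. poly q (x \<bullet> e) * poly \<phi> (x \<bullet> e)) \<le> N"
proof -
  let ?S = "sphere (0 :: real ^ 'n) 1"
  define M where "M = (\<ointegral>x. poly q (x \<bullet> e) * poly \<phi> (x \<bullet> e))"
  define s where "s x y = complex_of_real (poly \<phi> (x \<bullet> y))" for x y :: "real ^ 'n"
  define k where "k x z = complex_of_real (poly q (x \<bullet> z))" for x z :: "real ^ 'n"
  have s_cont: "continuous_on ?S (s x)" and k_cont: "continuous_on ?S (k x)" and k_cont': "continuous_on ?S (\<lambda>x. k x z)" for x z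
    unfolding s_def[abs_def] k_def[abs_def] by (intro continuous_intros)+
  \<comment> \<open>Expanding the test functions s x into products lets p pass through the integral
    over x by finite linearity.\<close>
  obtain ys where ys: "\<forall>(u, v)\<in>set ys. continuous_on ?S u \<and> continuous_on ?S v"
    "\<And>x y. x \<in> ?S \<Longrightarrow> s x y = (\<Sum>(u, v)\<leftarrow>ys. u x * v y)"
    using finite_rank_poly[of \<phi>, where 'n = 'n] unfolding finite_rank_def s_def by auto
  have p_list: "continuous_on ?S (\<lambda>y. \<Sum>(u, v)\<leftarrow>ys. c u * v y) \<and>
      p (\<lambda>y. \<Sum>(u, v)\<leftarrow>ys. c u * v y) z = (\<Sum>(u, v)\<leftarrow>ys. c u * p v z)" if z: "z \<in> ?S" for c z
    using ys(1)
  proof (induction ys)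
    case Nil
    show ?case using p_smult[of "\<lambda>_. 0" z 0] z by simp
  next
    case (Cons uv ys)
    obtain u v where uv: "uv = (u, v)" by (cases uv)
    have v: "continuous_on ?S v" and IH: "continuous_on ?S (\<lambda>y. \<Sum>(u, v)\<leftarrow>ys. c u * v y)"
      "p (\<lambda>y. \<Sum>(u, v)\<leftarrow>ys. c u * v y) z = (\<Sum>(u, v)\<leftarrow>ys. c u * p v z)"
      using Cons uv by auto
    have cv: "continuous_on ?S (\<lambda>y. c u * v y)" using v by (intro continuous_intros)
    show ?case
      using p_add[OF cv IH(1) z] p_smult[OF v z, of "c u"] IH cv continuous_on_add[OF cv IH(1)] by (simp add: uv)
  qed
  have p_s: "p (s x) z = (\<Sum>(u, v)\<leftarrow>ys. u x * p v z)" if "x \<in> ?S" "z \<in> ?S" for x z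
    using p_list[OF that(2), of "\<lambda>u. u x"] ys(2)[OF that(1)] by (metis (no_types, lifting) p_cong)
  define L where "L x z = k x z * (\<Sum>(u, v)\<leftarrow>ys. u x * p v z)" for x z
  have L: "finite_rank {g. continuous_on ?S g} L"
    unfolding L_def[abs_def] using ys(1)
  proof (induction ys)
    case Nil
    show ?case using finite_rank_zero by simp
  next
    case (Cons uv ys)
    obtain u v where uv: "uv = (u, v)" by (cases uv)
    have uc: "continuous_on ?S u" and vc: "continuous_on ?S v" using Cons uv by auto
    have "finite_rank {g. continuous_on ?S g} (\<lambda>x z. u x * p v z * k x z)"
      unfolding k_def
      by (rule finite_rank_mult[OF finite_rank_poly])
         (use uc continuous_on_sphere_polynomials[OF p_closed[OF vc]] in \<open>auto intro!: continuous_on_mult\<close>)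
    moreover have "finite_rank {g. continuous_on ?S g} (\<lambda>x z. k x z * (\<Sum>(u, v)\<leftarrow>ys. u x * p v z))"
      using Cons by simp
    ultimately show ?case
      by (rule finite_rank_cong[OF finite_rank_add]) (simp add: uv algebra_simps)
  qed

  have L_eq: "L x z = k x z * p (s x) z" if "x \<in> ?S" "z \<in> ?S" for x z
    unfolding L_def p_s[OF that] ..
  have diag: "(\<ointegral>z. L x z) = p (s x) x" if x: "x \<in> ?S" for x
  proof -
    have "(\<ointegral>z. L x z) = (\<ointegral>z. k x z * p (s x) z)"
      by (intro Bochner_Integration.integral_cong) (use L_eq[OF x] in auto)
    also have "\<dots> = p (s x) x"
      unfolding k_def by (rule zonal_kernel_reproducing[OF q p_closed[OF s_cont] x])
    finally show ?thesis .
  qed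
  \<comment> \<open>A zonal integral depends on the function of the inner product only, so the pole
    e may be replaced by z.\<close>
  have zonal_const: "(\<ointegral>x. poly q (x \<bullet> z) * poly \<phi> (x \<bullet> z)) = M" if "z \<in> ?S" for z
    using integral_sphere_zonal[OF n, of z "\<lambda>t. poly q t * poly \<phi> t"] that
      integral_sphere_zonal[OF n e, of "\<lambda>t. poly q t * poly \<phi> t"]
    by (simp add: M_def continuous_intros)
  have col: "(\<ointegral>x. L x z) = complex_of_real M" if z: "z \<in> ?S" for z
  proof -
    define c where "c u = (\<ointegral>x. k x z * u x)" for u
    have swap: "integrable sphere_measure (\<lambda>x. k x z * (\<Sum>(u, v)\<leftarrow>ys. u x * a v)) \<and>
        (\<ointegral>x. k x z * (\<Sum>(u, v)\<leftarrow>ys. u x * a v)) = (\<Sum>(u, v)\<leftarrow>ys. c u * a v)" for a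
      using ys(1)
    proof (induction ys)
      case (Cons uv ys)
      obtain u v where uv: "uv = (u, v)" by (cases uv)
      have u: "continuous_on ?S u" using Cons uv by auto
      have i1: "integrable sphere_measure (\<lambda>x. k x z * u x * a v)"
        using u k_cont' by (intro integrable_sphere_measure continuous_on_mult continuous_on_const)
      have i2: "integrable sphere_measure (\<lambda>x. k x z * (\<Sum>(u, v)\<leftarrow>ys. u x * a v))"
        and IH: "(\<ointegral>x. k x z * (\<Sum>(u, v)\<leftarrow>ys. u x * a v)) = (\<Sum>(u, v)\<leftarrow>ys. c u * a v)"
        using Cons by auto
      have "(\<lambda>x. k x z * (\<Sum>(u, v)\<leftarrow>uv # ys. u x * a v)) = (\<lambda>x. k x z * u x * a v + k x z * (\<Sum>(u, v)\<leftarrow>ys. u x * a v))"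
        by (auto simp: uv algebra_simps)
      then show ?case using i1 i2 IH by (simp add: c_def uv)
    qed simp
    have "(\<ointegral>x. L x z) = (\<Sum>(u, v)\<leftarrow>ys. c u * p v z)"
      unfolding L_def using swap[of "\<lambda>v. p v z"] by blast
    also have "\<dots> = p (\<lambda>y. \<Sum>(u, v)\<leftarrow>ys. c u * v y) z"
      using p_list[OF z, of c] by simp
    also have "\<dots> = complex_of_real M"
    proof -
      \<comment> \<open>The x-integral of q(x . z) s x, as a function of y, is a spherical
        polynomial f. This is where p disappears.\<close>
      obtain f where f: "f \<in> homogeneous_polynomials d"
        "\<And>y. norm y = 1 \<Longrightarrow> complex_of_real (\<ointegral>x. poly \<phi> (x \<bullet> y) * poly q (x \<bullet> z)) = f y"
        using zonal_convolution_homogeneous[OF n _ q, of z \<phi>] z by auto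
      have G: "(\<Sum>(u, v)\<leftarrow>ys. c u * v y) = f y" if y: "y \<in> ?S" for y
      proof -
        have "(\<Sum>(u, v)\<leftarrow>ys. c u * v y) = (\<ointegral>x. k x z * (\<Sum>(u, v)\<leftarrow>ys. u x * v y))"
          using swap[of "\<lambda>v. v y"] by simp
        also have "\<dots> = (\<ointegral>x. complex_of_real (poly \<phi> (x \<bullet> y) * poly q (x \<bullet> z)))"
        proof (rule Bochner_Integration.integral_cong[OF refl])
          fix x :: "real ^ 'n" assume "x \<in> space sphere_measure"
          then have "s x y = (\<Sum>(u, v)\<leftarrow>ys. u x * v y)" using ys(2) by simp
          then show "k x z * (\<Sum>(u, v)\<leftarrow>ys. u x * v y) = complex_of_real (poly \<phi> (x \<bullet> y) * poly q (x \<bullet> z))"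
            by (simp add: k_def s_def)
        qed
        also have "\<dots> = f y" using f(2)[of y] y by (simp del: of_real_mult)
        finally show ?thesis .
      qed
      have "p (\<lambda>y. \<Sum>(u, v)\<leftarrow>ys. c u * v y) z = p f z"
        using p_cong[of "\<lambda>y. \<Sum>(u, v)\<leftarrow>ys. c u * v y" f] G by simp
      also have "\<dots> = f z" by (rule p_id[OF f(1) z])
      also have "\<dots> = complex_of_real M"
        using f(2)[of z] zonal_const[OF z] z by (simp add: mult.commute)
      finally show ?thesis .
    qed
    finally show ?thesis .
  qed
  have "complex_of_real M = (\<ointegral>z. \<ointegral>x. L x z)"
  proof -
    have "(\<ointegral>z. \<ointegral>x. L x z) = (\<integral>z. complex_of_real M \<partial>(sphere_measure :: (real ^ 'n) measure))"
      by (intro Bochner_Integration.integral_cong) (use col in auto)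
    then show ?thesis by simp
  qed
  also have "\<dots> = (\<ointegral>x. \<ointegral>z. L x z)"
    by (rule finite_rank_Fubini(1)[OF L, symmetric])
  also have "cmod \<dots> \<le> N"
  proof (rule integral_sphere_measure_bound[OF finite_rank_Fubini(2)[OF L]])
    fix x :: "real ^ 'n" assume x: "x \<in> ?S"
    have "cmod (s x y) \<le> 1" if "y \<in> ?S" for y
    proof -
      have "x \<bullet> y \<in> {-1..1}" using Cauchy_Schwarz_ineq2[of x y] x that by (auto simp: abs_le_iff)
      then show ?thesis using \<phi> by (simp add: s_def)
    qed
    then show "cmod (\<ointegral>z. L x z) \<le> N"
      unfolding diag[OF x] by (intro p_le s_cont x)
  qed
  finally show ?thesis by (simp add: M_def)
qed

text \<open>The sign of \<open>q\<close> is replaced by the continuous function \<open>q / (\<bar>q\<bar> + \<delta>)\<close>, and this by a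
  polynomial.\<close>

lemma sign_approximation:
  fixes q :: "real poly" and e :: "real ^ 'n"
  assumes e: "norm e = 1"
    and le: "\<And>\<phi> :: real poly. (\<And>t. t \<in> {-1..1} \<Longrightarrow> \<bar>poly \<phi> t\<bar> \<le> 1) \<Longrightarrow>
      (\<ointegral>x. poly q (x \<bullet> e) * poly \<phi> (x \<bullet> e)) \<le> N"
  shows "(\<ointegral>x. \<bar>poly q (x \<bullet> e)\<bar>) \<le> N"
proof -
  define K where "K = (\<ointegral>x. \<bar>poly q (x \<bullet> e)\<bar>)"
  have N0: "0 \<le> N" using le[of 0] by simp
  have K0: "0 \<le> K" by (simp add: K_def)
  have main: "K \<le> N + \<delta> * (N + K + 1)" if \<delta>: "\<delta> > 0" for \<delta>
  proof -
    define \<psi> where "\<psi> t = poly q t / (\<bar>poly q t\<bar> + \<delta>)" for t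
    have pos: "\<bar>poly q t\<bar> + \<delta> > 0" for t using \<delta> by (simp add: add_nonneg_pos)
    have "continuous_on {-1..1} \<psi>"
      unfolding \<psi>_def[abs_def] using pos by (intro continuous_intros) (auto simp: less_imp_neq[symmetric])
    then obtain g where g: "real_polynomial_function g" "\<And>t. t \<in> {-1..1} \<Longrightarrow> \<bar>\<psi> t - g t\<bar> < \<delta>"
      using Stone_Weierstrass_real_polynomial_function[of "{-1..1}" \<psi> \<delta>] \<delta> by auto
    obtain a m where am: "g = (\<lambda>t. \<Sum>i\<le>m. a i * t ^ i)"
      using g(1) by (auto simp: real_polynomial_function_iff_sum)
    define r where "r = (\<Sum>i\<le>m. monom (a i) i)"
    have gr: "g t = poly r t" for t by (simp add: am r_def poly_sum poly_monom)
    \<comment> \<open>|\<open>\<psi>\<close>| <= 1 only gives |r| <= 1 + \<open>\<delta>\<close>,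
      hence the scaling.\<close>
    define \<phi> where "\<phi> = Polynomial.smult (1 / (1 + \<delta>)) r"
    have "\<bar>poly \<phi> t\<bar> \<le> 1" if t: "t \<in> {-1..1}" for t
    proof -
      have "\<bar>\<psi> t\<bar> \<le> 1" unfolding \<psi>_def using pos[of t] \<delta> by (simp add: abs_divide)
      then have "\<bar>poly r t\<bar> \<le> 1 + \<delta>" using g(2)[OF t] gr[of t] by linarith
      then show ?thesis using \<delta> by (simp add: \<phi>_def abs_mult abs_divide)
    qed
    from le[OF this] have "(\<ointegral>x. poly q (x \<bullet> e) * poly \<phi> (x \<bullet> e)) \<le> N" .
    also have "(\<ointegral>x. poly q (x \<bullet> e) * poly \<phi> (x \<bullet> e))
        = (\<ointegral>x. poly q (x \<bullet> e) * poly r (x \<bullet> e)) / (1 + \<delta>)"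
      by (simp add: \<phi>_def)
    finally have "(\<ointegral>x. poly q (x \<bullet> e) * poly r (x \<bullet> e)) \<le> N * (1 + \<delta>)"
      using \<delta> by (simp add: field_simps)
    \<comment> \<open>From (|q| - \<open>\<delta>\<close>) (|q| + \<open>\<delta>\<close>) <= q^2
      comes |q| - \<open>\<delta>\<close> <= q \<open>\<psi>\<close>, and replacing
      \<open>\<psi>\<close> by r loses at most \<open>\<delta>\<close> |q|.\<close>
    moreover have "(\<ointegral>x. (1 - \<delta>) * \<bar>poly q (x \<bullet> e)\<bar> - \<delta>) \<le> (\<ointegral>x. poly q (x \<bullet> e) * poly r (x \<bullet> e))"
    proof (rule integral_mono)
      fix x :: "real ^ 'n" assume "x \<in> space sphere_measure"
      then have t: "x \<bullet> e \<in> {-1..1}" using Cauchy_Schwarz_ineq2[of x e] e by (auto simp: abs_le_iff)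
      let ?t = "x \<bullet> e"
      have "\<bar>poly q ?t\<bar> - \<delta> \<le> poly q ?t * \<psi> ?t"
      proof -
        have "(\<bar>poly q ?t\<bar> - \<delta>) * (\<bar>poly q ?t\<bar> + \<delta>) \<le> poly q ?t * poly q ?t"
          using abs_mult_self_eq[of "poly q ?t"] by (simp add: algebra_simps)
        then show ?thesis
          unfolding \<psi>_def times_divide_eq_right using pos[of ?t] by (simp add: pos_le_divide_eq)
      qed
      moreover have "poly q ?t * (\<psi> ?t - poly r ?t) \<le> \<bar>poly q ?t\<bar> * \<delta>"
      proof -
        have "poly q ?t * (\<psi> ?t - poly r ?t) \<le> \<bar>poly q ?t\<bar> * \<bar>\<psi> ?t - poly r ?t\<bar>"
          by (metis abs_ge_self abs_mult)
        also have "\<dots> \<le> \<bar>poly q ?t\<bar> * \<delta>"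
          using g(2)[OF t] gr by (intro mult_left_mono) auto
        finally show ?thesis .
      qed
      ultimately show "(1 - \<delta>) * \<bar>poly q ?t\<bar> - \<delta> \<le> poly q ?t * poly r ?t"
        by (simp add: algebra_simps)
    qed (intro integrable_sphere_measure continuous_intros)+
    moreover have "(\<ointegral>x. (1 - \<delta>) * \<bar>poly q (x \<bullet> e)\<bar> - \<delta>) = (1 - \<delta>) * K - \<delta>"
      by (subst Bochner_Integration.integral_diff)
         (auto simp: K_def intro!: integrable_sphere_measure continuous_intros)
    ultimately show ?thesis by (simp add: algebra_simps)
  qed
  have "K \<le> N"
  proof (rule field_le_epsilon)
    fix \<epsilon> :: real assume \<epsilon>: "0 < \<epsilon>"
    have "N + K + 1 > 0" using N0 K0 by simp
    then show "K \<le> N + \<epsilon>" using main[of "\<epsilon> / (N + K + 1)"] \<epsilon> by simp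
  qed
  then show ?thesis by (simp add: K_def)
qed

text \<open>\<open>p\<close> reads P as an operator on functions on the sphere, with
  \<open>I\<close> restricting and tagging them. Continuous functions on the compact sphere are
  bounded and so belong to the ambient space, which lets \<open>projection_trace\<close> apply to an
  arbitrary P.\<close>

lemma relative_projection_constant_Inr_ge:
  fixes q :: "real poly" and e :: "real ^ 'n"
  assumes n: "CARD('n) > 2" and q: "zonal_kernel TYPE('n) d q" and e: "norm e = 1"
  shows "ereal (\<ointegral>x. \<bar>poly q (x \<bullet> e)\<bar>) \<le>
    relative_projection_constant (sphere_functions :: ('u + (real ^ 'n \<Rightarrow> complex)) cnormed)
      (Inr ` carrier (sphere_polynomials d))"
  unfolding relative_projection_constant_def
proof (rule INF_greatest)
  let ?Y = "sphere_functions :: ('u + (real ^ 'n \<Rightarrow> complex)) cnormed"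
  let ?S = "sphere (0 :: real ^ 'n) 1"
  let ?X = "sphere_polynomials d :: (real ^ 'n \<Rightarrow> complex) cnormed"
  let ?Z = "?Y\<lparr>carrier := Inr ` carrier ?X\<rparr>"
  fix P assume "P \<in> {P. bounded_linear_between ?Y ?Z P \<and> (\<forall>x\<in>Inr ` carrier ?X. P x = x)}"
  then have bl: "bounded_linear_between ?Y ?Z P" and id: "\<And>f. f \<in> carrier ?X \<Longrightarrow> P (Inr f) = Inr f"
    by (auto simp del: sphere_polynomials_simps)
  have P_closed: "P a \<in> Inr ` carrier ?X" and P_smult: "P (c \<odot>\<^bsub>?Y\<^esub> a) = c \<odot>\<^bsub>?Y\<^esub> P a"
    if "a \<in> carrier ?Y" for a c
    using bl that unfolding bounded_linear_between_def linear_between_def by auto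
  have P_add: "P (a \<oplus>\<^bsub>?Y\<^esub> b) = P a \<oplus>\<^bsub>?Y\<^esub> P b" if "a \<in> carrier ?Y" "b \<in> carrier ?Y" for a b
    using bl that unfolding bounded_linear_between_def linear_between_def by auto
  interpret complex_normed_space ?Y by (rule complex_normed_space_sphere_functions)
  have XY: "Inr f \<in> carrier ?Y" if "f \<in> carrier ?X" for f
    using isometric_embedding_Inr[of d] that unfolding isometric_embedding_def linear_between_def by blast
  define I where "I f = (Inr (restrict f ?S) :: 'u + (real ^ 'n \<Rightarrow> complex))" for f
  have I_closed: "I f \<in> carrier ?Y" if f: "continuous_on ?S f" for f
  proof -
    have "compact (f ` ?S)" using f by (intro compact_continuous_image) auto
    then obtain B where "\<And>z. z \<in> ?S \<Longrightarrow> cmod (f z) \<le> B"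
      using compact_imp_bounded bounded_iff by (metis imageI)
    then show ?thesis unfolding I_def by (rule sphere_functionsI)
  qed
  define p where "p f = projr (P (I f))" for f
  \<comment> \<open>The operator norm is a real supremum; boundedness of P makes it an upper bound
    of the values.\<close>
  have op_bound: "nrm ?Y (P a) \<le> op_norm ?Y ?Z P" if a: "a \<in> carrier ?Y" "nrm ?Y a \<le> 1" for a
  proof -
    obtain C where C: "\<And>x. x \<in> carrier ?Y \<Longrightarrow> nrm ?Y (P x) \<le> C * nrm ?Y x"
      using bl unfolding bounded_linear_between_def by auto
    have "bdd_above ((\<lambda>x. nrm ?Z (P x)) ` {x \<in> carrier ?Y. nrm ?Y x \<le> 1})"
    proof (rule bdd_aboveI2[where M = "\<bar>C\<bar>"])
      fix x assume x: "x \<in> {x \<in> carrier ?Y. nrm ?Y x \<le> 1}"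
      then have "nrm ?Y (P x) \<le> C * nrm ?Y x" using C by blast
      also have "\<dots> \<le> \<bar>C\<bar> * nrm ?Y x" using x nrm_nonneg by (intro mult_right_mono) auto
      also have "\<dots> \<le> \<bar>C\<bar> * 1" using x by (intro mult_left_mono) auto
      finally show "nrm ?Z (P x) \<le> \<bar>C\<bar>" by simp
    qed
    then have "nrm ?Z (P a) \<le> op_norm ?Y ?Z P"
      unfolding op_norm_def using a by (intro cSUP_upper) auto
    then show ?thesis by simp
  qed
  have "(\<ointegral>x. \<bar>poly q (x \<bullet> e)\<bar>) \<le> op_norm ?Y ?Z P"
  proof (rule sign_approximation[OF e], rule projection_trace[OF n q e, where p = p])
    show "p f \<in> carrier ?X" if "continuous_on ?S f" for f
      using P_closed[OF I_closed[OF that]] by (auto simp: p_def simp del: sphere_polynomials_simps)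
    show "p f = p g" if "\<And>x. x \<in> ?S \<Longrightarrow> f x = g x" for f g
    proof -
      have "I f = I g" using that by (simp add: I_def cong: restrict_cong)
      then show ?thesis by (simp add: p_def)
    qed
    show "p (\<lambda>y. f y + g y) x = p f x + p g x" if "continuous_on ?S f" "continuous_on ?S g" "x \<in> ?S" for f g x
    proof -
      have "I (\<lambda>y. f y + g y) = I f \<oplus>\<^bsub>?Y\<^esub> I g" by (simp add: I_def cong: restrict_cong)
      then show ?thesis
        using P_add[OF I_closed[OF that(1)] I_closed[OF that(2)]] that(3) by (simp add: p_def)
    qed
    show "p (\<lambda>y. c * f y) x = c * p f x" if "continuous_on ?S f" "x \<in> ?S" for c f x
    proof -
      have "I (\<lambda>y. c * f y) = c \<odot>\<^bsub>?Y\<^esub> I f" by (simp add: I_def cong: restrict_cong)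
      then show ?thesis
        using P_smult[OF I_closed[OF that(1)], of c] that(2) by (simp add: p_def)
    qed
    show "p f x = f x" if "f \<in> homogeneous_polynomials d" "x \<in> ?S" for f x
      using id[of "restrict f ?S"] that by (simp add: p_def I_def)
    show "cmod (p f x) \<le> op_norm ?Y ?Z P"
      if f: "continuous_on ?S f" and le: "\<And>y. y \<in> ?S \<Longrightarrow> cmod (f y) \<le> 1" and x: "x \<in> ?S" for f x
    proof -
      have "nrm ?Y (I f) \<le> 1"
        using le by (intro nrm_sphere_functions_le) (simp add: I_def)
      then have "nrm ?Y (P (I f)) \<le> op_norm ?Y ?Z P" by (rule op_bound[OF I_closed[OF f]])
      moreover have "P (I f) \<in> carrier ?Y"
        by (rule imageE[OF P_closed[OF I_closed[OF f]]]) (simp only: XY)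
      then have "cmod (p f x) \<le> nrm ?Y (P (I f))"
        unfolding p_def by (rule cmod_le_nrm_sphere_functions[OF _ x])
      ultimately show ?thesis by linarith
    qed
  qed
  then show "ereal (\<ointegral>x. \<bar>poly q (x \<bullet> e)\<bar>) \<le> ereal (op_norm ?Y ?Z P)" by simp
qed

text \<open>The summand \<open>real ^ 'n => complex\<close> of the element type gives room for the
  function space at which the supremum is attained; the upper bound holds for Banach spaces over any
  type, so \<open>'u\<close> can be arbitrary.\<close>

theorem theorem4p6:
  fixes n d :: nat
  assumes "CARD('n::finite) = n" and "n > 2" and "d \<ge> 1"
  shows "projection_constant TYPE('u + (real ^ 'n \<Rightarrow> complex))
           (sphere_polynomials d :: (real ^ 'n \<Rightarrow> complex) cnormed) =
         ereal (1 / (2 * sqrt pi) *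
           (Gamma (real n / 2) * Gamma (real d + real n)) /
           (Gamma (real n - 1) * Gamma (real d + (real n + 1) / 2)) *
           integral {-1..1} (\<lambda>t.
             \<bar>poly (jacobi_poly ((real n - 1) / 2) ((real n - 1) / 2) d) t\<bar> *
             (1 - t\<^sup>2) powr ((real n - 3) / 2)))"
    (is "_ = ereal ?K")
proof -
  obtain q where q: "zonal_kernel TYPE('n) d q"
    and K: "\<And>y :: real ^ 'n. norm y = 1 \<Longrightarrow> (\<ointegral>x. \<bar>poly q (x \<bullet> y)\<bar>) = ?K"
    by (rule zonal_kernelE[OF assms(1,2), of d, unfolded jacobi_integral_def]) (rule that)
  let ?X = "sphere_polynomials d :: (real ^ 'n \<Rightarrow> complex) cnormed"
  let ?Y = "sphere_functions :: ('u + (real ^ 'n \<Rightarrow> complex)) cnormed"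
  obtain e :: "real ^ 'n" where "e \<in> sphere 0 1"
    using sphere_nonempty by blast
  then have e: "norm e = 1" by simp
  have "ereal ?K \<le> relative_projection_constant ?Y (Inr ` carrier ?X)"
    using relative_projection_constant_Inr_ge[OF _ q e] K[OF e] assms(1,2) by simp
  also have "\<dots> \<le> projection_constant TYPE('u + (real ^ 'n \<Rightarrow> complex)) ?X"
    unfolding projection_constant_def
    using complex_banach_space_sphere_functions isometric_embedding_Inr
    by (intro SUP_upper2[where i = "(?Y, Inr)"]) auto
  finally have "ereal ?K \<le> projection_constant TYPE('u + (real ^ 'n \<Rightarrow> complex)) ?X" .
  moreover have "projection_constant TYPE('u + (real ^ 'n \<Rightarrow> complex)) ?X \<le> ereal ?K"
    unfolding projection_constant_def
  proof (rule SUP_least, clarify)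
    fix Y :: "('u + (real ^ 'n \<Rightarrow> complex)) cnormed" and J
    assume "complex_banach_space Y" and J: "isometric_embedding ?X Y J"
    then have "complex_normed_space Y" by (simp add: complex_banach_space_def)
    from projection_onto_sphere_polynomials[OF this q K J]
    show "relative_projection_constant Y (J ` carrier ?X) \<le> ereal ?K" .
  qed
  ultimately show ?thesis by (rule antisym[rotated])
qed

end
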